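(* Let $\Omega$ be a bounded domain in $\mathbb{C}^d$, let $E$ be a good zero variety of $\Omega$, and let $F:\Omega\to\mathbb{C}^d$ be holomorphic on $\overline{\Omega}$ such that the image of $F$ contains an interior point. Then $F^{-1}(F(\overline{E}))=\{z\in\Omega: F(z)\in F(\overline{E})\}$ is $L^2_a$-removable in $\Omega$, and $F(\overline{E})$ is $L^2_a$-removable in the sense that for every domain $D\subseteq\mathbb{C}^d$ containing $F(\Omega)$, the set $F(\overline E)\cap D$ is $L^2_a$-removable in $D$.
   Context: "Holomorphic on $\overline{\Omega}$" means holomorphic on an open neighborhood of $\overline{\Omega}$; $\overline E$ denotes the closure of $E$ in $\overline{\Omega}$. A zero variety of $\Omega$ is a set $\{z\in\Omega: f(z)=0\}$ with $f$ a nonconstant holomorphic function on $\Omega$. A zero variety $E$ is good if for each $\lambda\in\overline\Omega$ there is an open ball $U$ centered at $\lambda$ and a holomorphic function $h$ on $U$ with $U\cap\overline E=\{z\in U\cap\overline\Omega: h(z)=0\}$. For a domain $D$, $L^2_a(D)$ is the Bergman space of holomorphic functions on $D$ square integrable w.r.t. Lebesgue measure. A relatively closed subset $\mathcal{E}$ of a domain $D$ is $L^2_a$-removable in $D$ if every function in $L^2_a(D\setminus\mathcal{E})$ extends analytically to a function in $L^2_a(D)$. *)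

theory Defs
  imports "HOL-Analysis.Analysis"
begin

definition holo_on :: "(complex^'n \<Rightarrow> complex) \<Rightarrow> (complex^'n) set \<Rightarrow> bool" where
  "holo_on f U \<longleftrightarrow> (\<forall>z\<in>U. \<exists>L. (f has_derivative L) (at z) \<and> (\<forall>c w. L (c *s w) = c * L w))"

definition holo_map_on :: "(complex^'n \<Rightarrow> complex^'m) \<Rightarrow> (complex^'n) set \<Rightarrow> bool" where
  "holo_map_on F U \<longleftrightarrow> (\<forall>i. holo_on (\<lambda>z. F z $ i) U)"

definition holo_on_closure :: "(complex^'n \<Rightarrow> complex^'m) \<Rightarrow> (complex^'n) set \<Rightarrow> bool" where
  "holo_on_closure F \<Omega> \<longleftrightarrow> (\<exists>U. open U \<and> closure \<Omega> \<subseteq> U \<and> holo_map_on F U)"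

definition domain :: "(complex^'n) set \<Rightarrow> bool" where
  "domain D \<longleftrightarrow> open D \<and> connected D \<and> D \<noteq> {}"

definition zero_variety :: "(complex^'n) set \<Rightarrow> (complex^'n) set \<Rightarrow> bool" where
  "zero_variety \<Omega> E \<longleftrightarrow> (\<exists>f. holo_on f \<Omega> \<and> \<not> (\<exists>c. \<forall>z\<in>\<Omega>. f z = c) \<and> E = {z\<in>\<Omega>. f z = 0})"

definition good_zero_variety :: "(complex^'n) set \<Rightarrow> (complex^'n) set \<Rightarrow> bool" where
  "good_zero_variety \<Omega> E \<longleftrightarrow> zero_variety \<Omega> E \<and>
     (\<forall>p\<in>closure \<Omega>. \<exists>r>0. \<exists>h. holo_on h (ball p r) \<and>
        ball p r \<inter> closure E = {z \<in> ball p r \<inter> closure \<Omega>. h z = 0})"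

definition bergman :: "(complex^'n) set \<Rightarrow> (complex^'n \<Rightarrow> complex) set" where
  "bergman D = {f. holo_on f D \<and> set_integrable lborel D (\<lambda>z. (cmod (f z))\<^sup>2)}"

definition L2a_removable :: "(complex^'n) set \<Rightarrow> (complex^'n) set \<Rightarrow> bool" where
  "L2a_removable D \<E> \<longleftrightarrow> \<E> \<subseteq> D \<and> closedin (top_of_set D) \<E> \<and>
     (\<forall>f\<in>bergman (D - \<E>). \<exists>g\<in>bergman D. \<forall>z\<in>D - \<E>. g z = f z)"

end

theory Submission
  imports Defs "HOL-Complex_Analysis.Complex_Analysis"
begin

text \<open>
  Call a set of codimension two if for every \<open>e \<le> 1\<close> it is covered by \<open>O(e\<^sup>2\<^sup>-\<^sup>m)\<close> balls of radius \<open>e\<close>,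
  \<open>m\<close> being the real dimension. Countable unions of such sets are \<open>L\<^sup>2\<close>-removable: the cutoffs
  adapted to the covering have gradients of size \<open>1/e\<close> on a set of volume \<open>O(e\<^sup>2)\<close>, so they are bounded in the
  Dirichlet norm, and since \<open>|f|\<^sup>2\<close> has little mass near the set, \<open>f\<close> satisfies the Cauchy--Riemann equations
  weakly across it. Convolving with a radial kernel then reproduces \<open>f\<close>, which gives the extension.

  The zero set of a holomorphic \<open>h\<close> that does not vanish identically lies in countably many sets
  \<open>{g = 0, \<partial>g/\<partial>v \<noteq> 0}\<close>, where \<open>g\<close> is an iterated derivative of \<open>h\<close> in the direction \<open>v\<close>;
  each of them is locally a Lipschitz graph, hence of codimension two. So is the image under \<open>F\<close>, which is
  locally Lipschitz, and so is the preimage of that image: off the critical set \<open>F\<close> is locally bi-Lipschitz,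
  and the critical set is the zero set of the Jacobian determinant, which is not identically zero by Sard's lemma.
\<close>

section \<open>Sets of finite codimension-two content\<close>

text \<open>Counting balls of one common radius, as opposed to Hausdorff measure, gives one cutoff
  per scale: a function of the distance to finitely many centres. Such cutoffs are merely Lipschitz,
  so the weak equation is obtained from difference quotients, with translation invariance of
  Lebesgue measure in the role of integration by parts. Compactness of the support of a test
  function reduces a countable union to finitely many pieces; the n-th piece is allowed an error
  proportional to 2^-(n+1). Reproduction rests on one identity: the derivative of the kernel in its
  scale is a dbar-divergence. Hence the smoothed function does not depend on the scale, and
  shrinking the kernel identifies it with \<open>f\<close>. The same formula shows that bounded
  pointwise limits of holomorphic functions are holomorphic; so directional derivatives are
  holomorphic, and strict differentiability follows, which supplies the graph and bi-Lipschitz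
  estimates. Goodness enters because points of \<open>closure E\<close> on the boundary of \<Omega>
  need a local equation too: their images may lie inside the domain where removability is
  claimed.\<close>

text \<open>The \<open>(m - 2)\<close>-dimensional upper Minkowski content is finite, \<open>m = DIM('a)\<close>; multiplying
  by \<open>e ^ m\<close> avoids the truncated exponent \<open>m - 2\<close>.\<close>
definition codim_two :: "'a::euclidean_space set \<Rightarrow> bool" where
  "codim_two K \<longleftrightarrow> (\<exists>C. \<forall>e. 0 < e \<and> e \<le> 1 \<longrightarrow>
     (\<exists>T. finite T \<and> K \<subseteq> (\<Union>t\<in>T. cball t e) \<and> real (card T) * e ^ DIM('a) \<le> C * e\<^sup>2))"

text \<open>Inclusion instead of equality lets the notion pass to arbitrary subsets, measurable or
  not.\<close>

definition sigma_codim_two :: "'a::euclidean_space set \<Rightarrow> bool" where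
  "sigma_codim_two S \<longleftrightarrow> (\<exists>K::nat \<Rightarrow> 'a set. (\<forall>n. codim_two (K n)) \<and> S \<subseteq> (\<Union>n. K n))"

lemma codim_two_subset: "codim_two K \<Longrightarrow> L \<subseteq> K \<Longrightarrow> codim_two L"
  unfolding codim_two_def by (meson subset_trans)

lemma codim_two_empty: "codim_two {}"
  unfolding codim_two_def by (intro exI[of _ 0] allI impI exI[of _ "{}"]) auto

lemma codim_two_lipschitz_image:
  fixes f :: "'a::euclidean_space \<Rightarrow> 'a"
  assumes "codim_two K" and lip: "\<And>x y. x \<in> K \<Longrightarrow> y \<in> K \<Longrightarrow> dist (f x) (f y) \<le> L * dist x y"
  shows "codim_two (f ` K)"
proof -
  \<comment> \<open>Raising the constant to at least 1 makes \<open>e'\<close> below at most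
    \<open>e\<close>, so a cover of scale \<open>e'\<close> is available and the square of
    \<open>e'\<close> may be enlarged to that of \<open>e\<close>.\<close>
  define M where "M = max L 1"
  have M: "M \<ge> 1" and lipM: "\<And>x y. x \<in> K \<Longrightarrow> y \<in> K \<Longrightarrow> dist (f x) (f y) \<le> M * dist x y"
    unfolding M_def by (simp, smt (verit) lip mult_right_mono zero_le_dist max.cobounded1)
  obtain C where C: "\<And>e. 0 < e \<Longrightarrow> e \<le> 1 \<Longrightarrow>
      \<exists>T. finite T \<and> K \<subseteq> (\<Union>t\<in>T. cball t e) \<and> real (card T) * e ^ DIM('a) \<le> C * e\<^sup>2"
    using assms(1) unfolding codim_two_def by blast
  have C0: "C \<ge> 0"
  proof -
    obtain T :: "'a set" where "real (card T) * 1 ^ DIM('a) \<le> C * 1\<^sup>2"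
      using C[of 1] by auto
    then have "real (card T) \<le> C" by simp
    then show ?thesis by (rule order_trans[OF of_nat_0_le_iff])
  qed
  show ?thesis
    unfolding codim_two_def
  proof (intro exI[of _ "C * (2*M) ^ DIM('a)"] allI impI)
    fix e :: real
    assume e: "0 < e \<and> e \<le> 1"
    define e' where "e' = e / (2 * M)"
    have e': "0 < e'" "e' \<le> 1" "e' \<le> e" "e = e' * (2 * M)"
    proof -
      have "e \<le> e * (2 * M)" using e M by (simp add: mult_le_cancel_left1)
      then show "e' \<le> e" unfolding e'_def using M by (simp add: divide_le_eq)
      then show "e' \<le> 1" using e by simp
    qed (use e M in \<open>auto simp: e'_def\<close>)
    obtain T where T: "finite T" "K \<subseteq> (\<Union>t\<in>T. cball t e')" "real (card T) * e' ^ DIM('a) \<le> C * e'\<^sup>2"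
      using C[OF e'(1,2)] by auto
    define T0 where "T0 = {t \<in> T. cball t e' \<inter> K \<noteq> {}}"
    have "\<forall>t\<in>T0. \<exists>x. x \<in> cball t e' \<inter> K" unfolding T0_def by blast
    then obtain x where x: "\<And>t. t \<in> T0 \<Longrightarrow> x t \<in> cball t e' \<inter> K"
      by metis
    show "\<exists>T. finite T \<and> f ` K \<subseteq> (\<Union>t\<in>T. cball t e) \<and> real (card T) * e ^ DIM('a) \<le> C * (2*M) ^ DIM('a) * e\<^sup>2"
    proof (intro exI[of _ "(\<lambda>t. f (x t)) ` T0"] conjI)
      show "finite ((\<lambda>t. f (x t)) ` T0)" using T(1) T0_def by auto
      show "f ` K \<subseteq> (\<Union>t\<in>(\<lambda>t. f (x t)) ` T0. cball t e)"
      proof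
        fix y assume "y \<in> f ` K"
        then obtain k where k: "k \<in> K" "y = f k" by blast
        then obtain t where t: "t \<in> T" "k \<in> cball t e'" using T(2) by blast
        then have tT: "t \<in> T0" using k unfolding T0_def by blast
        have "dist (f (x t)) (f k) \<le> M * dist (x t) k" using lipM x[OF tT] k by blast
        also have "\<dots> \<le> M * (2 * e')"
          using x[OF tT] t M by (intro mult_left_mono) (auto simp: dist_commute intro: dist_triangle_le[where z=t])
        finally show "y \<in> (\<Union>t\<in>(\<lambda>t. f (x t)) ` T0. cball t e)"
          using tT k e'(4) by (auto simp: mult_ac)
      qed
      have "card ((\<lambda>t. f (x t)) ` T0) \<le> card T"
        by (rule order_trans[OF card_image_le card_mono]) (use T(1) T0_def in auto)
      then have "real (card ((\<lambda>t. f (x t)) ` T0)) * e ^ DIM('a) \<le> real (card T) * e ^ DIM('a)"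
        using e by (intro mult_right_mono) auto
      also have "\<dots> = (real (card T) * e' ^ DIM('a)) * (2*M) ^ DIM('a)"
        by (simp add: e'(4) power_mult_distrib)
      also have "\<dots> \<le> (C * e'\<^sup>2) * (2*M) ^ DIM('a)"
        using T(3) M by (intro mult_right_mono) auto
      also have "\<dots> \<le> (C * e\<^sup>2) * (2*M) ^ DIM('a)"
        using e' M C0 by (intro mult_right_mono mult_left_mono power_mono) auto
      finally show "real (card ((\<lambda>t. f (x t)) ` T0)) * e ^ DIM('a) \<le> C * (2*M) ^ DIM('a) * e\<^sup>2"
        by (simp add: mult_ac)
    qed
  qed
qed

lemma codim_two_imp_sigma: "codim_two K \<Longrightarrow> sigma_codim_two K"
  unfolding sigma_codim_two_def by (intro exI[of _ "\<lambda>_. K"]) auto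

lemma sigma_codim_two_subset: "sigma_codim_two S \<Longrightarrow> R \<subseteq> S \<Longrightarrow> sigma_codim_two R"
  unfolding sigma_codim_two_def by (meson subset_trans)

lemma sigma_codim_two_Union_nat:
  assumes "\<And>n::nat. sigma_codim_two (S n)"
  shows "sigma_codim_two (\<Union>n. S n)"
proof -
  obtain K :: "nat \<Rightarrow> nat \<Rightarrow> 'a set" where K: "\<And>n m. codim_two (K n m)" "\<And>n. S n \<subseteq> (\<Union>m. K n m)"
    using assms unfolding sigma_codim_two_def by metis
  have "(\<Union>n. S n) \<subseteq> (\<Union>k. case_prod K (prod_decode k))"
  proof
    fix x assume "x \<in> (\<Union>n. S n)"
    then obtain n m where "x \<in> K n m" using K(2) by blast
    then show "x \<in> (\<Union>k. case_prod K (prod_decode k))"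
      by (intro UN_I[of "prod_encode (n, m)"]) auto
  qed
  then show ?thesis
    unfolding sigma_codim_two_def using K(1)
    by (intro exI[of _ "\<lambda>k. case_prod K (prod_decode k)"]) (auto split: prod.splits)
qed

lemma sigma_codim_two_UN:
  assumes "countable I" "\<And>i. i \<in> I \<Longrightarrow> sigma_codim_two (S i)"
  shows "sigma_codim_two (\<Union>i\<in>I. S i)"
proof (cases "I = {}")
  case True
  then show ?thesis using codim_two_imp_sigma[OF codim_two_empty] by simp
next
  case False
  have "sigma_codim_two (\<Union>n. S (from_nat_into I n))"
    by (intro sigma_codim_two_Union_nat assms(2) from_nat_into False)
  moreover have "(\<Union>n. S (from_nat_into I n)) = (\<Union>i\<in>I. S i)"
    using assms(1) False by (metis UN_extend_simps(10) range_from_nat_into)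
  ultimately show ?thesis by simp
qed

lemma sigma_codim_two_Un:
  "sigma_codim_two A \<Longrightarrow> sigma_codim_two B \<Longrightarrow> sigma_codim_two (A \<union> B)"
  using sigma_codim_two_UN[of "{A, B}" "\<lambda>X. X"] by auto

text \<open>Lindelof's theorem extracts countably many of the neighbourhoods, so smallness only has
  to be checked near each point of \<open>S\<close>.\<close>

lemma sigma_codim_two_locally:
  assumes "\<And>x. x \<in> S \<Longrightarrow> \<exists>U. open U \<and> x \<in> U \<and> sigma_codim_two (S \<inter> U)"
  shows "sigma_codim_two S"
proof -
  define F where "F = {U. open U \<and> sigma_codim_two (S \<inter> U)}"
  obtain F' where F': "F' \<subseteq> F" "countable F'" "\<Union>F' = \<Union>F"
    using Lindelof[of F] unfolding F_def by blast
  have "S \<subseteq> \<Union>F" using assms unfolding F_def by blast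
  then have "S \<subseteq> (\<Union>U\<in>F'. S \<inter> U)" using F'(3) by blast
  moreover have "sigma_codim_two (\<Union>U\<in>F'. S \<inter> U)"
    using F' by (intro sigma_codim_two_UN) (auto simp: F_def)
  ultimately show ?thesis by (rule sigma_codim_two_subset[rotated])
qed

lemma sigma_codim_two_lipschitz_image:
  fixes f :: "'a::euclidean_space \<Rightarrow> 'a"
  assumes "sigma_codim_two S" "\<And>x y. x \<in> S \<Longrightarrow> y \<in> S \<Longrightarrow> dist (f x) (f y) \<le> L * dist x y"
  shows "sigma_codim_two (f ` S)"
proof -
  obtain K :: "nat \<Rightarrow> 'a set" where K: "\<And>n. codim_two (K n)" "S \<subseteq> (\<Union>n. K n)"
    using assms(1) unfolding sigma_codim_two_def by blast
  have "codim_two (f ` (K n \<inter> S))" for n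
    using assms(2) by (intro codim_two_lipschitz_image[where L=L] codim_two_subset[OF K(1)]) auto
  then show ?thesis
    unfolding sigma_codim_two_def using K(2)
    by (intro exI[of _ "\<lambda>n. f ` (K n \<inter> S)"]) blast
qed

lemma sigma_codim_two_locally_lipschitz_image:
  fixes f :: "'a::euclidean_space \<Rightarrow> 'a"
  assumes S: "sigma_codim_two S"
    and lip: "\<And>x. x \<in> S \<Longrightarrow> \<exists>U L. open U \<and> x \<in> U \<and> (\<forall>y\<in>U. \<forall>z\<in>U. dist (f y) (f z) \<le> L * dist y z)"
  shows "sigma_codim_two (f ` S)"
proof -
  define F where "F = {U. open U \<and> (\<exists>L. \<forall>y\<in>U. \<forall>z\<in>U. dist (f y) (f z) \<le> L * dist y z)}"
  obtain F' where F': "F' \<subseteq> F" "countable F'" "\<Union>F' = \<Union>F"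
    using Lindelof[of F] unfolding F_def by blast
  have "S \<subseteq> \<Union>F" using lip unfolding F_def by blast
  then have "f ` S \<subseteq> (\<Union>U\<in>F'. f ` (S \<inter> U))" using F'(3) by blast
  moreover have "sigma_codim_two (f ` (S \<inter> U))" if UF: "U \<in> F'" for U
  proof -
    obtain L where "\<forall>y\<in>U. \<forall>z\<in>U. dist (f y) (f z) \<le> L * dist y z"
      using UF F'(1) unfolding F_def by auto
    then show ?thesis
      by (intro sigma_codim_two_lipschitz_image[where L=L] sigma_codim_two_subset[OF S]) auto
  qed
  ultimately show ?thesis
    using sigma_codim_two_UN[OF F'(2)] sigma_codim_two_subset by metis
qed

section \<open>Packing estimates and transversal thickening\<close>

text \<open>Volume comparison: the balls of radius \<open>r\<close> about the points of
  \<open>P\<close> are disjoint and lie in the ball of radius \<open>R + r\<close>; the volume of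
  the unit ball cancels.\<close>

lemma card_separated_bound:
  fixes P :: "'a::euclidean_space set"
  assumes "finite P" "0 < r" "0 \<le> R" "P \<subseteq> ball 0 R"
    and sep: "\<And>x y. x \<in> P \<Longrightarrow> y \<in> P \<Longrightarrow> x \<noteq> y \<Longrightarrow> 2 * r \<le> dist x y"
  shows "real (card P) * r ^ DIM('a) \<le> (R + r) ^ DIM('a)"
proof -
  define V where "V = unit_ball_vol (real DIM('a))"
  have V: "V > 0" unfolding V_def by (rule unit_ball_vol_pos) auto
  have disj: "disjoint_family_on (\<lambda>x. ball x r) P"
    unfolding disjoint_family_on_def
  proof (intro ballI impI)
    fix x y assume xy: "x \<in> P" "y \<in> P" "x \<noteq> y"
    { fix z assume "dist x z < r" "dist y z < r"
      then have "dist x y < 2 * r" using dist_triangle[of x y z] by (simp add: dist_commute)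
      then have False using sep[OF xy] by simp }
    then show "ball x r \<inter> ball y r = {}" by auto
  qed
  have fin: "emeasure lborel (ball x r) \<noteq> \<infinity>" for x :: 'a
    using emeasure_lborel_ball_finite[of x r] by (metis less_irrefl)
  have "real (card P) * (V * r ^ DIM('a)) = (\<Sum>x\<in>P. measure lborel (ball x r))"
    using assms(2) by (simp add: content_ball V_def)
  also have "\<dots> = measure lborel (\<Union>x\<in>P. ball x r)"
    using assms(1) disj fin by (intro measure_finite_Union[symmetric]) auto
  also have "\<dots> \<le> measure lborel (ball (0::'a) (R + r))"
  proof (rule measure_mono_fmeasurable)
    show "(\<Union>x\<in>P. ball x r) \<subseteq> ball 0 (R + r)"
    proof
      fix y assume "y \<in> (\<Union>x\<in>P. ball x r)"
      then obtain x where x: "x \<in> P" "dist x y < r" by auto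
      then have "dist 0 x < R" using assms(4) by auto
      then show "y \<in> ball 0 (R + r)" using dist_triangle[of 0 y x] x by simp
    qed
    show "(\<Union>x\<in>P. ball x r) \<in> sets lborel"
      using assms(1) by (intro sets.finite_UN) auto
    show "ball 0 (R + r) \<in> fmeasurable lborel"
      using emeasure_lborel_ball_finite by (intro fmeasurableI) auto
  qed
  also have "\<dots> = V * (R + r) ^ DIM('a)"
    using assms(2,3) by (simp add: content_ball V_def)
  finally show ?thesis using V by (simp add: mult.left_commute)
qed

text \<open>Thickening a \<open>c\<close>-separated subset of \<open>K\<close> in the direction of \<open>\<iota>\<close> by a square grid gives
  about \<open>e\<^sup>-\<^sup>2\<close> times as many points, which are still separated.\<close>
lemma codim_two_transversal:
  fixes K :: "'a::euclidean_space set" and \<iota> :: "complex \<Rightarrow> 'a"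
  assumes "bounded K" "linear \<iota>" "0 < c"
    and norm_\<iota>: "\<And>s. norm (\<iota> s) = norm s"
    and c1: "\<And>z w s. z \<in> K \<Longrightarrow> w \<in> K \<Longrightarrow> c * norm (z - w) \<le> norm (z - w + \<iota> s)"
    and c2: "\<And>z w s. z \<in> K \<Longrightarrow> w \<in> K \<Longrightarrow> c * norm s \<le> norm (z - w + \<iota> s)"
  shows "codim_two K"
proof -
  obtain B where B: "0 < B" "K \<subseteq> ball 0 B"
    using \<open>bounded K\<close> by (metis bounded_subset_ballD)
  define D where "D = DIM('a)"
  \<comment> \<open>Points of \<open>K\<close> have norm below \<open>B\<close>, and a grid shift
    has norm at most \<open>2 * m * e\<close>, hence at most 4.\<close>
  define R where "R = B + 4"
  have R: "0 < R" using B R_def by simp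
  \<comment> \<open>The packing bound for radius \<open>c * e / 2\<close> in the ball of radius
    \<open>R\<close>, made independent of \<open>e\<close> by \<open>e \<le> 1\<close>.\<close>
  define C where "C = ((R + c) / (c / 2)) ^ D"
  have bound: "real (card T) * e ^ D \<le> C * e\<^sup>2"
    if e: "0 < e" "e \<le> 1" and T: "finite T" "T \<subseteq> K"
      and sep: "\<And>x y. x \<in> T \<Longrightarrow> y \<in> T \<Longrightarrow> x \<noteq> y \<Longrightarrow> e \<le> dist x y" for e T
  proof -
    \<comment> \<open>An \<open>m\<close> by \<open>m\<close> grid of mesh \<open>e\<close> has side
      comparable to 1, so it multiplies the number of points by about 1/e^2.\<close>
    define m where "m = nat \<lceil>1 / e\<rceil>"
    have m: "1 \<le> real m * e" "real m * e \<le> 2"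
    proof -
      have "1 / e \<le> real m" unfolding m_def using e by (simp add: real_nat_ceiling_ge)
      then show "1 \<le> real m * e" using e by (simp add: field_simps)
      have "real m \<le> 1 / e + 1" unfolding m_def using e by (simp add: of_nat_ceiling le_of_int_ceiling)
      then have "real m * e \<le> (1 / e + 1) * e" using e by (intro mult_right_mono) auto
      also have "\<dots> = 1 + e" using e by (simp add: field_simps)
      finally show "real m * e \<le> 2" using e by simp
    qed
    define p where "p = (\<lambda>(t, a, b). t + \<iota> (of_real e * Complex (real a) (real b)))"
    define I where "I = T \<times> {..<m} \<times> {..<m}"
    \<comment> \<open>Over distinct base points the thickened points are kept apart by
      \<open>c1\<close>; over the same base point, distinct grid nodes are kept apart by
      \<open>c2\<close>.\<close>
    have sep': "c * e \<le> dist (p x) (p y)" if "x \<in> I" "y \<in> I" "x \<noteq> y" for x y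
    proof -
      obtain t a b t' a' b' where xy: "x = (t, a, b)" "y = (t', a', b')" by (metis prod_cases3)
      define s where "s = of_real e * (Complex (real a) (real b) - Complex (real a') (real b'))"
      have eq: "p x - p y = t - t' + \<iota> s"
        unfolding xy p_def s_def by (simp add: right_diff_distrib linear_diff[OF \<open>linear \<iota>\<close>])
      have tt: "t \<in> K" "t' \<in> K" "t \<in> T" "t' \<in> T" using that T unfolding I_def xy by auto
      show ?thesis
      proof (cases "t = t'")
        case False
        then have "c * e \<le> c * norm (t - t')" using sep[OF tt(3,4)] \<open>0 < c\<close> by (simp add: dist_norm)
        then show ?thesis using c1[OF tt(1,2), of s] by (simp add: dist_norm eq)
      next
        case True
        then have ab: "a \<noteq> a' \<or> b \<noteq> b'" using that xy by auto
        have "1 \<le> norm (Complex (real a) (real b) - Complex (real a') (real b'))"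
        proof (cases "a = a'")
          case True
          then have "1 \<le> \<bar>real b - real b'\<bar>" using ab by linarith
          then show ?thesis using abs_Im_le_cmod[of "Complex (real a) (real b) - Complex (real a') (real b')"] by simp
        next
          case False
          then have "1 \<le> \<bar>real a - real a'\<bar>" by linarith
          then show ?thesis using abs_Re_le_cmod[of "Complex (real a) (real b) - Complex (real a') (real b')"] by simp
        qed
        then have "e \<le> norm s" unfolding s_def using e by (simp add: norm_mult)
        then have "c * e \<le> c * norm s" using \<open>0 < c\<close> by simp
        then show ?thesis using c2[OF tt(1,2), of s] by (simp add: dist_norm eq)
      qed
    qed
    have "inj_on p I"
    proof (rule inj_onI)
      fix x y assume "x \<in> I" "y \<in> I" "p x = p y"
      then show "x = y" using sep'[of x y] e \<open>0 < c\<close> by (cases "x = y") (auto simp: mult_le_0_iff)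
    qed
    then have card: "card (p ` I) = card T * (m * m)"
      by (simp add: card_image I_def card_cartesian_product)
    have sub: "p ` I \<subseteq> ball 0 R"
    proof
      fix y assume "y \<in> p ` I"
      then obtain t a b where y: "y = p (t, a, b)" "t \<in> T" "a < m" "b < m" unfolding I_def by auto
      have "norm y \<le> norm t + norm (\<iota> (of_real e * Complex (real a) (real b)))"
        unfolding y p_def by (simp add: norm_triangle_ineq)
      also have "norm (\<iota> (of_real e * Complex (real a) (real b))) \<le> e * (real a + real b)"
        unfolding norm_\<iota> norm_mult using e cmod_le[of "Complex (real a) (real b)"] by simp
      also have "\<dots> \<le> e * (2 * real m)" using y e by (intro mult_left_mono) auto
      also have "\<dots> = 2 * (real m * e)" by simp
      also have "\<dots> \<le> 4" using m by linarith
      also have "norm t < B" using y T B by auto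
      finally show "y \<in> ball 0 R" unfolding R_def by simp
    qed
    have "real (card (p ` I)) * (c * e / 2) ^ DIM('a) \<le> (R + c * e / 2) ^ DIM('a)"
    proof (rule card_separated_bound)
      show "finite (p ` I)" unfolding I_def using T by simp
      show "2 * (c * e / 2) \<le> dist x y" if xy: "x \<in> p ` I" "y \<in> p ` I" "x \<noteq> y" for x y
      proof -
        obtain x' y' where "x' \<in> I" "x = p x'" "y' \<in> I" "y = p y'" using xy by blast
        then show ?thesis using sep'[of x' y'] xy(3) by auto
      qed
    qed (use sub R e \<open>0 < c\<close> in auto)
    also have "\<dots> \<le> (R + c) ^ D"
      unfolding D_def using R e \<open>0 < c\<close> by (intro power_mono) auto
    finally have 1: "real (card (p ` I)) * (c / 2 * e) ^ D \<le> (R + c) ^ D" by (simp add: D_def)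
    have "real (card (p ` I)) * e ^ D = real (card (p ` I)) * (c / 2 * e) ^ D / (c / 2) ^ D"
      unfolding power_mult_distrib using \<open>0 < c\<close> by simp
    also have "\<dots> \<le> (R + c) ^ D / (c / 2) ^ D"
      using 1 \<open>0 < c\<close> by (intro divide_right_mono) auto
    also have "\<dots> = C" unfolding C_def by (rule power_divide[symmetric])
    finally have 2: "real (card T) * (real m * real m) * e ^ D \<le> C" unfolding card by simp
    \<comment> \<open>Since \<open>m * e\<close> is at least 1, inserting its square costs nothing;
      it converts the bound for \<open>card T * (m * m)\<close> points into one with the extra
      factor e^2.\<close>
    have "real (card T) * e ^ D * 1 \<le> real (card T) * e ^ D * (real m * e)\<^sup>2"
      using m e by (intro mult_left_mono) (auto simp: one_le_power)
    also have "\<dots> = real (card T) * (real m * real m) * e ^ D * e\<^sup>2" by (simp add: power2_eq_square)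
    also have "\<dots> \<le> C * e\<^sup>2" using 2 by (intro mult_right_mono) auto
    finally show ?thesis by simp
  qed
  show ?thesis
    unfolding codim_two_def
  proof (intro exI[of _ C] allI impI)
    fix e :: real
    assume e: "0 < e \<and> e \<le> 1"
    \<comment> \<open>A maximal \<open>e\<close>-separated subset of \<open>K\<close> is an
      \<open>e\<close>-net. One of greatest cardinality exists because the packing bound limits all
      of them.\<close>
    define Q where "Q = (\<lambda>T. finite T \<and> T \<subseteq> K \<and> (\<forall>x\<in>T. \<forall>y\<in>T. x \<noteq> y \<longrightarrow> e \<le> dist x y))"
    have Qb: "card T \<le> nat \<lceil>C * e\<^sup>2 / e ^ D\<rceil>" if "Q T" for T
    proof -
      have "real (card T) * e ^ D \<le> C * e\<^sup>2" using bound[of e T] e that unfolding Q_def by auto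
      then have "real (card T) \<le> C * e\<^sup>2 / e ^ D" using e by (simp add: field_simps)
      then show ?thesis by linarith
    qed
    have "Q {}" unfolding Q_def by auto
    have "\<exists>T. Q T \<and> (\<forall>T'. Q T' \<longrightarrow> card T' \<le> card T)"
      by (rule ex_has_greatest_nat[where b = "Suc (nat \<lceil>C * e\<^sup>2 / e ^ D\<rceil>)"])
        (use Qb \<open>Q {}\<close> in \<open>auto simp: less_Suc_eq_le\<close>)
    then obtain T where T: "Q T" "\<And>T'. Q T' \<Longrightarrow> card T' \<le> card T" by blast
    have "K \<subseteq> (\<Union>t\<in>T. cball t e)"
    proof
      fix x assume x: "x \<in> K"
      show "x \<in> (\<Union>t\<in>T. cball t e)"
      proof (rule ccontr)
        assume "x \<notin> (\<Union>t\<in>T. cball t e)"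
        then have far: "\<And>t. t \<in> T \<Longrightarrow> e < dist t x" by force
        then have "x \<notin> T" using e by force
        have "Q (insert x T)" using T(1) x far unfolding Q_def by (auto simp: dist_commute less_imp_le)
        then have "card (insert x T) \<le> card T" by (rule T(2))
        then show False using \<open>x \<notin> T\<close> T(1) unfolding Q_def by simp
      qed
    qed
    then show "\<exists>T. finite T \<and> K \<subseteq> (\<Union>t\<in>T. cball t e) \<and> real (card T) * e ^ DIM('a) \<le> C * e\<^sup>2"
      using bound[of e T] T(1) e unfolding Q_def D_def by auto
  qed
qed

section \<open>Holomorphic functions and cutoffs\<close>

lemma norm_smult: "norm (c *s (v::complex^'n)) = cmod c * norm v"
  unfolding norm_vec_def L2_set_def
  by (simp add: norm_mult power_mult_distrib sum_distrib_left[symmetric] real_sqrt_mult)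

lemma bounded_linear_smult_left: "bounded_linear (\<lambda>c. c *s (v::complex^'n))"
  by (rule bounded_linear_intro[of _ "norm v"])
     (auto simp: vec_eq_iff algebra_simps norm_smult)

lemma holo_onE:
  assumes "holo_on f U" "z \<in> U"
  obtains L where "(f has_derivative L) (at z)" "\<And>c w. L (c *s w) = c * L w"
  using assms unfolding holo_on_def by blast

lemma holo_on_subset: "holo_on f U \<Longrightarrow> V \<subseteq> U \<Longrightarrow> holo_on f V"
  unfolding holo_on_def by blast

lemma holo_on_continuous_at: "holo_on f U \<Longrightarrow> z \<in> U \<Longrightarrow> continuous (at z) f"
  by (metis holo_onE has_derivative_continuous)

lemma holo_on_imp_continuous_on: "holo_on f U \<Longrightarrow> continuous_on U f"
  by (simp add: continuous_at_imp_continuous_on holo_on_continuous_at)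

lemma holo_on_cong:
  assumes "open U" "holo_on f U" "\<And>z. z \<in> U \<Longrightarrow> g z = f z"
  shows "holo_on g U"
  unfolding holo_on_def
proof
  fix z assume z: "z \<in> U"
  obtain L where L: "(f has_derivative L) (at z)" "\<And>c w. L (c *s w) = c * L w"
    using holo_onE[OF assms(2) z] by blast
  have "(g has_derivative L) (at z)"
    using L(1) has_derivative_transform_within_open[OF _ assms(1) z] assms(3) by metis
  then show "\<exists>L. (g has_derivative L) (at z) \<and> (\<forall>c w. L (c *s w) = c * L w)" using L(2) by blast
qed

lemma holo_on_const: "holo_on (\<lambda>z. c) U"
  unfolding holo_on_def by (auto intro!: exI[of _ "\<lambda>_. 0"])

lemma holo_on_add:
  assumes "holo_on f U" "holo_on g U" shows "holo_on (\<lambda>z. f z + g z) U"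
  unfolding holo_on_def
proof
  fix z assume z: "z \<in> U"
  obtain L where L: "(f has_derivative L) (at z)" "\<And>c w. L (c *s w) = c * L w"
    using holo_onE[OF assms(1) z] by blast
  obtain K where K: "(g has_derivative K) (at z)" "\<And>c w. K (c *s w) = c * K w"
    using holo_onE[OF assms(2) z] by blast
  show "\<exists>L. ((\<lambda>z. f z + g z) has_derivative L) (at z) \<and> (\<forall>c w. L (c *s w) = c * L w)"
    by (intro exI[of _ "\<lambda>w. L w + K w"] conjI has_derivative_add L K) (simp add: L K algebra_simps)
qed

lemma holo_on_mult:
  assumes "holo_on f U" "holo_on g U" shows "holo_on (\<lambda>z. f z * g z) U"
  unfolding holo_on_def
proof
  fix z assume z: "z \<in> U"
  obtain L where L: "(f has_derivative L) (at z)" "\<And>c w. L (c *s w) = c * L w"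
    using holo_onE[OF assms(1) z] by blast
  obtain K where K: "(g has_derivative K) (at z)" "\<And>c w. K (c *s w) = c * K w"
    using holo_onE[OF assms(2) z] by blast
  show "\<exists>L. ((\<lambda>z. f z * g z) has_derivative L) (at z) \<and> (\<forall>c w. L (c *s w) = c * L w)"
    by (intro exI[of _ "\<lambda>w. f z * K w + L w * g z"] conjI has_derivative_mult L K) (simp add: L K algebra_simps)
qed

lemma holo_on_cmult: "holo_on f U \<Longrightarrow> holo_on (\<lambda>z. c * f z) U"
  by (rule holo_on_mult[OF holo_on_const])

lemma holo_on_sum:
  "(\<And>i. i \<in> I \<Longrightarrow> holo_on (f i) U) \<Longrightarrow> holo_on (\<lambda>z. \<Sum>i\<in>I. f i z) U"
  by (induction I rule: infinite_finite_induct) (auto intro: holo_on_const holo_on_add)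

lemma holo_on_prod:
  "(\<And>i. i \<in> I \<Longrightarrow> holo_on (f i) U) \<Longrightarrow> holo_on (\<lambda>z. \<Prod>i\<in>I. f i z) U"
  by (induction I rule: infinite_finite_induct) (auto intro: holo_on_const holo_on_mult)

lemma holo_on_shift:
  assumes "holo_on f U" "\<And>z. z \<in> V \<Longrightarrow> z + a \<in> U"
  shows "holo_on (\<lambda>z. f (z + a)) V"
  unfolding holo_on_def
proof
  fix z assume z: "z \<in> V"
  obtain L where L: "(f has_derivative L) (at (z + a))" "\<And>c w. L (c *s w) = c * L w"
    using holo_onE[OF assms(1) assms(2)[OF z]] by blast
  have "((\<lambda>z. f (z + a)) has_derivative (\<lambda>h. L h)) (at z)"
    by (rule has_derivative_compose[where f="\<lambda>z. z + a" and f'="\<lambda>h. h"]) (auto intro!: derivative_eq_intros L)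
  then show "\<exists>L. ((\<lambda>z. f (z + a)) has_derivative L) (at z) \<and> (\<forall>c w. L (c *s w) = c * L w)" using L(2) by blast
qed

text \<open>Complex homogeneity of the real derivative makes restrictions to complex lines
  differentiable in one variable; this gives access to Cauchy's estimates and to the identity
  theorem.\<close>

lemma has_field_derivative_line:
  fixes f :: "complex^'n \<Rightarrow> complex"
  assumes "(f has_derivative L) (at (z + \<zeta> *s v))" "\<And>c w. L (c *s w) = c * L w"
  shows "((\<lambda>\<zeta>. f (z + \<zeta> *s v)) has_field_derivative L v) (at \<zeta>)"
proof -
  have "((\<lambda>\<zeta>. z + \<zeta> *s v) has_derivative (\<lambda>h. h *s v)) (at \<zeta>)"
    using has_derivative_add[OF has_derivative_const[of z] bounded_linear_imp_has_derivative[OF bounded_linear_smult_left]] by simp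
  from has_derivative_compose[OF this assms(1)] have "((\<lambda>\<zeta>. f (z + \<zeta> *s v)) has_derivative (\<lambda>h. L (h *s v))) (at \<zeta>)" .
  then show ?thesis unfolding has_field_derivative_def by (simp add: assms(2) mult_commute_abs)
qed

lemma holomorphic_on_line:
  fixes f :: "complex^'n \<Rightarrow> complex"
  assumes "holo_on f U" "\<And>\<zeta>. \<zeta> \<in> V \<Longrightarrow> z + \<zeta> *s v \<in> U"
  shows "(\<lambda>\<zeta>. f (z + \<zeta> *s v)) holomorphic_on V"
  unfolding holomorphic_on_def
proof
  fix \<zeta> assume "\<zeta> \<in> V"
  then obtain L where "(f has_derivative L) (at (z + \<zeta> *s v))" "\<And>c w. L (c *s w) = c * L w"
    using assms holo_onE by metis
  from has_field_derivative_line[OF this] show "(\<lambda>\<zeta>. f (z + \<zeta> *s v)) field_differentiable at \<zeta> within V"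
    using field_differentiable_at_within field_differentiable_def by blast
qed

text \<open>Cauchy's estimate on the slice in direction \<open>v\<close>: the disc of radius
  \<open>r / norm v\<close> is carried into \<open>cball z r\<close>.\<close>

lemma holo_derivative_bound:
  fixes f :: "complex^'n \<Rightarrow> complex"
  assumes f: "holo_on f U" and "cball z r \<subseteq> U" "0 < r"
    and B: "\<And>w. w \<in> cball z r \<Longrightarrow> cmod (f w) \<le> B"
    and L: "(f has_derivative L) (at z)" "\<And>c w. L (c *s w) = c * L w"
  shows "cmod (L v) \<le> B / r * norm v"
proof (cases "v = 0")
  case True
  then show ?thesis using L(2)[of 0 v] by simp
next
  case False
  define \<rho> where "\<rho> = r / norm v"
  have \<rho>: "0 < \<rho>" unfolding \<rho>_def using False assms by simp
  have in_cball: "z + \<zeta> *s v \<in> cball z r" if "\<zeta> \<in> cball 0 \<rho>" for \<zeta>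
    using that False by (simp add: dist_norm norm_smult \<rho>_def field_simps)
  let ?\<phi> = "\<lambda>\<zeta>. f (z + \<zeta> *s v)"
  have hol: "?\<phi> holomorphic_on cball 0 \<rho>"
    using holomorphic_on_line[OF f] in_cball assms(2) by blast
  have "cmod ((deriv ^^ 1) ?\<phi> 0) \<le> fact 1 * B / \<rho> ^ 1"
  proof (rule Cauchy_inequality)
    show "?\<phi> holomorphic_on ball 0 \<rho>" using hol holomorphic_on_subset ball_subset_cball by blast
    show "continuous_on (cball 0 \<rho>) ?\<phi>" using hol holomorphic_on_imp_continuous_on by blast
    show "cmod (f (z + x *s v)) \<le> B" if "cmod (0 - x) = \<rho>" for x
      using that by (intro B in_cball) (simp add: dist_norm)
  qed (rule \<rho>)
  moreover have "deriv ?\<phi> 0 = L v"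
    using has_field_derivative_line[of f L z 0 v] L by (simp add: DERIV_imp_deriv)
  ultimately show ?thesis by (simp add: \<rho>_def)
qed

text \<open>The Cauchy estimate bounds the derivative throughout the inner ball, since
  \<open>cball w r\<close> stays in the doubled ball for every \<open>w\<close> in it; convexity
  then gives the Lipschitz bound.\<close>

lemma holo_lipschitz:
  fixes f :: "complex^'n \<Rightarrow> complex"
  assumes f: "holo_on f U" and "cball z (2 * r) \<subseteq> U" "0 < r"
    and B: "\<And>w. w \<in> cball z (2 * r) \<Longrightarrow> cmod (f w) \<le> B"
    and xy: "x \<in> cball z r" "y \<in> cball z r"
  shows "cmod (f x - f y) \<le> B / r * norm (x - y)"
proof -
  have "\<forall>w\<in>U. \<exists>L. (f has_derivative L) (at w) \<and> (\<forall>c v. L (c *s v) = c * L v)"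
    using f unfolding holo_on_def by blast
  then obtain L where L: "\<And>w. w \<in> U \<Longrightarrow> (f has_derivative L w) (at w)"
      "\<And>w c v. w \<in> U \<Longrightarrow> L w (c *s v) = c * L w v"
    by metis
  have sub: "cball w r \<subseteq> cball z (2 * r)" if "w \<in> cball z r" for w
    using that by (intro cball_subset_cball_iff[THEN iffD2]) (auto simp: dist_commute)
  show ?thesis
  proof (rule differentiable_bound[of "cball z r" f L])
    fix w assume w: "w \<in> cball z r"
    then have wU: "cball w r \<subseteq> U" "w \<in> U" using sub[OF w] assms(2,3) by auto
    show "(f has_derivative L w) (at w within cball z r)"
      using L(1) wU(2) has_derivative_at_withinI by blast
    show "onorm (L w) \<le> B / r"
    proof (rule onorm_le)
      show "cmod (L w v) \<le> B / r * norm v" for v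
        by (rule holo_derivative_bound[OF f wU(1) assms(3) _ L[OF wU(2)]]) (use sub[OF w] B in auto)
    qed
  qed (use xy in auto)
qed

section \<open>Integral estimates and cutoffs near a codimension-two set\<close>

text \<open>Truncation at a large height \<open>N\<close> leaves a small integral, while the
  truncated part contributes at most \<open>N\<close> times the measure of \<open>A\<close>.\<close>

lemma integrable_absolute_continuity:
  fixes q :: "'a \<Rightarrow> real"
  assumes q: "integrable M q" "\<And>x. 0 \<le> q x" and "0 < \<eta>"
  shows "\<exists>\<delta>>0. \<forall>A\<in>fmeasurable M. measure M A < \<delta> \<longrightarrow> (\<integral>x. indicator A x * q x \<partial>M) \<le> \<eta>"
proof -
  have [measurable]: "q \<in> borel_measurable M" using q by simp
  have "(\<lambda>n. \<integral>x. q x - min (q x) (real n) \<partial>M) \<longlonglongrightarrow> (\<integral>x. 0 \<partial>M)"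
  proof (rule integral_dominated_convergence[where w=q])
    show "AE x in M. (\<lambda>n. q x - min (q x) (real n)) \<longlonglongrightarrow> 0"
    proof (rule AE_I2)
      fix x
      obtain N where "q x \<le> real N" using real_arch_simple by blast
      then have "eventually (\<lambda>n. q x - min (q x) (real n) = 0) sequentially"
        by (auto simp: eventually_sequentially min_def intro!: exI[of _ N])
      then show "(\<lambda>n. q x - min (q x) (real n)) \<longlonglongrightarrow> 0" by (rule tendsto_eventually)
    qed
    show "AE x in M. norm (q x - min (q x) (real n)) \<le> q x" for n using q(2) by auto
  qed (use q in auto)
  then have "\<forall>\<^sub>F n in sequentially. (\<integral>x. q x - min (q x) (real n) \<partial>M) < \<eta> / 2"
    using assms(3) by (intro order_tendstoD(2)[where y=0]) auto
  then obtain N where N: "(\<integral>x. q x - min (q x) (real N) \<partial>M) < \<eta> / 2"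
    by (auto simp: eventually_sequentially)
  have int: "integrable M (\<lambda>x. q x - min (q x) (real N))"
    by (rule Bochner_Integration.integrable_bound[OF q(1)]) (use q(2) in auto)
  show ?thesis
  \<comment> \<open>The summand 1 keeps the quotient meaningful when \<open>N = 0\<close>.\<close>
  proof (intro exI[of _ "\<eta> / (2 * (real N + 1))"] conjI ballI impI)
    fix A assume A: "A \<in> fmeasurable M" "measure M A < \<eta> / (2 * (real N + 1))"
    then have [measurable]: "A \<in> sets M" and fin: "emeasure M A < \<infinity>" by (auto simp: fmeasurable_def)
    have iA: "integrable M (\<lambda>x. indicator A x * real N)" using fin by simp
    have "(\<integral>x. indicator A x * q x \<partial>M) \<le> (\<integral>x. (q x - min (q x) (real N)) + indicator A x * real N \<partial>M)"
    proof (rule integral_mono)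
      show "integrable M (\<lambda>x. indicator A x * q x)"
        by (rule Bochner_Integration.integrable_bound[OF q(1)]) (auto simp: indicator_def)
      show "integrable M (\<lambda>x. (q x - min (q x) (real N)) + indicator A x * real N)"
        using int iA by auto
      show "indicator A x * q x \<le> q x - min (q x) (real N) + indicator A x * real N" for x
        using q(2)[of x] by (auto simp: indicator_def min_def)
    qed
    also have "\<dots> = (\<integral>x. q x - min (q x) (real N) \<partial>M) + (\<integral>x. indicator A x * real N \<partial>M)"
      using int iA by (rule Bochner_Integration.integral_add)
    also have "(\<integral>x. indicator A x * real N \<partial>M) = measure M A * real N" using fin by simp
    also have "\<dots> \<le> \<eta> / (2 * (real N + 1)) * (real N + 1)"
      using A(2) assms(3) by (intro mult_mono) auto
    also have "\<dots> = \<eta> / 2" using of_nat_0_le_iff[of N, where 'a=real] by (simp add: divide_simps)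
    finally show "(\<integral>x. indicator A x * q x \<partial>M) \<le> \<eta>" using N by simp
  qed (use assms(3) in auto)
qed

text \<open>The point is the factor \<open>e\<close> in the last estimate, which compensates the
  Lipschitz constant \<open>1 / e\<close> of the cutoff. It comes from Cauchy-Schwarz in its AM-GM
  form: the volume of \<open>A\<close> is O(e^2), and the mass of the square of |f0| on
  \<open>A\<close> is as small as desired.\<close>

lemma codim_two_cutoff:
  fixes f0 :: "'a::euclidean_space \<Rightarrow> complex"
  assumes K: "codim_two K" and f0 [measurable]: "f0 \<in> borel_measurable borel"
    and int: "integrable lborel (\<lambda>x. (cmod (f0 x))\<^sup>2)" and "0 < \<eta>"
  obtains \<psi> :: "'a \<Rightarrow> real" and A O' e where
    "0 < e" "e \<le> 1" "\<And>x. 0 \<le> \<psi> x" "\<And>x. \<psi> x \<le> 1" "continuous_on UNIV \<psi>"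
    "open O'" "K \<subseteq> O'" "\<And>x. x \<in> O' \<Longrightarrow> \<psi> x = 0"
    "A \<in> sets borel" "\<And>x. x \<notin> A \<Longrightarrow> \<psi> x = 1"
    "\<And>x y. dist x y \<le> e \<Longrightarrow> \<bar>\<psi> x - \<psi> y\<bar> \<le> dist x y / e * indicator A x"
    "integrable lborel (\<lambda>x. indicator A x * cmod (f0 x))"
    "(\<integral>x. indicator A x * cmod (f0 x) \<partial>lborel) \<le> \<eta> * e"
\<comment> \<open>The empty set is separated off because \<open>infdist\<close> to an empty set of
  centres is 0, and the formula for \<open>\<psi>\<close> would then vanish everywhere.\<close>
proof (cases "K = {}")
  case True
  show ?thesis
    by (rule that[of 1 "\<lambda>_. 1" "{}" "{}"]) (use True \<open>0 < \<eta>\<close> in auto)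
next
  case False
  define D where "D = DIM('a)"
  define V where "V = unit_ball_vol (real DIM('a))"
  have V: "V > 0" unfolding V_def by (rule unit_ball_vol_pos) auto
  obtain C0 where C0: "\<And>e. 0 < e \<Longrightarrow> e \<le> 1 \<Longrightarrow>
      \<exists>T. finite T \<and> K \<subseteq> (\<Union>t\<in>T. cball t e) \<and> real (card T) * e ^ D \<le> C0 * e\<^sup>2"
    using K unfolding codim_two_def D_def by blast
  \<comment> \<open>Bounds the volume of \<open>A\<close> divided by e^2: the 5 comes from the
    enlarged radii \<open>5 * e\<close>, and the \<open>+ 1\<close> ensures positivity.\<close>
  define C where "C = \<bar>C0\<bar> * 5 ^ D * V + 1"
  have C: "C > 0" unfolding C_def using V by (smt (verit) abs_ge_zero mult_nonneg_nonneg zero_le_power)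
  \<comment> \<open>With weights \<open>e / s\<close> and \<open>s / e\<close> in the AM-GM
    inequality, each of the two terms contributes at most half of \<open>\<eta> * e\<close>.\<close>
  define s where "s = \<eta> / (2 * C)"
  have s: "s > 0" unfolding s_def using C \<open>0 < \<eta>\<close> by simp
  obtain \<delta> where \<delta>: "\<delta> > 0" "\<And>A. A \<in> fmeasurable lborel \<Longrightarrow> measure lborel A < \<delta> \<Longrightarrow>
      (\<integral>x. indicator A x * (cmod (f0 x))\<^sup>2 \<partial>lborel) \<le> s * \<eta> / 2"
    using integrable_absolute_continuity[OF int, of "s * \<eta> / 2"] s \<open>0 < \<eta>\<close> by auto
  define e where "e = min 1 (\<delta> / (2 * C))"
  have e: "0 < e" "e \<le> 1" "C * e\<^sup>2 < \<delta>"
  proof -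
    show "0 < e" "e \<le> 1" unfolding e_def using \<delta> C by auto
    have "C * e\<^sup>2 \<le> C * e" using C \<open>0 < e\<close> \<open>e \<le> 1\<close>
      by (intro mult_left_mono) (auto simp: power2_eq_square mult_le_one)
    also have "\<dots> \<le> C * (\<delta> / (2 * C))" using C unfolding e_def by (intro mult_left_mono) auto
    also have "\<dots> < \<delta>" using C \<delta> by simp
    finally show "C * e\<^sup>2 < \<delta>" .
  qed
  obtain T where T: "finite T" "K \<subseteq> (\<Union>t\<in>T. cball t e)" "real (card T) * e ^ D \<le> C0 * e\<^sup>2"
    using C0[OF e(1,2)] by blast
  have "T \<noteq> {}" using False T(2) by auto
  \<comment> \<open>The cutoff reaches 1 at distance \<open>3 * e\<close> from the centres. The
    radius \<open>5 * e\<close> leaves a margin: if \<open>x\<close> is outside \<open>A\<close>,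
    every \<open>y\<close> within \<open>e\<close> of \<open>x\<close> is still at distance at least
    \<open>4 * e\<close>, so \<open>\<psi>\<close> is 1 at both points and the increment
    vanishes.\<close>
  define A where "A = (\<Union>t\<in>T. cball t (5 * e))"
  define O' where "O' = {x. infdist x T < 2 * e}"
  define \<psi> where "\<psi> = (\<lambda>x. max 0 (min 1 (infdist x T / e - 2)))"
  have A_sets [measurable]: "A \<in> sets borel" unfolding A_def using T(1) by (intro sets.finite_UN) auto
  have A_fm: "A \<in> fmeasurable lborel"
    unfolding A_def using T(1) by (intro fmeasurable.finite_UN) (auto intro!: fmeasurableI emeasure_bounded_finite)
  have notA: "infdist x T > 5 * e" if "x \<notin> A" for x
  proof -
    obtain t where "t \<in> T" "infdist x T = dist x t"
      using infdist_attains_inf[of T x] finite_imp_closed[OF T(1)] \<open>T \<noteq> {}\<close> by blast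
    then show ?thesis using that unfolding A_def by (auto simp: dist_commute)
  qed
  have measA: "measure lborel A \<le> C * e\<^sup>2"
  proof -
    have "measure lborel A \<le> (\<Sum>t\<in>T. measure lborel (cball t (5 * e)))"
      unfolding A_def using T(1)
      by (intro measure_UNION_le) auto
    also have "\<dots> = real (card T) * (V * (5 * e) ^ D)"
      using e(1) by (simp add: content_cball V_def D_def)
    also have "\<dots> = (real (card T) * e ^ D) * (5 ^ D * V)"
      by (simp add: power_mult_distrib)
    also have "\<dots> \<le> (C0 * e\<^sup>2) * (5 ^ D * V)"
      using T(3) V by (intro mult_right_mono) auto
    also have "\<dots> \<le> (\<bar>C0\<bar> * e\<^sup>2) * (5 ^ D * V)"
      using V by (intro mult_right_mono) auto
    also have "\<dots> \<le> C * e\<^sup>2" unfolding C_def by (simp add: algebra_simps)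
    finally show ?thesis .
  qed
  have emA: "emeasure lborel A < \<infinity>" using A_fm by (auto simp: fmeasurable_def)
  have q: "integrable lborel (\<lambda>x. indicator A x * (cmod (f0 x))\<^sup>2)"
    by (rule Bochner_Integration.integrable_bound[OF int]) (auto simp: indicator_def)
  have i1: "integrable lborel (\<lambda>x. e / s * (indicator A x * (cmod (f0 x))\<^sup>2) + s / e * indicator A x)"
    using q emA by (intro Bochner_Integration.integrable_add integrable_mult_right) auto
  have pt: "indicator A x * cmod (f0 x) \<le> e / s * (indicator A x * (cmod (f0 x))\<^sup>2) + s / e * indicator A x" for x
  proof -
    let ?a = "cmod (f0 x)"
    have "0 \<le> (?a * e - s)\<^sup>2 + ?a * e * s" using e(1) s by simp
    then have "?a * e * s \<le> (?a * e)\<^sup>2 + s\<^sup>2" by (simp add: power2_eq_square algebra_simps)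
    then have "?a \<le> ((?a * e)\<^sup>2 + s\<^sup>2) / (e * s)" using e(1) s by (simp add: pos_le_divide_eq mult.assoc)
    also have "\<dots> = e / s * ?a\<^sup>2 + s / e" using e(1) s by (simp add: field_simps power2_eq_square)
    finally show ?thesis by (auto simp: indicator_def)
  qed
  have i2: "integrable lborel (\<lambda>x. indicator A x * cmod (f0 x))"
    by (rule Bochner_Integration.integrable_bound[OF i1]) (use pt in \<open>auto intro: order_trans[OF _ abs_ge_self]\<close>)
  have "(\<integral>x. indicator A x * cmod (f0 x) \<partial>lborel) \<le>
      (\<integral>x. e / s * (indicator A x * (cmod (f0 x))\<^sup>2) + s / e * indicator A x \<partial>lborel)"
    by (rule integral_mono[OF i2 i1 pt])
  also have "\<dots> = e / s * (\<integral>x. indicator A x * (cmod (f0 x))\<^sup>2 \<partial>lborel) + s / e * measure lborel A"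
    using q emA by (subst Bochner_Integration.integral_add) auto
  also have "\<dots> \<le> e / s * (s * \<eta> / 2) + s / e * (C * e\<^sup>2)"
    using measA e s \<delta>(2)[OF A_fm] by (intro add_mono mult_left_mono) auto
  also have "\<dots> = \<eta> * e"
    using e s C unfolding s_def by (simp add: field_simps power2_eq_square)
  finally have i3: "(\<integral>x. indicator A x * cmod (f0 x) \<partial>lborel) \<le> \<eta> * e" .
  show ?thesis
  proof (rule that[of e \<psi> O' A])
    show "continuous_on UNIV \<psi>" unfolding \<psi>_def by (intro continuous_intros) (use e in auto)
    show "open O'" unfolding O'_def by (intro open_Collect_less continuous_intros)
    show "K \<subseteq> O'"
    proof
      fix x assume "x \<in> K"
      then obtain t where "t \<in> T" "dist x t \<le> e" using T(2) by (auto simp: dist_commute)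
      then have "infdist x T \<le> e" by (meson infdist_le order_trans)
      then show "x \<in> O'" unfolding O'_def using e by simp
    qed
    show "\<psi> x = 0" if "x \<in> O'" for x
    proof -
      have "infdist x T / e - 2 \<le> 0" using that e(1) unfolding O'_def by (simp add: divide_le_eq)
      then show ?thesis unfolding \<psi>_def by simp
    qed
    have one: "\<psi> x = 1" if "4 * e \<le> infdist x T" for x
    proof -
      have "1 \<le> infdist x T / e - 2" using that e(1) by (simp add: le_divide_eq)
      then show ?thesis unfolding \<psi>_def by simp
    qed
    show "\<psi> x = 1" if "x \<notin> A" for x using notA[OF that] e(1) by (intro one) simp
    show "\<bar>\<psi> x - \<psi> y\<bar> \<le> dist x y / e * indicator A x" if xy: "dist x y \<le> e" for x y
    proof (cases "x \<in> A")
      case True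
      have "\<bar>\<psi> x - \<psi> y\<bar> \<le> \<bar>(infdist x T / e - 2) - (infdist y T / e - 2)\<bar>"
        unfolding \<psi>_def by (auto simp: max_def min_def)
      also have "\<dots> = \<bar>infdist x T - infdist y T\<bar> / e" using e(1) by (simp add: diff_divide_distrib[symmetric])
      also have "\<dots> \<le> dist x y / e" using e(1) infdist_triangle_abs by (intro divide_right_mono) auto
      finally show ?thesis using True by simp
    next
      case False
      have "infdist x T > 5 * e" by (rule notA[OF False])
      moreover have "infdist x T \<le> infdist y T + dist x y" by (rule infdist_triangle)
      ultimately have "\<psi> x = 1" "\<psi> y = 1" using xy e(1) by (auto intro!: one)
      then show ?thesis using False by simp
    qed
  qed (use e i2 i3 in \<open>auto simp: \<psi>_def\<close>)
qed

section \<open>The weak Cauchy--Riemann equations across small sets\<close>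

lemma
  fixes f :: "'a::euclidean_space \<Rightarrow> 'b::{banach, second_countable_topology}"
  assumes [measurable]: "f \<in> borel_measurable borel"
  shows lborel_integral_translate: "(\<integral>x. f (x + h) \<partial>lborel) = (\<integral>x. f x \<partial>lborel)"
    and lborel_integrable_translate: "integrable lborel (\<lambda>x. f (x + h)) \<longleftrightarrow> integrable lborel f"
proof -
  have "(\<integral>x. f x \<partial>(distr lborel borel ((+) h))) = (\<integral>x. f (h + x) \<partial>lborel)"
    by (rule integral_distr) auto
  then show "(\<integral>x. f (x + h) \<partial>lborel) = (\<integral>x. f x \<partial>lborel)"
    by (simp add: lborel_distr_plus add.commute)
  have "integrable (distr lborel borel ((+) h)) f \<longleftrightarrow> integrable lborel (\<lambda>x. f (h + x))"
    by (rule integrable_distr_eq) auto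
  then show "integrable lborel (\<lambda>x. f (x + h)) \<longleftrightarrow> integrable lborel f"
    by (simp add: lborel_distr_plus add.commute)
qed

text \<open>The sequence of steps 1/(n+1) suits dominated convergence and exhibits the directional
  derivative as a limit of measurable functions.\<close>

lemma has_derivative_difference_quotient:
  fixes f :: "'a::real_normed_vector \<Rightarrow> complex"
  assumes f: "(f has_derivative f') (at x)"
  shows "(\<lambda>n. of_nat (Suc n) * (f (x + inverse (of_nat (Suc n)) *\<^sub>R v) - f x)) \<longlonglongrightarrow> f' v"
proof -
  let ?q = "\<lambda>n. norm (f (x + (0 + inverse (real (Suc n))) *\<^sub>R v) - f (x + 0 *\<^sub>R v) - f' (inverse (real (Suc n)) *\<^sub>R v))
      / norm (inverse (real (Suc n)))"
  have lin: "bounded_linear f'" using f by (rule has_derivative_bounded_linear)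
  have "((\<lambda>t. x + t *\<^sub>R v) has_derivative (\<lambda>t. t *\<^sub>R v)) (at 0)"
    by (auto intro!: derivative_eq_intros)
  moreover have "(f has_derivative f') (at (x + 0 *\<^sub>R v))" using f by simp
  ultimately have "((\<lambda>t. f (x + t *\<^sub>R v)) has_derivative (\<lambda>t. f' (t *\<^sub>R v))) (at 0)"
    by (rule has_derivative_compose)
  then have "(\<lambda>t. norm (f (x + (0 + t) *\<^sub>R v) - f (x + 0 *\<^sub>R v) - f' (t *\<^sub>R v)) / norm t) \<midarrow>0\<rightarrow> 0"
    unfolding has_derivative_at by blast
  then have "?q \<longlonglongrightarrow> 0"
    by (rule filterlim_compose)
       (use LIMSEQ_inverse_real_of_nat in \<open>auto simp: filterlim_at intro!: always_eventually\<close>)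
  also have "?q =
      (\<lambda>n. norm (of_nat (Suc n) * (f (x + inverse (of_nat (Suc n)) *\<^sub>R v) - f x) - f' v))"
  proof
    fix n
    let ?a = "of_nat (Suc n) :: complex"
    let ?d = "f (x + inverse (real (Suc n)) *\<^sub>R v) - f x"
    have "?a * (?d - f' (inverse (real (Suc n)) *\<^sub>R v)) = ?a * ?d - f' v"
      by (simp add: linear_scale[OF bounded_linear.linear[OF lin]] right_diff_distrib scaleR_conv_of_real del: of_nat_Suc)
    then have "cmod (?a * ?d - f' v) = real (Suc n) * cmod (?d - f' (inverse (real (Suc n)) *\<^sub>R v))"
      by (metis norm_mult norm_of_nat)
    then show "?q n = norm (?a * ?d - f' v)"
      by (simp add: divide_inverse del: of_nat_Suc)
  qed
  finally show ?thesis by (simp only: tendsto_norm_zero_iff LIM_zero_iff)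
qed

text \<open>The expression \<open>\<phi>' w v + \<i> * \<phi>' w (\<i> *s v)\<close> is twice the
  dbar-derivative in direction \<open>v\<close>. This operator annihilates \<open>f\<close> off
  \<open>E\<close>, so the integrand is the operator applied to \<open>f * \<phi>\<close>; without
  \<open>E\<close> its integral would vanish by translation invariance. To cope with
  \<open>E\<close>, a cutoff \<open>X\<close> is inserted and differences are moved from
  \<open>f * \<phi>\<close> to \<open>X\<close>, which varies only where \<open>f\<close> has small
  integral.\<close>

lemma weak_dbar:
  fixes f \<phi> :: "complex^'n \<Rightarrow> complex"
  assumes "open D" "closedin (top_of_set D) E" "sigma_codim_two E"
    and f: "holo_on f (D - E)" "set_integrable lborel (D - E) (\<lambda>z. (cmod (f z))\<^sup>2)"
    and \<phi>: "\<And>w. (\<phi> has_derivative \<phi>' w) (at w)"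
    and M: "\<And>w. cmod (\<phi> w) \<le> M" "\<And>w h. cmod (\<phi>' w h) \<le> M * norm h"
    and S: "compact S" "S \<subseteq> D" "\<And>w. w \<notin> S \<Longrightarrow> \<phi> w = 0"
  shows "(\<integral>w. (indicator (D - E) w *\<^sub>R f w) * (\<phi>' w v + \<i> * \<phi>' w (\<i> *s v)) \<partial>lborel) = 0"
proof -
  define f0 where "f0 = (\<lambda>w. indicator (D - E) w *\<^sub>R f w)"
  define \<Phi> where "\<Phi> = (\<lambda>w. \<phi>' w v + \<i> * \<phi>' w (\<i> *s v))"
  define \<alpha> where "\<alpha> = (\<lambda>n. inverse (real (Suc n)))"
  have \<alpha>: "0 < \<alpha> n" "\<alpha> n \<le> 1" "of_nat (Suc n) * complex_of_real (\<alpha> n) = 1" "real (Suc n) * \<alpha> n = 1" for n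
    unfolding \<alpha>_def by (auto simp: field_simps simp del: of_nat_Suc)
  have M0: "0 \<le> M" using M(1)[of undefined] by (rule order_trans[OF norm_ge_zero])
  have opG: "open (D - E)"
    using assms(1,2) by (metis closedin_def openin_open_eq topspace_euclidean_subtopology)
  have f0_meas [measurable]: "f0 \<in> borel_measurable borel"
    unfolding f0_def
    by (rule borel_measurable_continuous_on_indicator) (use opG holo_on_imp_continuous_on[OF f(1)] in auto)
  have int2: "integrable lborel (\<lambda>x. (cmod (f0 x))\<^sup>2)"
  proof -
    have "(\<lambda>x. (cmod (f0 x))\<^sup>2) = (\<lambda>x. indicator (D - E) x *\<^sub>R (cmod (f x))\<^sup>2)"
      unfolding f0_def by (auto simp: indicator_def fun_eq_iff)
    then show ?thesis using f(2) unfolding set_integrable_def by simp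
  qed
  have contphi: "continuous_on UNIV \<phi>"
    using \<phi> has_derivative_continuous continuous_at_imp_continuous_on by blast
  then have phi_meas [measurable]: "\<phi> \<in> borel_measurable borel"
    by (rule borel_measurable_continuous_onI)
  have \<Phi>_lim: "(\<lambda>n. of_nat (Suc n) * (\<phi> (w + \<alpha> n *\<^sub>R v) - \<phi> w) +
      \<i> * (of_nat (Suc n) * (\<phi> (w + \<alpha> n *\<^sub>R (\<i> *s v)) - \<phi> w))) \<longlonglongrightarrow> \<Phi> w" for w
    unfolding \<Phi>_def \<alpha>_def by (intro tendsto_add tendsto_mult tendsto_const has_derivative_difference_quotient \<phi>)
  have \<Phi>_meas [measurable]: "\<Phi> \<in> borel_measurable borel"
    by (rule borel_measurable_LIMSEQ_metric[OF _ \<Phi>_lim]) measurable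
  have \<phi>'0: "\<phi>' w h = 0" if "w \<notin> S" for w h
  proof -
    have "((\<lambda>_. 0) has_derivative \<phi>' w) (at w)"
      by (rule has_derivative_transform_within_open[OF \<phi>[of w], of "- S"])
         (use that S(1,3) compact_imp_closed in \<open>auto simp: open_Compl\<close>)
    from has_derivative_unique[OF this has_derivative_const] show ?thesis by metis
  qed
  have \<Phi>_bd: "cmod (\<Phi> w) \<le> 2 * M * norm v * indicator S w" for w
  proof (cases "w \<in> S")
    case True
    have "cmod (\<Phi> w) \<le> cmod (\<phi>' w v) + cmod (\<i> * \<phi>' w (\<i> *s v))"
      unfolding \<Phi>_def by (rule norm_triangle_ineq)
    also have "\<dots> \<le> M * norm v + M * norm (\<i> *s v)"
      using M(2) by (intro add_mono) (auto simp: norm_mult)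
    finally show ?thesis using True by (simp add: norm_smult)
  qed (simp add: \<Phi>_def \<phi>'0)
  have S_sets [measurable]: "S \<in> sets borel" by (rule borel_compact[OF S(1)])
  have \<phi>_lip: "cmod (\<phi> x - \<phi> y) \<le> M * norm (x - y)" for x y
    by (rule differentiable_bound[of UNIV \<phi> \<phi>']) (use \<phi> M(2) in \<open>auto intro: onorm_le\<close>)
  have int1: "integrable lborel (\<lambda>w. indicator B w * cmod (f0 w))" if B: "compact B" for B
  proof -
    have [measurable]: "B \<in> sets borel" by (rule borel_compact[OF B])
    show ?thesis
    proof (rule Bochner_Integration.integrable_bound)
      show "integrable lborel (\<lambda>w. indicator B w + (cmod (f0 w))\<^sup>2)"
        using int2 emeasure_compact_finite[OF B] by (intro Bochner_Integration.integrable_add) auto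
      have "a \<le> 1 + a\<^sup>2" for a :: real
        using zero_le_power2[of "a - 1/2"] by (simp add: power2_eq_square algebra_simps)
      then show "AE w in lborel. norm (indicator B w * cmod (f0 w)) \<le> norm (indicator B w + (cmod (f0 w))\<^sup>2)"
        by (auto simp: indicator_def)
    qed measurable
  qed
  have f0\<Phi>: "integrable lborel (\<lambda>w. f0 w * \<Phi> w)"
  proof (rule Bochner_Integration.integrable_bound)
    show "integrable lborel (\<lambda>w. 2 * M * norm v * (indicator S w * cmod (f0 w)))"
      using int1[OF S(1)] by (rule integrable_mult_right)
    have "cmod (f0 w) * cmod (\<Phi> w) \<le> cmod (f0 w) * (2 * M * norm v * indicator S w)" for w
      using \<Phi>_bd by (rule mult_left_mono) simp
    then show "AE w in lborel. norm (f0 w * \<Phi> w) \<le> norm (2 * M * norm v * (indicator S w * cmod (f0 w)))"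
      using M0 by (auto simp: norm_mult mult_ac abs_mult)
  qed measurable
  define k where "k = (\<lambda>w. f0 w * \<phi> w)"
  have k_meas [measurable]: "k \<in> borel_measurable borel" unfolding k_def by measurable
  have k_bd: "cmod (k w) \<le> M * (indicator S w * cmod (f0 w))" for w
    using mult_right_mono[OF M(1)[of w] norm_ge_zero[of "f0 w"]] S(3)[of w]
    by (auto simp: k_def indicator_def norm_mult mult_ac)
  have k_int: "integrable lborel k"
    by (rule Bochner_Integration.integrable_bound[OF integrable_mult_right[OF int1[OF S(1)], of M]])
       (use k_bd M0 in \<open>auto simp: abs_mult\<close>)
  obtain K :: "nat \<Rightarrow> (complex^'n) set" where K: "\<And>n. codim_two (K n)" "E \<subseteq> (\<Union>n. K n)"
    using assms(3) unfolding sigma_codim_two_def by blast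
  let ?I = "\<integral>w. f0 w * \<Phi> w \<partial>lborel"
  \<comment> \<open>The factor 4 adds two errors of size \<open>2 * M * norm v * \<theta>\<close>:
    one from translating the cutoff, one from the region where it differs from 1.\<close>
  have main: "cmod ?I \<le> 4 * M * norm v * \<theta>" if "\<theta> > 0" for \<theta> :: real
  proof -
    \<comment> \<open>The n-th piece gets the share \<open>\<theta> * (1/2) ^ Suc n\<close>, so the
      errors sum to at most \<open>\<theta>\<close> whichever finite subfamily compactness
      selects.\<close>
    define R where "R = (\<lambda>n (\<psi> :: complex^'n \<Rightarrow> real) A O' e.
        (0 < e \<and> e \<le> 1 \<and> (\<forall>x. 0 \<le> \<psi> x) \<and> (\<forall>x. \<psi> x \<le> 1) \<and> continuous_on UNIV \<psi>) \<and>
        (open O' \<and> K n \<subseteq> O' \<and> (\<forall>x. x \<in> O' \<longrightarrow> \<psi> x = 0) \<and> A \<in> sets borel \<and> (\<forall>x. x \<notin> A \<longrightarrow> \<psi> x = 1)) \<and>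
        (\<forall>x y. dist x y \<le> e \<longrightarrow> \<bar>\<psi> x - \<psi> y\<bar> \<le> dist x y / e * indicator A x) \<and>
        integrable lborel (\<lambda>x. indicator A x * cmod (f0 x)) \<and>
        (\<integral>x. indicator A x * cmod (f0 x) \<partial>lborel) \<le> (\<theta> * (1/2) ^ Suc n) * e)"
    have "\<exists>\<psi> A O' e. R n \<psi> A O' e" for n
      unfolding R_def
      by (rule codim_two_cutoff[OF K(1)[of n] f0_meas int2, of "\<theta> * (1/2) ^ Suc n"])
         (use \<open>\<theta> > 0\<close> in \<open>simp, intro exI conjI allI impI\<close>)
    then obtain \<psi> A O' e where R: "\<And>n. R n (\<psi> n) (A n) (O' n) (e n)" by metis
    have P: "\<And>n. 0 < e n" "\<And>n. e n \<le> 1" "\<And>n x. 0 \<le> \<psi> n x" "\<And>n x. \<psi> n x \<le> 1"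
        "\<And>n. continuous_on UNIV (\<psi> n)" "\<And>n. open (O' n)" "\<And>n. K n \<subseteq> O' n"
        "\<And>n x. x \<in> O' n \<Longrightarrow> \<psi> n x = 0" "\<And>n. A n \<in> sets borel" "\<And>n x. x \<notin> A n \<Longrightarrow> \<psi> n x = 1"
        "\<And>n x y. dist x y \<le> e n \<Longrightarrow> \<bar>\<psi> n x - \<psi> n y\<bar> \<le> dist x y / e n * indicator (A n) x"
        "\<And>n. integrable lborel (\<lambda>x. indicator (A n) x * cmod (f0 x))"
        "\<And>n. (\<integral>x. indicator (A n) x * cmod (f0 x) \<partial>lborel) \<le> (\<theta> * (1/2) ^ Suc n) * e n"
      using R unfolding R_def by blast+
    let ?m = "\<lambda>n w. indicator (A n) w * cmod (f0 w)"
    have [measurable]: "A n \<in> sets borel" for n by (rule P(9))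
    obtain \<delta>0 where \<delta>0: "0 < \<delta>0" "(\<Union>x\<in>S. cball x \<delta>0) \<subseteq> D"
      using compact_subset_open_imp_cball_epsilon_subset[OF S(1) assms(1) S(2)] by blast
    \<comment> \<open>Translates of \<open>S\<close> by vectors of norm at most
      \<open>\<delta>0\<close> stay in \<open>S2\<close>, so the difference quotients of
      \<open>k\<close> are supported there.\<close>
    define S2 where "S2 = (\<Union>x\<in>S. cball x \<delta>0)"
    have S2: "compact S2" "S2 \<subseteq> D" "S \<subseteq> S2"
      unfolding S2_def using compact_minkowski_sum_cball[OF S(1)] \<delta>0 by auto
    have S2_sets [measurable]: "S2 \<in> sets borel" by (rule borel_compact[OF S2(1)])
    have "compact (E \<inter> S2)"
    proof -
      obtain C where "closed C" "E = D \<inter> C" using assms(2) by (auto simp: closedin_closed)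
      then have "E \<inter> S2 = C \<inter> S2" using S2(2) by auto
      then show ?thesis using \<open>closed C\<close> S2(1) by (simp add: closed_Int_compact)
    qed
    moreover have "E \<inter> S2 \<subseteq> (\<Union>n\<in>UNIV. O' n)" using K(2) P(7) by blast
    ultimately obtain I :: "nat set" where I: "finite I" "E \<inter> S2 \<subseteq> (\<Union>n\<in>I. O' n)"
      by (rule compactE_image[OF _ P(6)])
    have geo: "(\<Sum>n\<in>I. (1/2::real) ^ Suc n) \<le> 1"
      using sum_le_suminf[OF sums_summable[OF power_half_series] I(1)] power_half_series
      by (auto simp: sums_iff)
    define O2 where "O2 = (\<Union>n\<in>I. O' n)"
    have "open O2" unfolding O2_def using P(6) by blast
    define X where "X = (\<lambda>w. \<Prod>n\<in>I. \<psi> n w)"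
    have X01: "0 \<le> X w" "X w \<le> 1" for w unfolding X_def using P(3,4) by (auto intro: prod_nonneg prod_le_1)
    have X0: "X w = 0" if "w \<in> O2" for w
      unfolding X_def using that I(1) P(8) unfolding O2_def by (auto intro: prod_zero)
    have X1: "X w = 1" if "\<And>n. n \<in> I \<Longrightarrow> w \<notin> A n" for w
      unfolding X_def using that P(10) by (simp add: prod.neutral)
    have contX: "continuous_on UNIV X" unfolding X_def by (intro continuous_intros P(5))
    then have X_meas [measurable]: "X \<in> borel_measurable borel" by (rule borel_measurable_continuous_onI)
    \<comment> \<open>The cutoff vanishes on \<open>O2\<close>, so only \<open>Q\<close> matters
      inside \<open>S2\<close>. It is compact in \<open>D - E\<close>; hence \<open>f\<close> is
      bounded and Lipschitz near each of its points, with uniform constants.\<close>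
    define Q where "Q = S2 - O2"
    have Q: "compact Q" "Q \<subseteq> D - E"
      unfolding Q_def using S2 I(2) \<open>open O2\<close> O2_def by (auto intro: compact_diff)
    obtain \<delta>1 where \<delta>1: "0 < \<delta>1" "(\<Union>x\<in>Q. cball x \<delta>1) \<subseteq> D - E"
      using compact_subset_open_imp_cball_epsilon_subset[OF Q(1) opG Q(2)] by blast
    have "compact (\<Union>x\<in>Q. cball x \<delta>1)" by (rule compact_minkowski_sum_cball[OF Q(1)])
    then have "compact (f ` (\<Union>x\<in>Q. cball x \<delta>1))"
      by (rule compact_continuous_image[OF continuous_on_subset[OF holo_on_imp_continuous_on[OF f(1)] \<delta>1(2)]])
    then obtain B0 where B0: "B0 > 0" "\<And>w. w \<in> (\<Union>x\<in>Q. cball x \<delta>1) \<Longrightarrow> cmod (f w) \<le> B0"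
      by (metis bounded_pos compact_imp_bounded image_eqI)
    \<comment> \<open>Product rule for \<open>f * \<phi>\<close>: the Lipschitz constant of
      \<open>f\<close> times the bound of \<open>\<phi>\<close>, plus the bound of \<open>f\<close>
      times the Lipschitz constant of \<open>\<phi>\<close>.\<close>
    define B where "B = B0 / (\<delta>1/2) * M + B0 * M"
    have B: "B \<ge> 0" unfolding B_def using B0 M0 \<delta>1 by simp
    have inS2: "w \<in> Q" if "w \<in> S2" "X w \<noteq> 0" for w using that X0 unfolding Q_def by blast
    have diffk: "X w * cmod (k (w + h) - k w) \<le> B * norm h * indicator S2 w"
      if h: "norm h \<le> \<delta>0" "norm h \<le> \<delta>1/2" for w h
    proof (cases "w \<in> S2 \<and> X w \<noteq> 0")
      case False
      have "k (w + h) = 0 \<and> k w = 0" if "w \<notin> S2"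
      proof -
        have "w \<notin> S" using S2(3) that by blast
        moreover have "w + h \<notin> S"
        proof
          assume "w + h \<in> S"
          moreover have "w \<in> cball (w + h) \<delta>0" using h(1) by (simp add: dist_norm)
          ultimately show False using that unfolding S2_def by blast
        qed
        ultimately show ?thesis unfolding k_def using S(3) by simp
      qed
      then show ?thesis using False B by (auto simp: indicator_def)
    next
      case True
      then have wQ: "w \<in> Q" using inS2 by blast
      have c: "cball w \<delta>1 \<subseteq> D - E" using \<delta>1 wQ by blast
      have Bw: "cmod (f x) \<le> B0" if "x \<in> cball w \<delta>1" for x using B0(2) that wQ by blast
      have wh: "w \<in> cball w (\<delta>1/2)" "w + h \<in> cball w (\<delta>1/2)" using \<delta>1(1) h(2) by (auto simp: dist_norm)
      have wh': "w \<in> cball w \<delta>1" "w + h \<in> cball w \<delta>1" using wh \<delta>1(1) by auto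
      have "w \<in> D - E" "w + h \<in> D - E" using wh' c by blast+
      then have ff: "f0 w = f w" "f0 (w + h) = f (w + h)" by (auto simp: f0_def)
      have "cmod (f (w + h) - f w) \<le> B0 / (\<delta>1/2) * norm ((w + h) - w)"
        by (rule holo_lipschitz[OF f(1), of w]) (use c Bw wh \<delta>1 in auto)
      then have lf: "cmod (f (w + h) - f w) \<le> B0 / (\<delta>1/2) * norm h" by simp
      have lp: "cmod (\<phi> (w + h) - \<phi> w) \<le> M * norm h" using \<phi>_lip[of "w + h" w] by simp
      have "k (w + h) - k w = (f (w + h) - f w) * \<phi> (w + h) + f w * (\<phi> (w + h) - \<phi> w)"
        unfolding k_def ff by (simp add: algebra_simps)
      then have "cmod (k (w + h) - k w) \<le> cmod (f (w + h) - f w) * cmod (\<phi> (w + h)) + cmod (f w) * cmod (\<phi> (w + h) - \<phi> w)"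
        by (metis norm_mult norm_triangle_ineq)
      also have "\<dots> \<le> (B0 / (\<delta>1/2) * norm h) * M + B0 * (M * norm h)"
        using lf lp M(1) Bw[OF wh'(1)] B0(1) \<delta>1(1) by (intro add_mono mult_mono) auto
      also have "\<dots> = B * norm h" unfolding B_def by (simp add: algebra_simps)
      finally have "cmod (k (w + h) - k w) \<le> B * norm h" .
      then have "X w * cmod (k (w + h) - k w) \<le> 1 * (B * norm h)" using X01 by (intro mult_mono) auto
      then show ?thesis using True by simp
    qed
    \<comment> \<open>The discrete form of the operator applied to \<open>k\<close>, with step
      1/(n+1) in the directions \<open>v\<close> and \<open>\<i> *s v\<close>.\<close>
    define q where "q = (\<lambda>n w. of_nat (Suc n) * (k (w + \<alpha> n *\<^sub>R v) - k w) + \<i> * (of_nat (Suc n) * (k (w + \<alpha> n *\<^sub>R (\<i> *s v)) - k w)))"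
    have q_lim: "(\<lambda>n. X w *\<^sub>R q n w) \<longlonglongrightarrow> X w *\<^sub>R (f0 w * \<Phi> w)" for w
    proof (cases "X w = 0")
      case False
      have "\<exists>k'. (k has_derivative k') (at w) \<and> k' v + \<i> * k' (\<i> *s v) = f0 w * \<Phi> w"
      proof (cases "w \<in> S2")
        case True
        then have w: "w \<in> D - E" using inS2 False Q(2) by blast
        obtain L where L: "(f has_derivative L) (at w)" "\<And>c u. L (c *s u) = c * L u"
          using holo_onE[OF f(1) w] by blast
        have "(f0 has_derivative L) (at w)"
          by (rule has_derivative_transform_within_open[OF L(1) opG w]) (simp add: f0_def)
        then have "(k has_derivative (\<lambda>h. f0 w * \<phi>' w h + L h * \<phi> w)) (at w)"
          unfolding k_def by (rule has_derivative_mult) (rule \<phi>)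
        \<comment> \<open>Complex linearity of the derivative of \<open>f\<close> enters here:
          \<open>L v + \<i> * L (\<i> *s v) = 0\<close>.\<close>
        moreover have "(f0 w * \<phi>' w v + L v * \<phi> w) + \<i> * (f0 w * \<phi>' w (\<i> *s v) + L (\<i> *s v) * \<phi> w) = f0 w * \<Phi> w"
          unfolding \<Phi>_def L(2) by (simp add: algebra_simps)
        ultimately show ?thesis by blast
      next
        case notS2: False
        then have "w \<in> - S" using S2(3) by blast
        have "(k has_derivative (\<lambda>_. 0)) (at w)"
          by (rule has_derivative_transform_within_open[OF has_derivative_const[of 0] _ \<open>w \<in> - S\<close>])
             (use S(1,3) compact_imp_closed in \<open>auto simp: open_Compl k_def\<close>)
        moreover have "f0 w * \<Phi> w = 0" using \<open>w \<in> - S\<close> by (simp add: \<Phi>_def \<phi>'0)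
        ultimately show ?thesis by (intro exI[of _ "\<lambda>_. 0"]) simp
      qed
      then obtain k' where k': "(k has_derivative k') (at w)" "k' v + \<i> * k' (\<i> *s v) = f0 w * \<Phi> w" by blast
      have "(\<lambda>n. q n w) \<longlonglongrightarrow> k' v + \<i> * k' (\<i> *s v)"
        unfolding q_def \<alpha>_def by (intro tendsto_add tendsto_mult tendsto_const has_derivative_difference_quotient k'(1))
      then show ?thesis unfolding k'(2) by (intro tendsto_scaleR tendsto_const)
    qed simp
    define \<delta> where "\<delta> = Min ({\<delta>0, \<delta>1/2} \<union> e ` I)"
    have \<delta>: "0 < \<delta>" "\<delta> \<le> \<delta>0" "\<delta> \<le> \<delta>1/2" "\<And>n. n \<in> I \<Longrightarrow> \<delta> \<le> e n"
    proof -
      have fin: "finite ({\<delta>0, \<delta>1/2} \<union> e ` I)" using I(1) by simp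
      show "0 < \<delta>" unfolding \<delta>_def using fin \<delta>0(1) \<delta>1(1) P(1) by (subst Min_gr_iff) auto
      show "\<delta> \<le> \<delta>0" "\<delta> \<le> \<delta>1/2" "\<And>n. n \<in> I \<Longrightarrow> \<delta> \<le> e n"
        unfolding \<delta>_def by (rule Min_le[OF fin]; simp)+
    qed
    have "(\<lambda>n. \<alpha> n * norm v) \<longlonglongrightarrow> 0 * norm v"
      unfolding \<alpha>_def by (intro tendsto_mult tendsto_const LIMSEQ_inverse_real_of_nat)
    then have "\<forall>\<^sub>F n in sequentially. \<alpha> n * norm v < \<delta>"
      using \<delta>(1) by (intro order_tendstoD(2)[where y=0]) auto
    then obtain N where N: "\<And>n. n \<ge> N \<Longrightarrow> \<alpha> n * norm v < \<delta>" by (auto simp: eventually_sequentially)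
    have Xk: "integrable lborel (\<lambda>w. X w *\<^sub>R k w)"
      by (rule Bochner_Integration.integrable_bound[OF k_int]) (use X01 in \<open>auto intro!: AE_I2 mult_left_le_one_le\<close>)
    \<comment> \<open>Discrete integration by parts: a change of variables puts the increment on
      \<open>X\<close>, and the gain \<open>e n\<close> in the integral over \<open>A n\<close>
      cancels the Lipschitz constant \<open>1 / e n\<close>. The bound is free of \<open>B\<close>,
      which depends on the cutoffs.\<close>
    have shift: "cmod (\<integral>w. X w *\<^sub>R (k (w + h) - k w) \<partial>lborel) \<le> norm h * M * \<theta>"
      if h: "norm h < \<delta>" for h
    proof -
      have m1: "(\<lambda>w. X (w - h) *\<^sub>R k w) \<in> borel_measurable borel" by measurable
      have i1: "integrable lborel (\<lambda>w. X (w - h) *\<^sub>R k w)"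
        by (rule Bochner_Integration.integrable_bound[OF k_int]) (use X01 in \<open>auto intro!: AE_I2 mult_left_le_one_le\<close>)
      have i2: "integrable lborel (\<lambda>w. X w *\<^sub>R k (w + h))"
        using lborel_integrable_translate[OF m1, of h] i1 by simp
      have e1: "(\<integral>w. X w *\<^sub>R k (w + h) \<partial>lborel) = (\<integral>w. X (w - h) *\<^sub>R k w \<partial>lborel)"
        using lborel_integral_translate[OF m1, of h] by simp
      have "(\<integral>w. X w *\<^sub>R (k (w + h) - k w) \<partial>lborel) = (\<integral>w. X w *\<^sub>R k (w + h) \<partial>lborel) - (\<integral>w. X w *\<^sub>R k w \<partial>lborel)"
        unfolding scaleR_diff_right using i2 Xk by (rule Bochner_Integration.integral_diff)
      also have "\<dots> = (\<integral>w. (X (w - h) - X w) *\<^sub>R k w \<partial>lborel)"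
        unfolding e1 scaleR_diff_left using i1 Xk by (rule Bochner_Integration.integral_diff[symmetric])
      finally have eq: "(\<integral>w. X w *\<^sub>R (k (w + h) - k w) \<partial>lborel) = (\<integral>w. (X (w - h) - X w) *\<^sub>R k w \<partial>lborel)" .
      have "cmod (\<integral>w. (X (w - h) - X w) *\<^sub>R k w \<partial>lborel) \<le>
          (\<integral>w. (\<Sum>n\<in>I. norm h * M / e n * ?m n w) \<partial>lborel)"
      proof (rule Bochner_Integration.integral_norm_bound_integral)
        show "integrable lborel (\<lambda>w. (X (w - h) - X w) *\<^sub>R k w)"
          unfolding scaleR_diff_left using i1 Xk by (rule Bochner_Integration.integrable_diff)
        show "integrable lborel (\<lambda>w. \<Sum>n\<in>I. norm h * M / e n * ?m n w)"
          by (intro Bochner_Integration.integrable_sum integrable_mult_right P(12))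
        fix w
        \<comment> \<open>All factors lie in [0,1], so the increment of the product is at most the
          sum of their increments.\<close>
        have "\<bar>X (w - h) - X w\<bar> \<le> (\<Sum>n\<in>I. \<bar>\<psi> n (w - h) - \<psi> n w\<bar>)"
          unfolding X_def using norm_prod_diff[of I "\<lambda>n. \<psi> n (w - h)" "\<lambda>n. \<psi> n w"] P(3,4) by simp
        also have "\<dots> \<le> (\<Sum>n\<in>I. norm h / e n * indicator (A n) w)"
        proof (rule sum_mono)
          fix n assume "n \<in> I"
          then have "dist w (w - h) \<le> e n" using \<delta>(4) h by (force simp: dist_norm)
          from P(11)[OF this] show "\<bar>\<psi> n (w - h) - \<psi> n w\<bar> \<le> norm h / e n * indicator (A n) w"
            by (simp add: dist_norm abs_minus_commute)
        qed
        finally have 1: "\<bar>X (w - h) - X w\<bar> \<le> (\<Sum>n\<in>I. norm h / e n * indicator (A n) w)" .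
        have 2: "cmod (k w) \<le> M * cmod (f0 w)"
          using k_bd[of w] M0 by (cases "w \<in> S") auto
        have "norm ((X (w - h) - X w) *\<^sub>R k w) \<le> (\<Sum>n\<in>I. norm h / e n * indicator (A n) w) * (M * cmod (f0 w))"
          unfolding norm_scaleR by (rule mult_mono[OF 1 2]) (use P(1) in \<open>auto intro!: sum_nonneg simp: less_imp_le\<close>)
        also have "\<dots> = (\<Sum>n\<in>I. norm h * M / e n * ?m n w)"
          unfolding sum_distrib_right by (intro sum.cong) auto
        finally show "norm ((X (w - h) - X w) *\<^sub>R k w) \<le> (\<Sum>n\<in>I. norm h * M / e n * ?m n w)" .
      qed
      also have "\<dots> = (\<Sum>n\<in>I. norm h * M / e n * (\<integral>w. ?m n w \<partial>lborel))"
        by (subst Bochner_Integration.integral_sum) (auto intro!: integrable_mult_right P(12) simp del: times_divide_eq_left)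
      also have "\<dots> \<le> (\<Sum>n\<in>I. norm h * M / e n * ((\<theta> * (1/2) ^ Suc n) * e n))"
        using P(1,13) M0 by (intro sum_mono mult_left_mono) (auto simp: less_imp_le)
      also have "\<dots> = norm h * M * \<theta> * (\<Sum>n\<in>I. (1/2) ^ Suc n)"
        unfolding sum_distrib_left using P(1) by (intro sum.cong) (auto simp: less_imp_neq[symmetric] field_simps)
      also have "\<dots> \<le> norm h * M * \<theta> * 1"
        by (rule mult_left_mono[OF geo]) (use M0 \<open>\<theta> > 0\<close> in auto)
      finally show ?thesis unfolding eq by simp
    qed
    have ik: "integrable lborel (\<lambda>w. X w *\<^sub>R (k (w + h) - k w))" for h
    proof -
      have "integrable lborel (\<lambda>w. k (w + h))" using lborel_integrable_translate[OF k_meas] k_int by blast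
      then have "integrable lborel (\<lambda>w. k (w + h) - k w)" using k_int by (rule Bochner_Integration.integrable_diff)
      then show ?thesis
        by (rule Bochner_Integration.integrable_bound) (use X01 in \<open>auto intro!: AE_I2 mult_left_le_one_le\<close>)
    qed
    have q_bd: "cmod (\<integral>w. X w *\<^sub>R q n w \<partial>lborel) \<le> 2 * M * norm v * \<theta>" if n: "n \<ge> N" for n
    proof -
      let ?a = "of_nat (Suc n) :: complex"
      have nv: "norm (\<alpha> n *\<^sub>R v) < \<delta>" "norm (\<alpha> n *\<^sub>R (\<i> *s v)) < \<delta>"
        using N[OF n] \<alpha>(1)[of n] by (auto simp: norm_smult)
      let ?J = "\<lambda>u. (\<integral>w. X w *\<^sub>R (k (w + \<alpha> n *\<^sub>R u) - k w) \<partial>lborel)"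
      have "(\<integral>w. X w *\<^sub>R q n w \<partial>lborel) = (\<integral>w. ?a * (X w *\<^sub>R (k (w + \<alpha> n *\<^sub>R v) - k w)) + (\<i> * ?a) * (X w *\<^sub>R (k (w + \<alpha> n *\<^sub>R (\<i> *s v)) - k w)) \<partial>lborel)"
        unfolding q_def by (simp add: scaleR_conv_of_real algebra_simps del: of_nat_Suc)
      also have "\<dots> = (\<integral>w. ?a * (X w *\<^sub>R (k (w + \<alpha> n *\<^sub>R v) - k w)) \<partial>lborel) + (\<integral>w. (\<i> * ?a) * (X w *\<^sub>R (k (w + \<alpha> n *\<^sub>R (\<i> *s v)) - k w)) \<partial>lborel)"
        by (intro Bochner_Integration.integral_add integrable_mult_right ik)
      also have "\<dots> = ?a * ?J v + (\<i> * ?a) * ?J (\<i> *s v)"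
        by (simp only: integral_mult_right_zero)
      finally have "cmod (\<integral>w. X w *\<^sub>R q n w \<partial>lborel) \<le> cmod (?a * ?J v) + cmod ((\<i> * ?a) * ?J (\<i> *s v))"
        by (simp add: norm_triangle_ineq del: of_nat_Suc)
      also have "\<dots> = real (Suc n) * cmod (?J v) + real (Suc n) * cmod (?J (\<i> *s v))"
        unfolding norm_mult norm_of_nat by simp
      also have "\<dots> \<le> real (Suc n) * (norm (\<alpha> n *\<^sub>R v) * M * \<theta>) + real (Suc n) * (norm (\<alpha> n *\<^sub>R (\<i> *s v)) * M * \<theta>)"
        by (intro add_mono mult_left_mono shift nv) auto
      also have "\<dots> = (real (Suc n) * \<alpha> n) * (2 * M * norm v * \<theta>)"
        using \<alpha>(1)[of n] by (simp add: norm_smult algebra_simps del: of_nat_Suc)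
      finally show ?thesis unfolding \<alpha>(4) by simp
    qed
    \<comment> \<open>The constant \<open>B\<close> serves only as a dominating bound here; starting
      at index \<open>N\<close> makes every step short enough for it.\<close>
    have lim: "(\<lambda>n. \<integral>w. X w *\<^sub>R q (n + N) w \<partial>lborel) \<longlonglongrightarrow> (\<integral>w. X w *\<^sub>R (f0 w * \<Phi> w) \<partial>lborel)"
    proof (rule integral_dominated_convergence)
      show "(\<lambda>w. X w *\<^sub>R (f0 w * \<Phi> w)) \<in> borel_measurable lborel" by measurable
      show "(\<lambda>w. X w *\<^sub>R q (n + N) w) \<in> borel_measurable lborel" for n unfolding q_def by measurable
      show "integrable lborel (\<lambda>w. 2 * B * norm v * indicator S2 w)"
        using emeasure_compact_finite[OF S2(1)] by (intro integrable_mult_right) auto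
      show "AE w in lborel. (\<lambda>n. X w *\<^sub>R q (n + N) w) \<longlonglongrightarrow> X w *\<^sub>R (f0 w * \<Phi> w)"
        by (rule AE_I2) (rule LIMSEQ_ignore_initial_segment[OF q_lim])
      show "AE w in lborel. norm (X w *\<^sub>R q (n + N) w) \<le> 2 * B * norm v * indicator S2 w" for n
      proof (rule AE_I2)
        fix w
        let ?n = "n + N"
        let ?a = "of_nat (Suc ?n) :: complex"
        have nv: "norm (\<alpha> ?n *\<^sub>R v) \<le> \<delta>" "norm (\<alpha> ?n *\<^sub>R (\<i> *s v)) \<le> \<delta>"
          using N[of ?n] \<alpha>(1)[of ?n] by (auto simp: norm_smult)
        have "norm (X w *\<^sub>R q ?n w) \<le> X w * (cmod (?a * (k (w + \<alpha> ?n *\<^sub>R v) - k w)) + cmod (\<i> * (?a * (k (w + \<alpha> ?n *\<^sub>R (\<i> *s v)) - k w))))"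
          unfolding q_def norm_scaleR using X01[of w] by (intro mult_mono norm_triangle_ineq) auto
        also have "\<dots> = real (Suc ?n) * (X w * cmod (k (w + \<alpha> ?n *\<^sub>R v) - k w)) + real (Suc ?n) * (X w * cmod (k (w + \<alpha> ?n *\<^sub>R (\<i> *s v)) - k w))"
          unfolding norm_mult norm_of_nat by (simp add: algebra_simps del: of_nat_Suc)
        also have "\<dots> \<le> real (Suc ?n) * (B * norm (\<alpha> ?n *\<^sub>R v) * indicator S2 w) + real (Suc ?n) * (B * norm (\<alpha> ?n *\<^sub>R (\<i> *s v)) * indicator S2 w)"
          by (intro add_mono mult_left_mono diffk order_trans[OF nv(1)] order_trans[OF nv(2)] \<delta>) auto
        also have "\<dots> = (real (Suc ?n) * \<alpha> ?n) * (2 * B * norm v * indicator S2 w)"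
          using \<alpha>(1)[of ?n] by (simp add: norm_smult algebra_simps del: of_nat_Suc)
        finally show "norm (X w *\<^sub>R q ?n w) \<le> 2 * B * norm v * indicator S2 w" unfolding \<alpha>(4) by simp
      qed
    qed
    let ?X = "\<lambda>w. X w *\<^sub>R (f0 w * \<Phi> w)"
    have part1: "cmod (\<integral>w. ?X w \<partial>lborel) \<le> 2 * M * norm v * \<theta>"
      by (rule Lim_bounded[OF tendsto_norm[OF lim], of 0]) (auto intro: q_bd)
    have iX: "integrable lborel (\<lambda>w. ?X w)"
      by (rule Bochner_Integration.integrable_bound[OF f0\<Phi>]) (use X01 in \<open>auto intro!: AE_I2 mult_left_le_one_le\<close>)
    have part2: "cmod (\<integral>w. f0 w * \<Phi> w - ?X w \<partial>lborel) \<le> 2 * M * norm v * \<theta>"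
    proof -
      have "cmod (\<integral>w. f0 w * \<Phi> w - ?X w \<partial>lborel) \<le>
          (\<integral>w. (\<Sum>n\<in>I. 2 * M * norm v * ?m n w) \<partial>lborel)"
      proof (rule Bochner_Integration.integral_norm_bound_integral)
        show "integrable lborel (\<lambda>w. f0 w * \<Phi> w - ?X w)"
          using f0\<Phi> iX by (rule Bochner_Integration.integrable_diff)
        show "integrable lborel (\<lambda>w. \<Sum>n\<in>I. 2 * M * norm v * ?m n w)"
          by (intro Bochner_Integration.integrable_sum integrable_mult_right P(12))
        fix w
        have 1: "1 - X w \<le> (\<Sum>n\<in>I. indicator (A n) w)"
        proof (cases "\<exists>n\<in>I. w \<in> A n")
          case True
          then obtain n where "n \<in> I" "w \<in> A n" by blast
          then have "(1::real) \<le> (\<Sum>n\<in>I. indicator (A n) w)"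
            using member_le_sum[of n I "\<lambda>n. indicator (A n) w :: real"] I(1) by simp
          then show ?thesis using X01(1)[of w] by linarith
        next
          case False
          then have "X w = 1" by (intro X1) blast
          then show ?thesis by (simp add: sum_nonneg)
        qed
        have 2: "cmod (f0 w * \<Phi> w) \<le> cmod (f0 w) * (2 * M * norm v)"
        proof -
          have "cmod (\<Phi> w) \<le> 2 * M * norm v" using \<Phi>_bd[of w] M0 by (cases "w \<in> S") auto
          then show ?thesis unfolding norm_mult by (rule mult_left_mono) simp
        qed
        have "f0 w * \<Phi> w - ?X w = (1 - X w) *\<^sub>R (f0 w * \<Phi> w)" by (simp add: scaleR_diff_left)
        then have "norm (f0 w * \<Phi> w - ?X w) = (1 - X w) * cmod (f0 w * \<Phi> w)" using X01[of w] by simp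
        also have "\<dots> \<le> (\<Sum>n\<in>I. indicator (A n) w) * (cmod (f0 w) * (2 * M * norm v))"
          by (rule mult_mono[OF 1 2]) (auto intro: sum_nonneg)
        also have "\<dots> = (\<Sum>n\<in>I. 2 * M * norm v * ?m n w)"
          unfolding sum_distrib_right by (intro sum.cong) auto
        finally show "norm (f0 w * \<Phi> w - ?X w) \<le> (\<Sum>n\<in>I. 2 * M * norm v * ?m n w)" .
      qed
      also have "\<dots> = (\<Sum>n\<in>I. 2 * M * norm v * (\<integral>w. ?m n w \<partial>lborel))"
        by (subst Bochner_Integration.integral_sum) (auto intro!: integrable_mult_right P(12))
      also have "\<dots> \<le> (\<Sum>n\<in>I. 2 * M * norm v * (\<theta> * (1/2) ^ Suc n))"
      proof (intro sum_mono mult_left_mono)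
        fix n
        have "(\<theta> * (1/2) ^ Suc n) * e n \<le> \<theta> * (1/2) ^ Suc n"
          using P(1,2)[of n] \<open>\<theta> > 0\<close> by (intro mult_right_le_one_le) auto
        then show "(\<integral>w. ?m n w \<partial>lborel) \<le> \<theta> * (1/2) ^ Suc n" using P(13)[of n] by linarith
      qed (use M0 in auto)
      also have "\<dots> = 2 * M * norm v * \<theta> * (\<Sum>n\<in>I. (1/2) ^ Suc n)"
        unfolding sum_distrib_left by (intro sum.cong) auto
      also have "\<dots> \<le> 2 * M * norm v * \<theta> * 1"
        by (rule mult_left_mono[OF geo]) (use M0 \<open>\<theta> > 0\<close> in auto)
      finally show ?thesis by simp
    qed
    have "?I = (\<integral>w. ?X w \<partial>lborel) + (\<integral>w. f0 w * \<Phi> w - ?X w \<partial>lborel)"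
      using Bochner_Integration.integral_diff[OF f0\<Phi> iX] by simp
    then have "cmod ?I \<le> cmod (\<integral>w. ?X w \<partial>lborel) + cmod (\<integral>w. f0 w * \<Phi> w - ?X w \<partial>lborel)"
      by (simp only: norm_triangle_ineq)
    then show ?thesis using part1 part2 by linarith
  qed
  have "cmod ?I \<le> 0"
  proof (rule field_le_epsilon)
    fix \<epsilon> :: real assume "0 < \<epsilon>"
    \<comment> \<open>The \<open>+ 1\<close> guards against \<open>M * norm v = 0\<close>.\<close>
    define \<theta> where "\<theta> = \<epsilon> / (4 * M * norm v + 1)"
    have p: "4 * M * norm v + 1 > 0" using mult_nonneg_nonneg[OF M0 norm_ge_zero[of v]] by linarith
    then have "\<theta> > 0" unfolding \<theta>_def using \<open>0 < \<epsilon>\<close> by simp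
    have "cmod ?I \<le> (4 * M * norm v) * \<theta>" using main[OF \<open>\<theta> > 0\<close>] .
    also have "\<dots> \<le> (4 * M * norm v + 1) * \<theta>" using \<open>\<theta> > 0\<close> by (intro mult_right_mono) auto
    also have "\<dots> = \<epsilon>" unfolding \<theta>_def using less_imp_neq[OF p] by (simp only: times_divide_eq_right nonzero_mult_div_cancel_left not_False_eq_True)
    finally show "cmod ?I \<le> 0 + \<epsilon>" by simp
  qed
  then show ?thesis unfolding f0_def \<Phi>_def by simp
qed

section \<open>A radial smoothing kernel\<close>

text \<open>Dominated convergence: the difference quotient and the derivative are both bounded by
  \<open>B\<close>, so the normalised remainder is at most \<open>2 * B\<close>. The kernel is
  differentiated in this way with respect to its centre and with respect to its scale.\<close>

lemma has_derivative_integral_parameter: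
  fixes \<kappa> :: "'p::euclidean_space \<Rightarrow> 'a \<Rightarrow> real" and q :: "'a \<Rightarrow> complex"
  assumes q: "integrable M q"
    and \<kappa>: "\<And>w. ((\<lambda>p. \<kappa> p w) has_derivative \<kappa>' w) (at p)"
    and meas: "\<And>p. \<kappa> p \<in> borel_measurable M" "\<And>h. (\<lambda>w. \<kappa>' w h) \<in> borel_measurable M"
    and bd: "\<And>p' w. dist p' p < \<delta> \<Longrightarrow> \<bar>\<kappa> p' w\<bar> \<le> C" and bd': "\<And>w h. \<bar>\<kappa>' w h\<bar> \<le> B * norm h"
    and lip: "0 < \<delta>" "\<And>w p'. dist p' p < \<delta> \<Longrightarrow> \<bar>\<kappa> p' w - \<kappa> p w\<bar> \<le> B * dist p' p"
  shows "((\<lambda>p. \<integral>w. \<kappa> p w *\<^sub>R q w \<partial>M) has_derivative (\<lambda>h. \<integral>w. \<kappa>' w h *\<^sub>R q w \<partial>M)) (at p)"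
proof -
  note [measurable] = meas
  have [measurable]: "q \<in> borel_measurable M" using q by simp
  have int: "integrable M (\<lambda>w. u w *\<^sub>R q w)" if [measurable]: "u \<in> borel_measurable M" and "\<And>w. \<bar>u w\<bar> \<le> c" for u c
  proof (rule Bochner_Integration.integrable_bound)
    show "integrable M (\<lambda>w. c *\<^sub>R q w)" using q by simp
    have "\<bar>u w\<bar> \<le> \<bar>c\<bar>" for w using that(2)[of w] by simp
    then show "AE w in M. norm (u w *\<^sub>R q w) \<le> norm (c *\<^sub>R q w)" by (auto intro!: AE_I2 mult_right_mono)
  qed measurable
  have i0: "integrable M (\<lambda>w. \<kappa> p' w *\<^sub>R q w)" if "dist p' p < \<delta>" for p' using bd[OF that] by (intro int meas)
  have i1: "integrable M (\<lambda>w. \<kappa>' w h *\<^sub>R q w)" for h using bd' by (intro int meas)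
  have lin: "linear (\<kappa>' w)" for w using \<kappa> has_derivative_linear by blast
  have B: "0 \<le> B"
  proof -
    obtain b :: 'p where "b \<in> Basis" using nonempty_Basis by blast
    then show ?thesis using bd'[of undefined b] by simp
  qed
  let ?\<Delta> = "\<lambda>h. (\<integral>w. \<kappa> (p + h) w *\<^sub>R q w \<partial>M) - (\<integral>w. \<kappa> p w *\<^sub>R q w \<partial>M) - (\<integral>w. \<kappa>' w h *\<^sub>R q w \<partial>M)"
  show ?thesis
    unfolding has_derivative_at
  proof
    show "bounded_linear (\<lambda>h. \<integral>w. \<kappa>' w h *\<^sub>R q w \<partial>M)"
    proof (rule bounded_linear_intro)
      show "(\<integral>w. \<kappa>' w (x + y) *\<^sub>R q w \<partial>M) = (\<integral>w. \<kappa>' w x *\<^sub>R q w \<partial>M) + (\<integral>w. \<kappa>' w y *\<^sub>R q w \<partial>M)" for x y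
        unfolding linear_add[OF lin] scaleR_add_left by (rule Bochner_Integration.integral_add[OF i1 i1])
      show "(\<integral>w. \<kappa>' w (r *\<^sub>R x) *\<^sub>R q w \<partial>M) = r *\<^sub>R (\<integral>w. \<kappa>' w x *\<^sub>R q w \<partial>M)" for r x
        unfolding linear_scale[OF lin] by (simp add: scaleR_scaleR[symmetric] del: scaleR_scaleR)
      show "norm (\<integral>w. \<kappa>' w h *\<^sub>R q w \<partial>M) \<le> norm h * (B * (\<integral>w. norm (q w) \<partial>M))" for h
      proof -
        have "norm (\<integral>w. \<kappa>' w h *\<^sub>R q w \<partial>M) \<le> (\<integral>w. norm (\<kappa>' w h *\<^sub>R q w) \<partial>M)" by (rule integral_norm_bound)
        also have "\<dots> \<le> (\<integral>w. (B * norm h) * norm (q w) \<partial>M)"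
          using integrable_norm[OF i1, of h] q bd' by (intro integral_mono) (auto intro!: mult_right_mono)
        also have "\<dots> = norm h * (B * (\<integral>w. norm (q w) \<partial>M))" by simp
        finally show ?thesis .
      qed
    qed
    show "(\<lambda>h. norm (?\<Delta> h) / norm h) \<midarrow>0\<rightarrow> 0"
      unfolding tendsto_at_iff_sequentially
    proof (intro allI impI)
      fix X :: "nat \<Rightarrow> 'p"
      assume X: "\<forall>i. X i \<in> UNIV - {0}" "X \<longlonglongrightarrow> 0"
      then have "\<forall>\<^sub>F n in sequentially. dist (X n) 0 < \<delta>" using lip(1) by (auto simp: tendsto_iff)
      then obtain N where N: "\<And>n. n \<ge> N \<Longrightarrow> norm (X n) < \<delta>" by (auto simp: eventually_sequentially)
      define R where "R = (\<lambda>n w. \<bar>\<kappa> (p + X n) w - \<kappa> p w - \<kappa>' w (X n)\<bar> / norm (X n))"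
      have R_meas [measurable]: "R n \<in> borel_measurable M" for n unfolding R_def by measurable
      have R_bd: "R n w \<le> 2 * B" if "n \<ge> N" for n w
      proof -
        have "\<bar>\<kappa> (p + X n) w - \<kappa> p w - \<kappa>' w (X n)\<bar> \<le> B * norm (X n) + B * norm (X n)"
          using lip(2)[of "p + X n" w] N[OF that] bd'[of w "X n"] by (simp add: dist_norm)
        then show ?thesis unfolding R_def using X(1) by (simp add: divide_le_eq)
      qed
      have R_lim: "(\<lambda>n. R n w) \<longlonglongrightarrow> 0" for w
      proof -
        have "(\<lambda>h. norm (\<kappa> (p + h) w - \<kappa> p w - \<kappa>' w h) / norm h) \<midarrow>0\<rightarrow> 0"
          using \<kappa>[of w] unfolding has_derivative_at by blast
        then have "((\<lambda>h. norm (\<kappa> (p + h) w - \<kappa> p w - \<kappa>' w h) / norm h) \<circ> X) \<longlonglongrightarrow> 0"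
          using X unfolding tendsto_at_iff_sequentially by blast
        then show ?thesis unfolding R_def o_def by simp
      qed
      have "(\<lambda>n. \<integral>w. R (n + N) w * norm (q w) \<partial>M) \<longlonglongrightarrow> (\<integral>w. 0 \<partial>M)"
      proof (rule integral_dominated_convergence)
        show "integrable M (\<lambda>w. 2 * B * norm (q w))" using q by simp
        show "AE w in M. (\<lambda>n. R (n + N) w * norm (q w)) \<longlonglongrightarrow> 0"
          using tendsto_mult_left_zero[OF LIMSEQ_ignore_initial_segment[OF R_lim]] by simp
        show "AE w in M. norm (R (n + N) w * norm (q w)) \<le> 2 * B * norm (q w)" for n
        proof (rule AE_I2)
          fix w
          have "0 \<le> R (n + N) w" unfolding R_def by simp
          then show "norm (R (n + N) w * norm (q w)) \<le> 2 * B * norm (q w)"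
            using R_bd[of "n + N" w] by (auto simp: abs_mult intro!: mult_right_mono)
        qed
      qed measurable
      then have lim: "(\<lambda>n. \<integral>w. R n w * norm (q w) \<partial>M) \<longlonglongrightarrow> 0" using LIMSEQ_offset by force
      show "((\<lambda>h. norm (?\<Delta> h) / norm h) \<circ> X) \<longlonglongrightarrow> 0"
      proof (rule Lim_null_comparison[OF _ lim], rule eventually_sequentiallyI[of N])
        fix n
        assume n: "N \<le> n"
        have "?\<Delta> (X n) =
            (\<integral>w. \<kappa> (p + X n) w *\<^sub>R q w - \<kappa> p w *\<^sub>R q w - \<kappa>' w (X n) *\<^sub>R q w \<partial>M)"
          using i0[of "p + X n"] i0[of p] i1 N[OF n] lip(1) by (simp add: dist_norm)
        then have "norm (?\<Delta> (X n)) / norm (X n)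
            \<le> (\<integral>w. norm (\<kappa> (p + X n) w *\<^sub>R q w - \<kappa> p w *\<^sub>R q w - \<kappa>' w (X n) *\<^sub>R q w) \<partial>M) / norm (X n)"
          by (intro divide_right_mono) (auto intro: integral_norm_bound)
        also have "\<dots> = (\<integral>w. R n w * norm (q w) \<partial>M)"
          unfolding R_def by (simp add: scaleR_diff_left[symmetric] integral_divide_zero[symmetric] del: integral_divide_zero)
        finally show "norm (((\<lambda>h. norm (?\<Delta> h) / norm h) \<circ> X) n)
            \<le> (\<integral>w. R n w * norm (q w) \<partial>M)" by simp
      qed
    qed
  qed
qed

text \<open>The factor \<open>a ^ CARD('n)\<close> makes the total mass independent of \<open>a\<close>.\<close>
definition kern :: "real \<Rightarrow> complex^'n \<Rightarrow> real" where
  "kern a x = a ^ CARD('n) * (max 0 (1 - a * (norm x)\<^sup>2))\<^sup>2"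

definition kern' :: "real \<Rightarrow> complex^'n \<Rightarrow> complex^'n \<Rightarrow> real" where
  "kern' a x h = - (4 * a ^ Suc CARD('n) * max 0 (1 - a * (norm x)\<^sup>2) * (x \<bullet> h))"

text \<open>The square smooths the corner at 0, so the truncated quadratic in \<open>kern\<close> is
  differentiable across the sphere where its support ends.\<close>

lemma has_derivative_pos_part_square:
  "((\<lambda>t::real. (max 0 t)\<^sup>2) has_real_derivative 2 * max 0 t) (at t)"
proof (cases "t = 0")
  case True
  have "(\<lambda>h. ((max 0 (0 + h))\<^sup>2 - (max 0 0)\<^sup>2) / h) \<midarrow>0\<rightarrow> (0::real)"
  proof (rule Lim_null_comparison)
    show "\<forall>\<^sub>F h::real in at 0. norm (((max 0 (0 + h))\<^sup>2 - (max 0 0)\<^sup>2) / h) \<le> \<bar>h\<bar>"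
      by (rule always_eventually) (auto simp: max_def power2_eq_square)
    show "((\<lambda>h::real. \<bar>h\<bar>) \<longlongrightarrow> 0) (at 0)" by (rule tendsto_rabs_zero) (rule tendsto_ident_at)
  qed
  then show ?thesis unfolding DERIV_def True by simp
next
  case False
  show ?thesis
  proof (cases "t > 0")
    case True
    have "((\<lambda>t::real. t\<^sup>2) has_real_derivative 2 * max 0 t) (at t)"
      using True by (auto intro!: derivative_eq_intros)
    then show ?thesis
      by (rule has_field_derivative_transform_within_open[of _ _ _ "{0<..}"]) (use True in auto)
  next
    case f: False
    have "((\<lambda>t::real. 0) has_real_derivative 2 * max 0 t) (at t)" using f by auto
    then show ?thesis
      by (rule has_field_derivative_transform_within_open[of _ _ _ "{..<0}"]) (use f False in auto)
  qed
qed

lemma kern_has_derivative: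
  fixes x :: "complex^'n"
  shows "(kern a has_derivative kern' a x) (at x)"
proof -
  have "((\<lambda>x::complex^'n. 1 - a * (norm x)\<^sup>2) has_derivative (\<lambda>h. - (a * (2 * (x \<bullet> h))))) (at x)"
    unfolding power2_norm_eq_inner by (auto intro!: derivative_eq_intros simp: inner_commute)
  from has_derivative_compose[OF this has_derivative_pos_part_square[unfolded has_field_derivative_def]]
  have "((\<lambda>x::complex^'n. (max 0 (1 - a * (norm x)\<^sup>2))\<^sup>2) has_derivative
     (\<lambda>h. 2 * max 0 (1 - a * (norm x)\<^sup>2) * - (a * (2 * (x \<bullet> h))))) (at x)" .
  from has_derivative_mult_right[OF this, of "a ^ CARD('n)"] show ?thesis
    unfolding kern_def[abs_def] kern'_def[abs_def] by (simp add: mult_ac)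
qed

lemma kern_has_derivative_scale:
  "((\<lambda>a. kern a (x::complex^'n)) has_real_derivative
     real CARD('n) * a ^ (CARD('n) - 1) * (max 0 (1 - a * (norm x)\<^sup>2))\<^sup>2
      - 2 * a ^ CARD('n) * (norm x)\<^sup>2 * max 0 (1 - a * (norm x)\<^sup>2)) (at a)"
proof -
  have "((\<lambda>a. 1 - a * (norm x)\<^sup>2) has_real_derivative - ((norm x)\<^sup>2)) (at a)"
    by (auto intro!: derivative_eq_intros)
  from DERIV_chain2[OF has_derivative_pos_part_square this]
  have "((\<lambda>a. (max 0 (1 - a * (norm x)\<^sup>2))\<^sup>2) has_real_derivative 2 * max 0 (1 - a * (norm x)\<^sup>2) * - (norm x)\<^sup>2) (at a)" .
  from DERIV_mult[OF DERIV_power[OF DERIV_ident, of "CARD('n)"] this]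
  show ?thesis unfolding kern_def by (rule DERIV_cong) (simp add: algebra_simps)
qed

context
  fixes a :: real
  assumes a: "0 < a"
begin

text \<open>The factor \<open>t\<close> vanishes once \<open>a * (norm x)\<^sup>2\<close> reaches 1,
  so its products with powers of \<open>norm x\<close> stay bounded. The last bound is crude: it
  uses \<open>norm x \<le> 1 + (norm x)\<^sup>2\<close> and avoids square roots.\<close>

lemma kern_pos_part_bounds:
  fixes x :: "complex^'n"
  defines "t \<equiv> max 0 (1 - a * (norm x)\<^sup>2)"
  shows "0 \<le> t" "t \<le> 1" "t * (norm x)\<^sup>2 \<le> 1 / a" "t * norm x \<le> 1 + 1 / a"
proof -
  show t: "0 \<le> t" "t \<le> 1" unfolding t_def using a by auto
  show sq: "t * (norm x)\<^sup>2 \<le> 1 / a"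
  proof (cases "a * (norm x)\<^sup>2 \<le> 1")
    case True
    then have "(norm x)\<^sup>2 \<le> 1 / a" using a by (simp add: field_simps)
    moreover have "t * (norm x)\<^sup>2 \<le> (norm x)\<^sup>2" using t by (simp add: mult_left_le_one_le)
    ultimately show ?thesis by linarith
  qed (use a in \<open>simp add: t_def\<close>)
  have "norm x \<le> 1 + (norm x)\<^sup>2"
    using zero_le_power2[of "norm x - 1/2"] by (simp add: power2_eq_square algebra_simps)
  then have "t * norm x \<le> t * (1 + (norm x)\<^sup>2)" using t by (intro mult_left_mono)
  also have "\<dots> \<le> 1 + 1 / a" using sq t by (simp add: algebra_simps)
  finally show "t * norm x \<le> 1 + 1 / a" .
qed

lemma kern_nonneg: "0 \<le> kern a x"
  unfolding kern_def using a by simp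

lemma kern_le: "kern a (x::complex^'n) \<le> a ^ CARD('n)"
  unfolding kern_def using a kern_pos_part_bounds(1,2)[of x]
  by (intro mult_right_le_one_le) (auto simp: power_le_one)

lemma kern_eq_0: "1 \<le> a * (norm x)\<^sup>2 \<Longrightarrow> kern a x = 0"
  unfolding kern_def by simp

lemma kern'_bound:
  fixes x :: "complex^'n"
  shows "\<bar>kern' a x h\<bar> \<le> 4 * a ^ Suc CARD('n) * (1 + 1 / a) * norm h"
proof -
  have "\<bar>kern' a x h\<bar> = 4 * a ^ Suc CARD('n) * (max 0 (1 - a * (norm x)\<^sup>2) * \<bar>x \<bullet> h\<bar>)"
    unfolding kern'_def using a by (simp add: abs_mult)
  also have "\<dots> \<le> 4 * a ^ Suc CARD('n) * (max 0 (1 - a * (norm x)\<^sup>2) * (norm x * norm h))"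
    using a by (intro mult_left_mono Cauchy_Schwarz_ineq2) auto
  also have "\<dots> = 4 * a ^ Suc CARD('n) * ((max 0 (1 - a * (norm x)\<^sup>2) * norm x) * norm h)" by simp
  also have "\<dots> \<le> 4 * a ^ Suc CARD('n) * ((1 + 1 / a) * norm h)"
    using a kern_pos_part_bounds(4)[of x] by (intro mult_left_mono mult_right_mono) auto
  finally show ?thesis by (simp add: mult_ac)
qed

text \<open>Serves the product rule for \<open>cnj (x $ j) * kern a x\<close>, whose first factor is
  unbounded.\<close>

lemma norm_kern'_bound:
  fixes x :: "complex^'n"
  shows "norm x * \<bar>kern' a x h\<bar> \<le> 4 * a ^ CARD('n) * norm h"
proof -
  have "norm x * \<bar>kern' a x h\<bar> = 4 * a ^ Suc CARD('n) * (norm x * (max 0 (1 - a * (norm x)\<^sup>2) * \<bar>x \<bullet> h\<bar>))"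
    unfolding kern'_def using a by (simp add: abs_mult)
  also have "\<dots> \<le> 4 * a ^ Suc CARD('n) * (norm x * (max 0 (1 - a * (norm x)\<^sup>2) * (norm x * norm h)))"
    using a by (intro mult_left_mono Cauchy_Schwarz_ineq2) auto
  also have "\<dots> = 4 * a ^ Suc CARD('n) * ((max 0 (1 - a * (norm x)\<^sup>2) * (norm x)\<^sup>2) * norm h)" by (simp add: power2_eq_square)
  also have "\<dots> \<le> 4 * a ^ Suc CARD('n) * ((1 / a) * norm h)"
    using a kern_pos_part_bounds(3)[of x] by (intro mult_left_mono mult_right_mono) auto
  also have "\<dots> = 4 * a ^ CARD('n) * norm h" using a by simp
  finally show ?thesis .
qed

end

lemma kern_measurable [measurable]:
  assumes [measurable]: "g \<in> borel_measurable M"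
  shows "(\<lambda>w. kern a (g w)) \<in> borel_measurable M"
  unfolding kern_def by measurable

lemma kern'_measurable [measurable]:
  assumes [measurable]: "g \<in> borel_measurable M"
  shows "(\<lambda>w. kern' a (g w) h) \<in> borel_measurable M"
  unfolding kern'_def by measurable

lemma kern_lipschitz:
  assumes "0 < a"
  shows "\<bar>kern a x - kern a y\<bar> \<le> 4 * a ^ Suc CARD('n) * (1 + 1 / a) * norm (x - (y::complex^'n))"
proof -
  have "norm (kern a x - kern a y) \<le> 4 * a ^ Suc CARD('n) * (1 + 1 / a) * norm (x - y)"
    by (rule differentiable_bound[of UNIV "kern a" "kern' a"])
       (auto intro!: onorm_le kern_has_derivative order_trans[OF kern'_bound[OF assms]] simp del: power_Suc)
  then show ?thesis by simp
qed

section \<open>Convolution with the kernel\<close>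

text \<open>The kernel is not normalised; its total mass \<open>kern_mass\<close> is divided out
  only when an extension or a limit is recovered.\<close>

definition smoothing :: "(complex^'n \<Rightarrow> complex) \<Rightarrow> real \<Rightarrow> complex^'n \<Rightarrow> complex" where
  "smoothing q a z = (\<integral>w. kern a (w - z) *\<^sub>R q w \<partial>lborel)"

lemma smoothing_has_derivative:
  fixes q :: "complex^'n \<Rightarrow> complex"
  assumes q: "integrable lborel q" and a: "0 < a"
  shows "(smoothing q a has_derivative (\<lambda>h. \<integral>w. (- kern' a (w - z) h) *\<^sub>R q w \<partial>lborel)) (at z)"
  unfolding smoothing_def[abs_def]
proof (rule has_derivative_integral_parameter[OF q, where \<delta>=1 and C="a ^ CARD('n)"
      and B="4 * a ^ Suc CARD('n) * (1 + 1 / a)"])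
  show "((\<lambda>z. kern a (w - z)) has_derivative (\<lambda>h. - kern' a (w - z) h)) (at z)" for w
  proof -
    have "((\<lambda>z. w - z) has_derivative (\<lambda>h. - h)) (at z)" by (auto intro!: derivative_eq_intros)
    from has_derivative_compose[OF this kern_has_derivative]
    show ?thesis by (simp add: kern'_def)
  qed
  show "\<bar>kern a (w - z') - kern a (w - z)\<bar> \<le> 4 * a ^ Suc CARD('n) * (1 + 1 / a) * dist z' z" for w z'
    using kern_lipschitz[OF a, of "w - z'" "w - z"] by (simp add: dist_norm norm_minus_commute)
  show "\<bar>kern a (w - z)\<bar> \<le> a ^ CARD('n)" for z w :: "complex^'n" using kern_nonneg[OF a, of "w - z"] kern_le[OF a, of "w - z"] by simp
  show "\<bar>- kern' a (w - z) h\<bar> \<le> 4 * a ^ Suc CARD('n) * (1 + 1 / a) * norm h" for w h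
    using kern'_bound[OF a, of "w - z" h] by simp
  show "(\<lambda>w. kern a (w - z)) \<in> borel_measurable lborel" for z :: "complex^'n"
    by (rule kern_measurable) simp
  show "(\<lambda>w. - kern' a (w - z) h) \<in> borel_measurable lborel" for h
    by (intro borel_measurable_uminus kern'_measurable) simp
qed simp

section \<open>The reproducing formula\<close>

text \<open>Boundedness of \<open>D\<close> turns square integrability into integrability, so
  \<open>f\<close> extended by 0 can be convolved. The case \<open>E = {}\<close> is used as well:
  it normalises the kernel and treats bounded limits of holomorphic functions.\<close>

locale punctured_L2 =
  fixes D E :: "(complex^'n) set" and f :: "complex^'n \<Rightarrow> complex"
  assumes D: "open D" "bounded D" and E: "closedin (top_of_set D) E" "sigma_codim_two E"
    and f: "holo_on f (D - E)" "set_integrable lborel (D - E) (\<lambda>z. (cmod (f z))\<^sup>2)"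
begin

definition f0 :: "complex^'n \<Rightarrow> complex" where
  "f0 w = indicator (D - E) w *\<^sub>R f w"

lemma open_diff: "open (D - E)"
  using D(1) E(1) by (metis closedin_def openin_open_eq topspace_euclidean_subtopology)

lemma f0_measurable [measurable]: "f0 \<in> borel_measurable borel"
  unfolding f0_def[abs_def]
  by (rule borel_measurable_continuous_on_indicator) (use open_diff holo_on_imp_continuous_on[OF f(1)] in auto)

lemma f0_integrable: "integrable lborel f0"
proof (rule Bochner_Integration.integrable_bound)
  have "emeasure lborel (D - E) < \<infinity>" using D(2) by (intro emeasure_bounded_finite bounded_diff)
  then show "integrable lborel (\<lambda>w. indicator (D - E) w + indicator (D - E) w *\<^sub>R (cmod (f w))\<^sup>2)"
    using f(2) open_diff unfolding set_integrable_def by (intro Bochner_Integration.integrable_add) auto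
  have "c \<le> 1 + c\<^sup>2" for c :: real
    using zero_le_power2[of "c - 1/2"] by (simp add: power2_eq_square algebra_simps)
  then show "AE w in lborel. norm (f0 w) \<le> norm (indicator (D - E) w + indicator (D - E) w *\<^sub>R (cmod (f w))\<^sup>2 :: real)"
    by (intro AE_I2) (auto simp: f0_def indicator_def)
qed measurable

lemma weak_dbar':
  assumes "\<And>w. (\<phi> has_derivative \<phi>' w) (at w)"
    and "\<And>w. cmod (\<phi> w) \<le> M" "\<And>w h. cmod (\<phi>' w h) \<le> M * norm h"
    and "cball z r \<subseteq> D" "\<And>w. w \<notin> cball z r \<Longrightarrow> \<phi> w = 0"
  shows "(\<integral>w. f0 w * (\<phi>' w v + \<i> * \<phi>' w (\<i> *s v)) \<partial>lborel) = 0"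
  unfolding f0_def using weak_dbar[OF D(1) E f assms(1-3), of "cball z r"] assms(4,5) by simp

text \<open>The condition \<open>1 \<le> a * r\<^sup>2\<close> says that the radius 1/sqrt(a) of the
  kernel is at most \<open>r\<close>.\<close>

lemma kern_support:
  assumes "1 \<le> a * r\<^sup>2" "0 < r" "w \<notin> cball z r"
  shows "kern a (w - z :: complex^'n) = 0"
proof -
  have a: "0 < a" using assms(1,2) by (smt (verit) mult_nonpos_nonneg zero_le_power2)
  have "r \<le> norm (w - z)" using assms(3) by (simp add: dist_norm norm_minus_commute)
  then have "a * r\<^sup>2 \<le> a * (norm (w - z))\<^sup>2" using a assms(2) by (intro mult_left_mono power_mono) auto
  then show ?thesis using kern_eq_0[OF a, of "w - z"] assms(1) by linarith
qed

text \<open>Differentiation in the centre \<open>z\<close> is, up to sign, differentiation of the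
  kernel in \<open>w\<close>. The kernel centred at \<open>z\<close> is an admissible test function,
  and the weak equation for it says that the real derivative commutes with multiplication by
  \<open>\<i>\<close>.\<close>

lemma holo_on_smoothing:
  assumes "0 < r" and ar: "1 \<le> a * r\<^sup>2"
  shows "holo_on (smoothing f0 a) {z. cball z r \<subseteq> D}"
  unfolding holo_on_def
proof
  fix z assume "z \<in> {z. cball z r \<subseteq> D}"
  then have z: "cball z r \<subseteq> D" by simp
  have a: "0 < a" using assms by (smt (verit) mult_nonpos_nonneg zero_le_power2)
  define L where "L = (\<lambda>h. \<integral>w. (- kern' a (w - z) h) *\<^sub>R f0 w \<partial>lborel)"
  have der: "(smoothing f0 a has_derivative L) (at z)"
    unfolding L_def by (rule smoothing_has_derivative[OF f0_integrable a])
  have lin: "linear L" using der by (rule has_derivative_linear)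
  have int: "integrable lborel (\<lambda>w. kern' a (w - z) h *\<^sub>R f0 w)" for h
  proof (rule Bochner_Integration.integrable_bound)
    let ?c = "4 * a ^ Suc CARD('n) * (1 + 1 / a) * norm h"
    show "integrable lborel (\<lambda>w. ?c *\<^sub>R f0 w)" using f0_integrable by simp
    have "\<bar>kern' a (w - z) h\<bar> \<le> \<bar>?c\<bar>" for w by (rule order_trans[OF kern'_bound[OF a] abs_ge_self])
    then show "AE w in lborel. norm (kern' a (w - z) h *\<^sub>R f0 w) \<le> norm (?c *\<^sub>R f0 w)"
      unfolding norm_scaleR by (intro AE_I2 mult_right_mono) auto
  qed measurable
  have Li: "L (\<i> *s h) = \<i> * L h" for h
  proof -
    let ?C = "max (a ^ CARD('n)) (4 * a ^ Suc CARD('n) * (1 + 1 / a))"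
    have "(\<integral>w. f0 w * (of_real (kern' a (w - z) h) + \<i> * of_real (kern' a (w - z) (\<i> *s h))) \<partial>lborel) = 0"
    proof (rule weak_dbar'[where \<phi>="\<lambda>w. of_real (kern a (w - z))" and M="?C" and z=z and r=r])
      show "((\<lambda>w. complex_of_real (kern a (w - z))) has_derivative (\<lambda>h. of_real (kern' a (w - z) h))) (at w)" for w
      proof -
        have "((\<lambda>w. w - z) has_derivative (\<lambda>h. h)) (at w)" by (auto intro!: derivative_eq_intros)
        from has_derivative_of_real[OF has_derivative_compose[OF this kern_has_derivative]] show ?thesis .
      qed
      show "cmod (of_real (kern a (w - z))) \<le> ?C" for w
        using kern_nonneg[OF a, of "w - z"] kern_le[OF a, of "w - z"] by (simp add: max.coboundedI1)
      show "cmod (of_real (kern' a (w - z) h)) \<le> ?C * norm h" for w h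
      proof -
        have "\<bar>kern' a (w - z) h\<bar> \<le> 4 * a ^ Suc CARD('n) * (1 + 1 / a) * norm h" by (rule kern'_bound[OF a])
        also have "\<dots> \<le> ?C * norm h" by (intro mult_right_mono) auto
        finally show ?thesis by simp
      qed
      show "complex_of_real (kern a (w - z)) = 0" if "w \<notin> cball z r" for w
        using kern_support[OF ar \<open>0 < r\<close> that] by simp
    qed (rule z)
    also have "(\<integral>w. f0 w * (of_real (kern' a (w - z) h) + \<i> * of_real (kern' a (w - z) (\<i> *s h))) \<partial>lborel)
        = (\<integral>w. kern' a (w - z) h *\<^sub>R f0 w + \<i> * (kern' a (w - z) (\<i> *s h) *\<^sub>R f0 w) \<partial>lborel)"
      by (simp add: scaleR_conv_of_real algebra_simps)
    also have "\<dots> = (\<integral>w. kern' a (w - z) h *\<^sub>R f0 w \<partial>lborel) + (\<integral>w. \<i> * (kern' a (w - z) (\<i> *s h) *\<^sub>R f0 w) \<partial>lborel)"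
      by (intro Bochner_Integration.integral_add integrable_mult_right int)
    also have "(\<integral>w. \<i> * (kern' a (w - z) (\<i> *s h) *\<^sub>R f0 w) \<partial>lborel) = \<i> * (\<integral>w. kern' a (w - z) (\<i> *s h) *\<^sub>R f0 w \<partial>lborel)"
      by (rule integral_mult_right_zero)
    also have "(\<integral>w. kern' a (w - z) h *\<^sub>R f0 w \<partial>lborel) + \<dots> = - (L h + \<i> * L (\<i> *s h))"
      unfolding L_def by (simp add: scaleR_minus_left)
    finally have "L h + \<i> * L (\<i> *s h) = 0" by (simp only: neg_equal_0_iff_equal)
    then have "\<i> * (L h + \<i> * L (\<i> *s h)) = 0" by simp
    then show ?thesis by (simp add: algebra_simps)
  qed
  have "L (c *s h) = c * L h" for c h
  proof -
    have "c *s h = Re c *\<^sub>R h + Im c *\<^sub>R (\<i> *s h)"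
      by (simp add: vec_eq_iff complex_eq_iff)
    then have "L (c *s h) = Re c *\<^sub>R L h + Im c *\<^sub>R (\<i> * L h)"
      using linear_add[OF lin] linear_scale[OF lin] Li by metis
    also have "\<dots> = c * L h" by (simp add: complex_eq_iff)
    finally show ?thesis .
  qed
  then show "\<exists>L. (smoothing f0 a has_derivative L) (at z) \<and> (\<forall>c w. L (c *s w) = c * L w)"
    using der by blast
qed

text \<open>Up to the factor \<open>2a\<close>, the \<open>a\<close>-derivative of the kernel is
  \<open>\<Sum>j. \<partial>(cnj (x$j) * kern a x) / \<partial>(cnj x$j)\<close>, which is orthogonal to \<open>f0\<close>.\<close>
lemma smoothing_scale_derivative:
  assumes "0 < r" and ar: "1 \<le> a * r\<^sup>2" and z: "cball z r \<subseteq> D"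
  shows "((\<lambda>a. smoothing f0 a z) has_vector_derivative 0) (at a)"
proof -
  have a: "0 < a" using assms by (smt (verit) mult_nonpos_nonneg zero_le_power2)
  define d where "d = CARD('n)"
  have d: "d > 0" unfolding d_def by simp
  define t where "t = (\<lambda>b (x::complex^'n). max 0 (1 - b * (norm x)\<^sup>2))"
  define k' where "k' = (\<lambda>b (x::complex^'n). real d * b ^ (d - 1) * (t b x)\<^sup>2 - 2 * b ^ d * (norm x)\<^sup>2 * t b x)"
  define \<phi>' where "\<phi>' = (\<lambda>j w h. cnj ((w - z) $ j) * of_real (kern' a (w - z) h) + cnj (h $ j) * of_real (kern a (w - z)))"
  let ?\<Phi> = "\<lambda>j w. \<phi>' j w (axis j 1) + \<i> * \<phi>' j w (\<i> *s axis j 1)"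
  \<comment> \<open>The 5 is 4 from \<open>norm_kern'_bound\<close> plus 1 from
    \<open>kern_le\<close>; the other entry of the maximum will bound the test function
    itself.\<close>
  have \<phi>'_bd: "cmod (\<phi>' j w h) \<le> max ((1 + 1/a) * a ^ d) (5 * a ^ d) * norm h" for j w h
    proof -
      have "cmod (\<phi>' j w h) \<le> cmod ((w - z) $ j) * \<bar>kern' a (w - z) h\<bar> + cmod (h $ j) * \<bar>kern a (w - z)\<bar>"
        unfolding \<phi>'_def by (rule order_trans[OF norm_triangle_ineq]) (simp add: norm_mult del: vector_minus_component complex_cnj_diff)
      also have "\<dots> \<le> norm (w - z) * \<bar>kern' a (w - z) h\<bar> + norm h * a ^ d"
        unfolding d_def using kern_nonneg[OF a, of "w - z"] kern_le[OF a, of "w - z"]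
        by (intro add_mono mult_right_mono mult_mono Finite_Cartesian_Product.norm_nth_le) auto
      also have "\<dots> \<le> 4 * a ^ d * norm h + norm h * a ^ d"
        unfolding d_def using norm_kern'_bound[OF a] by (intro add_mono) auto
      also have "\<dots> = (5 * a ^ d) * norm h" by simp
      also have "\<dots> \<le> max ((1 + 1/a) * a ^ d) (5 * a ^ d) * norm h" by (intro mult_right_mono) auto
      finally show ?thesis .
    qed
  have vanish: "(\<integral>w. f0 w * ?\<Phi> j w \<partial>lborel) = 0" for j
  proof (rule weak_dbar'[where \<phi>="\<lambda>w. cnj ((w - z) $ j) * of_real (kern a (w - z))" and z=z and r=r
        and M="max ((1 + 1/a) * a ^ d) (5 * a ^ d)"])
    show "((\<lambda>w. cnj ((w - z) $ j) * of_real (kern a (w - z))) has_derivative \<phi>' j w) (at w)" for w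
    proof -
      have 1: "((\<lambda>w. w - z) has_derivative (\<lambda>h. h)) (at w)" by (auto intro!: derivative_eq_intros)
      have 2: "((\<lambda>w. complex_of_real (kern a (w - z))) has_derivative (\<lambda>h. of_real (kern' a (w - z) h))) (at w)"
        by (rule has_derivative_of_real[OF has_derivative_compose[OF 1 kern_has_derivative]])
      have "bounded_linear (\<lambda>h::complex^'n. cnj (h $ j))"
        by (rule bounded_linear_compose[OF bounded_linear_cnj bounded_linear_vec_nth])
      from has_derivative_compose[OF 1 bounded_linear_imp_has_derivative[OF this]]
      have "((\<lambda>w. cnj ((w - z) $ j)) has_derivative (\<lambda>h. cnj (h $ j))) (at w)" .
      from has_derivative_mult[OF this 2] show ?thesis unfolding \<phi>'_def .
    qed
    show "cmod (cnj ((w - z) $ j) * of_real (kern a (w - z))) \<le> max ((1 + 1/a) * a ^ d) (5 * a ^ d)" for w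
    proof -
      have tb: "0 \<le> t a (w - z)" "t a (w - z) \<le> 1" "t a (w - z) * norm (w - z) \<le> 1 + 1 / a"
        unfolding t_def by (rule kern_pos_part_bounds[OF a])+
      have "cmod ((w - z) $ j) * (a ^ d * (t a (w - z))\<^sup>2) \<le> norm (w - z) * (a ^ d * (t a (w - z))\<^sup>2)"
        using a by (intro mult_right_mono Finite_Cartesian_Product.norm_nth_le) auto
      also have "\<dots> = a ^ d * (t a (w - z) * (t a (w - z) * norm (w - z)))" by (simp add: power2_eq_square)
      also have "\<dots> \<le> a ^ d * (1 * (1 + 1 / a))"
        using a tb by (intro mult_left_mono mult_mono) auto
      finally have "cmod ((w - z) $ j) * kern a (w - z) \<le> (1 + 1 / a) * a ^ d"
        unfolding kern_def t_def d_def by (simp add: mult_ac)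
      then have "cmod (cnj ((w - z) $ j) * of_real (kern a (w - z))) \<le> (1 + 1 / a) * a ^ d"
        using kern_nonneg[OF a, of "w - z"]
        by (simp add: norm_mult del: vector_minus_component complex_cnj_diff)
      then show ?thesis by simp
    qed
    show "cmod (\<phi>' j w h) \<le> max ((1 + 1/a) * a ^ d) (5 * a ^ d) * norm h" for w h
      by (rule \<phi>'_bd)
    show "cnj ((w - z) $ j) * complex_of_real (kern a (w - z)) = 0" if "w \<notin> cball z r" for w
      using kern_support[OF ar \<open>0 < r\<close> that] by simp
  qed (rule z)
  \<comment> \<open>Differentiating the conjugate coordinate contributes
    \<open>2 * kern a (w - z)\<close> to each summand; differentiating the kernel subtracts a
    multiple of the squared modulus of the j-th coordinate. Summation yields the factor
    \<open>d\<close> and the squared norm in the proportion in which they occur in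
    \<open>2 * a * k' a (w - z)\<close>.\<close>
  have eq: "(\<Sum>j\<in>UNIV. ?\<Phi> j w) = of_real (2 * a * k' a (w - z))" for w
  proof -
    let ?x = "w - z"
    have axi: "\<i> *s axis j 1 = axis j \<i>" for j :: 'n by (simp add: vec_eq_iff axis_def)
    have "?\<Phi> j w
        = of_real (2 * kern a ?x - 4 * a ^ Suc d * t a ?x * (norm (?x $ j))\<^sup>2)" for j
    proof -
      have i1: "?x \<bullet> axis j 1 = Re (?x $ j)" and i2: "?x \<bullet> axis j \<i> = Im (?x $ j)"
        by (simp_all add: inner_axis inner_complex_def)
      have "cnj (?x $ j) * (of_real (Re (?x $ j)) + \<i> * of_real (Im (?x $ j))) = of_real ((norm (?x $ j))\<^sup>2)"
        using complex_norm_square[of "?x $ j"] complex_eq[of "?x $ j"] by (metis mult.commute)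
      then have "cnj (?x $ j) * (of_real (- (4 * a ^ Suc d * t a ?x)) * (of_real (Re (?x $ j)) + \<i> * of_real (Im (?x $ j))))
          = of_real (- (4 * a ^ Suc d * t a ?x) * (norm (?x $ j))\<^sup>2)"
        by (metis mult.left_commute of_real_mult)
      moreover have "?\<Phi> j w =
          cnj (?x $ j) * (of_real (- (4 * a ^ Suc d * t a ?x)) * (of_real (Re (?x $ j)) + \<i> * of_real (Im (?x $ j))))
          + 2 * of_real (kern a ?x)"
        unfolding axi \<phi>'_def kern'_def i1 i2 t_def d_def by (simp add: axis_def algebra_simps)
      ultimately show ?thesis by simp
    qed
    then have "(\<Sum>j\<in>UNIV. ?\<Phi> j w)
        = of_real (\<Sum>j\<in>UNIV. 2 * kern a ?x - 4 * a ^ Suc d * t a ?x * (norm (?x $ j))\<^sup>2)" by simp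
    also have "(\<Sum>j\<in>UNIV. 2 * kern a ?x - 4 * a ^ Suc d * t a ?x * (norm (?x $ j))\<^sup>2)
        = 2 * real d * kern a ?x - 4 * a ^ Suc d * t a ?x * (\<Sum>j\<in>UNIV. (norm (?x $ j))\<^sup>2)"
      by (simp add: sum_subtractf sum_distrib_left d_def)
    also have "(\<Sum>j\<in>UNIV. (norm (?x $ j))\<^sup>2) = (norm ?x)\<^sup>2"
      by (simp add: norm_vec_def L2_set_def sum_nonneg)
    also have "2 * real d * kern a ?x - 4 * a ^ Suc d * t a ?x * (norm ?x)\<^sup>2 = 2 * a * k' a ?x"
    proof -
      have "a ^ d = a * a ^ (d - 1)" using d by (metis Suc_diff_1 power_Suc)
      then show ?thesis unfolding k'_def kern_def t_def d_def by (simp add: algebra_simps)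
    qed
    finally show ?thesis .
  qed
  have k'_meas: "(\<lambda>w. k' a (w - z)) \<in> borel_measurable lborel" unfolding k'_def t_def by measurable
  \<comment> \<open>Valid for all positive scales up to \<open>2 * a\<close>; the neighbourhood of
    radius \<open>a\<close> about \<open>a\<close> keeps the scale positive.\<close>
  define B where "B = (real d + 2) * (2 * a) ^ (d - 1)"
  have k'_bd: "\<bar>k' b x\<bar> \<le> B" if b: "0 < b" "b \<le> 2 * a" for b x
  proof -
    have tb: "0 \<le> t b x" "t b x \<le> 1" "t b x * (norm x)\<^sup>2 \<le> 1 / b"
      unfolding t_def by (rule kern_pos_part_bounds[OF b(1)])+
    have "b ^ d = b * b ^ (d - 1)" using d by (metis Suc_diff_1 power_Suc)
    then have "b ^ d * (t b x * (norm x)\<^sup>2) \<le> b * b ^ (d - 1) * (1 / b)"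
      using tb b by (metis (no_types, lifting) less_imp_le mult_left_mono zero_less_power)
    also have "\<dots> = b ^ (d - 1)" using b by simp
    finally have 1: "b ^ d * (t b x * (norm x)\<^sup>2) \<le> b ^ (d - 1)" .
    have 2: "b ^ (d - 1) * (t b x)\<^sup>2 \<le> b ^ (d - 1)"
      using tb b by (intro mult_right_le_one_le) (auto simp: power_le_one)
    have 3: "0 \<le> b ^ d * (t b x * (norm x)\<^sup>2)" "0 \<le> b ^ (d - 1) * (t b x)\<^sup>2" using tb b by auto
    have "\<bar>k' b x\<bar> \<le> real d * (b ^ (d - 1) * (t b x)\<^sup>2) + 2 * (b ^ d * (t b x * (norm x)\<^sup>2))"
    proof -
      have "k' b x = real d * (b ^ (d - 1) * (t b x)\<^sup>2) - 2 * (b ^ d * (t b x * (norm x)\<^sup>2))"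
        unfolding k'_def by simp
      moreover have "0 \<le> real d * (b ^ (d - 1) * (t b x)\<^sup>2)" by (rule mult_nonneg_nonneg[OF of_nat_0_le_iff 3(2)])
      ultimately show ?thesis using 3(1) by linarith
    qed
    also have "\<dots> \<le> real d * b ^ (d - 1) + 2 * b ^ (d - 1)"
      using 1 2 by (intro add_mono mult_left_mono) auto
    also have "\<dots> = (real d + 2) * b ^ (d - 1)" by (simp add: algebra_simps)
    also have "\<dots> \<le> B" unfolding B_def using b by (intro mult_left_mono power_mono) auto
    finally show ?thesis .
  qed
  have der: "((\<lambda>b. kern b x) has_real_derivative k' b x) (at b)" for b x
    unfolding k'_def t_def d_def by (rule kern_has_derivative_scale)
  have "((\<lambda>a. \<integral>w. kern a (w - z) *\<^sub>R f0 w \<partial>lborel) has_derivative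
      (\<lambda>h. \<integral>w. (k' a (w - z) * h) *\<^sub>R f0 w \<partial>lborel)) (at a)"
  proof (rule has_derivative_integral_parameter[OF f0_integrable, where \<delta>=a and B=B and C="(2 * a) ^ d"])
    show "((\<lambda>b. kern b (w - z)) has_derivative (\<lambda>h. k' a (w - z) * h)) (at a)" for w
      using der[of "w - z" a] unfolding has_field_derivative_def .
    show "\<bar>k' a (w - z) * h\<bar> \<le> B * norm h" for w h
      using k'_bd[of a "w - z"] a by (auto simp: abs_mult intro!: mult_right_mono)
    show "\<bar>kern b (w - z) - kern a (w - z)\<bar> \<le> B * dist b a" if b: "dist b a < a" for w b
    proof -
      have "norm (kern b (w - z) - kern a (w - z)) \<le> B * norm (b - a)"
      proof (rule field_differentiable_bound[of "{0<..<2*a}"])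
        show "((\<lambda>b. kern b (w - z)) has_field_derivative k' c (w - z)) (at c within {0<..<2*a})" for c
          using der has_field_derivative_at_within by blast
        show "norm (k' c (w - z)) \<le> B" if "c \<in> {0<..<2*a}" for c using k'_bd that by simp
      qed (use b a in \<open>auto simp: dist_real_def\<close>)
      then show ?thesis by (simp add: dist_real_def)
    qed
    show "\<bar>kern b (w - z)\<bar> \<le> (2 * a) ^ d" if b: "dist b a < a" for b w
    proof -
      have b': "0 < b" "b \<le> 2 * a" using b by (auto simp: dist_real_def)
      have "kern b (w - z) \<le> b ^ d" unfolding d_def by (rule kern_le[OF b'(1)])
      also have "\<dots> \<le> (2 * a) ^ d" using b' by (intro power_mono) auto
      finally show ?thesis using kern_nonneg[OF b'(1), of "w - z"] by simp
    qed
    show "(\<lambda>w. k' a (w - z) * h) \<in> borel_measurable lborel" for h using k'_meas by simp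
  qed (use a in auto)
  moreover have "(\<integral>w. (k' a (w - z) * h) *\<^sub>R f0 w \<partial>lborel) = 0" for h
  proof -
    have int: "integrable lborel (\<lambda>w. f0 w * ?\<Phi> j w)" for j
    proof (rule Bochner_Integration.integrable_bound)
      let ?c = "max ((1 + 1/a) * a ^ d) (5 * a ^ d) * norm (axis j 1 :: complex^'n)
        + max ((1 + 1/a) * a ^ d) (5 * a ^ d) * norm (\<i> *s axis j 1 :: complex^'n)"
      show "integrable lborel (\<lambda>w. ?c *\<^sub>R f0 w)" using f0_integrable by simp
      have [measurable]: "(\<lambda>w. cnj ((w - z) $ j)) \<in> borel_measurable borel"
        by (intro borel_measurable_continuous_onI continuous_intros)
      have [measurable]: "(\<lambda>w. kern' a (w - z) h) \<in> borel_measurable borel" for h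
        by (rule kern'_measurable) simp
      have [measurable]: "(\<lambda>w. kern a (w - z)) \<in> borel_measurable borel"
        by (rule kern_measurable) simp
      show "(\<lambda>w. f0 w * ?\<Phi> j w) \<in> borel_measurable lborel"
        unfolding \<phi>'_def by measurable
      show "AE w in lborel. norm (f0 w * ?\<Phi> j w) \<le> norm (?c *\<^sub>R f0 w)"
      proof (rule AE_I2)
        fix w
        have "cmod (?\<Phi> j w) \<le> ?c"
          using \<phi>'_bd[of j w "axis j 1"] \<phi>'_bd[of j w "\<i> *s axis j 1"]
          by (intro order_trans[OF norm_triangle_ineq] add_mono) (auto simp: norm_mult)
        then have "cmod (?\<Phi> j w) \<le> \<bar>?c\<bar>" by linarith
        then have "cmod (?\<Phi> j w) * cmod (f0 w) \<le> \<bar>?c\<bar> * cmod (f0 w)"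
          by (rule mult_right_mono) simp
        then show "norm (f0 w * ?\<Phi> j w) \<le> norm (?c *\<^sub>R f0 w)"
          unfolding norm_mult norm_scaleR by (simp only: mult.commute)
      qed
    qed
    have "of_real (2 * a) * (\<integral>w. k' a (w - z) *\<^sub>R f0 w \<partial>lborel) = (\<integral>w. f0 w * of_real (2 * a * k' a (w - z)) \<partial>lborel)"
      by (subst integral_mult_right_zero[symmetric]) (simp add: scaleR_conv_of_real mult_ac)
    also have "\<dots> = (\<integral>w. (\<Sum>j\<in>UNIV. f0 w * ?\<Phi> j w) \<partial>lborel)"
      unfolding eq[symmetric] sum_distrib_left ..
    also have "\<dots> = 0" using int vanish by (subst Bochner_Integration.integral_sum) auto
    finally have "(\<integral>w. k' a (w - z) *\<^sub>R f0 w \<partial>lborel) = 0" using a by simp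
    moreover have "(\<integral>w. (k' a (w - z) * h) *\<^sub>R f0 w \<partial>lborel) = h *\<^sub>R (\<integral>w. k' a (w - z) *\<^sub>R f0 w \<partial>lborel)"
      by (subst integral_scaleR_right[symmetric]) (simp add: mult.commute)
    ultimately show ?thesis by simp
  qed
  ultimately show ?thesis
    unfolding has_vector_derivative_def smoothing_def by simp
qed

text \<open>The admissible scales form the ray \<open>{1 / r\<^sup>2..}\<close>, which is convex,
  and the derivative in the scale vanishes on it.\<close>

lemma smoothing_const:
  assumes "0 < r" "cball z r \<subseteq> D" "1 \<le> a * r\<^sup>2" "1 \<le> b * r\<^sup>2"
  shows "smoothing f0 a z = smoothing f0 b z"
proof -
  have iff: "x \<in> {1 / r\<^sup>2..} \<longleftrightarrow> 1 \<le> x * r\<^sup>2" for x using assms(1) by (simp add: field_simps)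
  obtain c where "\<And>x. x \<in> {1 / r\<^sup>2..} \<Longrightarrow> smoothing f0 x z = c"
  proof (rule has_vector_derivative_zero_constant[of "{1 / r\<^sup>2..}" "\<lambda>x. smoothing f0 x z"])
    show "((\<lambda>x. smoothing f0 x z) has_vector_derivative 0) (at x within {1 / r\<^sup>2..})" if "x \<in> {1 / r\<^sup>2..}" for x
      using smoothing_scale_derivative[OF assms(1) _ assms(2)] that iff has_vector_derivative_at_within by blast
  qed auto
  then show ?thesis using assms(3,4) iff by metis
qed

end

section \<open>Normalisation of the kernel\<close>

lemma kern_integrable:
  assumes a: "0 < a"
  shows "integrable lborel (kern a :: complex^'n \<Rightarrow> real)"
proof (rule Bochner_Integration.integrable_bound)
  let ?R = "1 + 1 / a"
  show "integrable lborel (\<lambda>x::complex^'n. a ^ CARD('n) * indicator (cball 0 ?R) x)"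
    using emeasure_bounded_finite[OF bounded_cball[of "0::complex^'n" ?R]] by (intro integrable_mult_right) auto
  show "kern a \<in> borel_measurable (lborel :: (complex^'n) measure)" using kern_measurable[of "\<lambda>x. x"] by simp
  have "kern a x \<le> a ^ CARD('n) * indicator (cball 0 ?R) x" for x :: "complex^'n"
  proof (cases "x \<in> cball 0 ?R")
    case False
    then have "?R\<^sup>2 \<le> (norm x)\<^sup>2" using a by (intro power_mono) auto
    moreover have "1 / a \<le> ?R\<^sup>2" using self_le_power[of ?R 2] a by simp
    ultimately have "1 / a \<le> (norm x)\<^sup>2" by linarith
    then have "1 \<le> a * (norm x)\<^sup>2" using a by (simp add: field_simps)
    then show ?thesis using kern_eq_0[OF a, of x] a by simp
  qed (simp add: kern_le[OF a])
  then have "\<bar>kern a x\<bar> \<le> \<bar>a ^ CARD('n) * indicator (cball 0 ?R) x\<bar>" for x :: "complex^'n"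
    using kern_nonneg[OF a, of x] by (metis abs_ge_self abs_of_nonneg order_trans)
  then show "AE x::complex^'n in lborel. norm (kern a x) \<le> norm (a ^ CARD('n) * indicator (cball 0 ?R) x)"
    by (intro AE_I2) (simp only: real_norm_def)
qed

text \<open>No linear substitution is made: smoothing the constant function 1 at the origin gives
  the integral of the kernel, and scale independence applies to it.\<close>

lemma kern_integral_const:
  assumes "0 < a" "0 < b"
  shows "(\<integral>x. kern a (x::complex^'n) \<partial>lborel) = (\<integral>x. kern b (x::complex^'n) \<partial>lborel)"
proof -
  \<comment> \<open>Large enough for both scales: \<open>r\<close> is at least 1, hence at most its
    square, and \<open>a * r\<close> and \<open>b * r\<close> are at least 1.\<close>
  define r where "r = 1 + 1 / a + 1 / b"
  have r: "0 < r" unfolding r_def using assms by (simp add: add_pos_pos)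
  have "1 \<le> r" unfolding r_def using assms by simp
  then have rr: "r \<le> r\<^sup>2" by (simp add: power2_eq_square)
  have ar: "1 \<le> a * r\<^sup>2"
  proof -
    have "1 \<le> a * r" unfolding r_def using assms by (simp add: algebra_simps)
    also have "\<dots> \<le> a * r\<^sup>2" using rr assms by simp
    finally show ?thesis .
  qed
  have br: "1 \<le> b * r\<^sup>2"
  proof -
    have "1 \<le> b * r" unfolding r_def using assms by (simp add: algebra_simps)
    also have "\<dots> \<le> b * r\<^sup>2" using rr assms by simp
    finally show ?thesis .
  qed
  interpret punctured_L2 "ball (0::complex^'n) (2 * r)" "{}" "\<lambda>_. 1"
  proof
    show "sigma_codim_two ({}::(complex^'n) set)" by (intro codim_two_imp_sigma codim_two_empty)
    have "emeasure lborel (ball (0::complex^'n) (2 * r)) < \<infinity>" by (intro emeasure_bounded_finite bounded_ball)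
    then show "set_integrable lborel (ball (0::complex^'n) (2 * r) - {}) (\<lambda>z. (cmod 1)\<^sup>2)"
      unfolding set_integrable_def by simp
  qed (auto intro: holo_on_const)
  have sub: "cball 0 r \<subseteq> ball (0::complex^'n) (2 * r)" using r by auto
  have eq: "smoothing f0 c 0 = of_real (\<integral>x. kern c (x::complex^'n) \<partial>lborel)" if c: "0 < c" "1 \<le> c * r\<^sup>2" for c
  proof -
    have "kern c (w - 0) *\<^sub>R f0 w = of_real (kern c w)" for w :: "complex^'n"
      using kern_support[OF c(2) r, of w 0] sub by (cases "w \<in> cball 0 r") (auto simp: f0_def scaleR_conv_of_real)
    then show ?thesis unfolding smoothing_def by simp
  qed
  have "smoothing f0 a 0 = smoothing f0 b 0" by (rule smoothing_const[OF r sub ar br])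
  then show ?thesis using eq[OF assms(1) ar] eq[OF assms(2) br] by simp
qed

text \<open>Only positivity of this number matters; its value is never computed. The argument is a
  type because the mass depends on the dimension alone.\<close>

definition kern_mass :: "'n::finite itself \<Rightarrow> real" where
  "kern_mass _ = (\<integral>x. kern 1 (x::complex^'n) \<partial>lborel)"

lemma kern_integral:
  fixes z :: "complex^'n"
  assumes "0 < a"
  shows "(\<integral>w. kern a (w - z) \<partial>lborel) = kern_mass TYPE('n)"
proof -
  have "(\<integral>w. kern a (w - z) \<partial>lborel) = (\<integral>w. kern a (w::complex^'n) \<partial>lborel)"
    using lborel_integral_translate[of "kern a" "- z"] kern_measurable[of "\<lambda>x. x" borel a] by simp
  then show ?thesis unfolding kern_mass_def using kern_integral_const[OF assms zero_less_one] by metis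
qed

text \<open>On the ball of radius 1/2 the positive part is at least 1/2, so the kernel of scale 1 is
  at least 1/4 there.\<close>

lemma kern_mass_pos: "0 < kern_mass TYPE('n::finite)"
proof -
  let ?B = "ball (0::complex^'n) (1/2)"
  have fin: "emeasure lborel ?B < \<infinity>" by (intro emeasure_bounded_finite bounded_ball)
  have "0 < measure lborel ?B" by (simp add: content_ball_pos)
  then have "0 < (\<integral>x. 1/4 * indicat_real ?B x \<partial>lborel)" using fin by simp
  also have "\<dots> \<le> kern_mass TYPE('n)"
    unfolding kern_mass_def
  proof (rule integral_mono)
    show "integrable lborel (\<lambda>x. 1/4 * indicat_real ?B x)" using fin by (intro integrable_mult_right) auto
    show "integrable lborel (kern 1 :: complex^'n \<Rightarrow> real)" by (rule kern_integrable) simp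
    show "1/4 * indicator ?B x \<le> kern 1 x" for x :: "complex^'n"
    proof (cases "x \<in> ?B")
      case True
      then have "(norm x)\<^sup>2 \<le> (1/2)\<^sup>2" by (intro power_mono) auto
      then have h: "1/2 \<le> max 0 (1 - 1 * (norm x)\<^sup>2)" by (simp add: power2_eq_square)
      have "(1/2::real)\<^sup>2 \<le> (max 0 (1 - 1 * (norm x)\<^sup>2))\<^sup>2" by (rule power_mono[OF h]) simp
      then show ?thesis using True unfolding kern_def by (simp add: power2_eq_square)
    qed (simp add: kern_nonneg)
  qed
  finally show ?thesis .
qed

text \<open>Scale independence allows the kernel to shrink: a large \<open>b\<close> in place of
  \<open>a\<close> confines the integral to a ball about \<open>z\<close> on which \<open>f\<close>
  is nearly constant, although \<open>cball z r\<close> itself may meet \<open>E\<close>. The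
  left-hand side does not change, so the error is zero.\<close>

lemma (in punctured_L2) smoothing_eq:
  assumes "z \<in> D - E" "0 < r" "cball z r \<subseteq> D" "1 \<le> a * r\<^sup>2"
  shows "smoothing f0 a z = of_real (kern_mass TYPE('n)) * f z"
proof -
  let ?N = "kern_mass TYPE('n)"
  have "cmod (smoothing f0 a z - of_real ?N * f z) \<le> 0"
  proof (rule field_le_epsilon)
    fix \<epsilon> :: real assume "0 < \<epsilon>"
    define \<epsilon>' where "\<epsilon>' = \<epsilon> / ?N"
    have \<epsilon>': "\<epsilon>' > 0" unfolding \<epsilon>'_def using \<open>0 < \<epsilon>\<close> kern_mass_pos[where 'n='n] by simp
    have "continuous (at z) f" using holo_on_continuous_at[OF f(1) assms(1)] .
    then obtain \<delta>1 where \<delta>1: "\<delta>1 > 0" "\<And>w. dist w z < \<delta>1 \<Longrightarrow> dist (f w) (f z) < \<epsilon>'"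
      using \<epsilon>' unfolding continuous_at_eps_delta by blast
    obtain \<delta>2 where \<delta>2: "\<delta>2 > 0" "ball z \<delta>2 \<subseteq> D - E"
      using open_diff assms(1) open_contains_ball by metis
    define s where "s = min \<delta>1 \<delta>2 / 2"
    have s: "0 < s" "s < \<delta>1" "s < \<delta>2" unfolding s_def using \<delta>1 \<delta>2 by auto
    define b where "b = max a (1 / s\<^sup>2)"
    have b: "1 \<le> b * r\<^sup>2" "1 \<le> b * s\<^sup>2" "0 < b"
    proof -
      show "0 < b" unfolding b_def using s by (simp add: less_max_iff_disj)
      show "1 \<le> b * r\<^sup>2" by (rule order_trans[OF assms(4)]) (auto simp: b_def intro!: mult_right_mono)
      have "1 = 1 / s\<^sup>2 * s\<^sup>2" using s by simp
      also have "\<dots> \<le> b * s\<^sup>2" unfolding b_def by (intro mult_right_mono) auto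
      finally show "1 \<le> b * s\<^sup>2" .
    qed
    have int1: "integrable lborel (\<lambda>w. kern b (w - z))"
      using kern_integrable[OF b(3), where 'n='n] lborel_integrable_translate[of "kern b :: complex^'n \<Rightarrow> real" "- z"]
        kern_measurable[of "\<lambda>x. x" borel b] by simp
    have int2: "integrable lborel (\<lambda>w. kern b (w - z) *\<^sub>R f0 w)"
    proof (rule Bochner_Integration.integrable_bound)
      show "integrable lborel (\<lambda>w. (b ^ CARD('n)) *\<^sub>R f0 w)" using f0_integrable by simp
      have "\<bar>kern b (w - z)\<bar> \<le> \<bar>b ^ CARD('n)\<bar>" for w
        using kern_nonneg[OF b(3), of "w - z"] kern_le[OF b(3), of "w - z"] by simp
      then show "AE w in lborel. norm (kern b (w - z) *\<^sub>R f0 w) \<le> norm ((b ^ CARD('n)) *\<^sub>R f0 w)"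
        unfolding norm_scaleR by (intro AE_I2 mult_right_mono) auto
    qed measurable
    have eq: "smoothing f0 a z - of_real ?N * f z = (\<integral>w. kern b (w - z) *\<^sub>R f0 w - kern b (w - z) *\<^sub>R f z \<partial>lborel)"
    proof -
      have "smoothing f0 a z = smoothing f0 b z" by (rule smoothing_const[OF assms(2-4) b(1)])
      moreover have "(\<integral>w. kern b (w - z) *\<^sub>R f z \<partial>lborel) = of_real ?N * f z"
        using int1 by (simp add: kern_integral[OF b(3)] scaleR_conv_of_real)
      moreover have "integrable lborel (\<lambda>w. kern b (w - z) *\<^sub>R f z)" using int1 by simp
      ultimately show ?thesis using int2 by (simp add: smoothing_def)
    qed
    have "cmod (smoothing f0 a z - of_real ?N * f z) \<le> (\<integral>w. kern b (w - z) * \<epsilon>' \<partial>lborel)"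
      unfolding eq
    proof (rule Bochner_Integration.integral_norm_bound_integral)
      show "integrable lborel (\<lambda>w. kern b (w - z) *\<^sub>R f0 w - kern b (w - z) *\<^sub>R f z)" using int1 int2 by simp
      show "integrable lborel (\<lambda>w. kern b (w - z) * \<epsilon>')" using int1 by simp
      fix w
      show "norm (kern b (w - z) *\<^sub>R f0 w - kern b (w - z) *\<^sub>R f z) \<le> kern b (w - z) * \<epsilon>'"
      proof (cases "w \<in> cball z s")
        case True
        then have "w \<in> D - E" "dist w z < \<delta>1" using s \<delta>2(2) by (auto simp: dist_commute subset_iff)
        then have "f0 w = f w" "norm (f w - f z) \<le> \<epsilon>'"
          using \<delta>1(2)[of w] by (auto simp: f0_def dist_norm)
        then show ?thesis
          using kern_nonneg[OF b(3), of "w - z"] by (simp add: scaleR_diff_right[symmetric] mult_left_mono)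
      next
        case False
        then show ?thesis using kern_support[OF b(2) s(1) False] by simp
      qed
    qed
    also have "\<dots> = \<epsilon>" using int1 kern_mass_pos[where 'n='n] by (simp add: kern_integral[OF b(3)] \<epsilon>'_def)
    finally show "cmod (smoothing f0 a z - of_real ?N * f z) \<le> 0 + \<epsilon>" by simp
  qed
  then show ?thesis by simp
qed

text \<open>Off \<open>E\<close> the normalised smoothing equals \<open>f\<close>, and it is
  holomorphic on \<open>E\<close> too. The single scale \<open>1 / r\<^sup>2\<close> serves the
  whole ball, because \<open>cball z r\<close> stays in \<open>D\<close> for every \<open>z\<close>
  in it.\<close>

lemma (in punctured_L2) local_extension:
  assumes "0 < r" "ball p (2 * r) \<subseteq> D"
  shows "\<exists>g. holo_on g (ball p r) \<and> (\<forall>z\<in>ball p r - E. g z = f z)"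
proof (intro exI conjI ballI)
  let ?N = "complex_of_real (kern_mass TYPE('n))"
  have N: "?N \<noteq> 0" using kern_mass_pos[where 'n='n] by simp
  have sub: "cball z r \<subseteq> D" if "z \<in> ball p r" for z
  proof -
    have "cball z r \<subseteq> ball p (2 * r)"
    proof
      fix w assume "w \<in> cball z r"
      then show "w \<in> ball p (2 * r)" using that dist_triangle[of p w z] by simp
    qed
    then show ?thesis using assms(2) by blast
  qed
  have r: "1 \<le> (1 / r\<^sup>2) * r\<^sup>2" using assms(1) by simp
  show "holo_on (\<lambda>z. inverse ?N * smoothing f0 (1 / r\<^sup>2) z) (ball p r)"
    by (intro holo_on_cmult holo_on_subset[OF holo_on_smoothing[OF assms(1) r]] subsetI CollectI sub)
  show "inverse ?N * smoothing f0 (1 / r\<^sup>2) z = f z" if z: "z \<in> ball p r - E" for z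
  proof -
    have "z \<in> D - E" using z sub[of z] assms(1) by auto
    from smoothing_eq[OF this assms(1) _ r] sub[of z] z N show ?thesis by simp
  qed
qed

section \<open>Removability and bounded limits\<close>

lemma codim_two_negligible:
  fixes K :: "'a::euclidean_space set"
  assumes "codim_two K"
  shows "negligible K"
  unfolding negligible_outer_le
proof (intro allI impI)
  fix \<epsilon> :: real assume "0 < \<epsilon>"
  define V where "V = unit_ball_vol (real DIM('a))"
  have V: "V > 0" unfolding V_def by (rule unit_ball_vol_pos) auto
  obtain C where C: "\<And>e. 0 < e \<Longrightarrow> e \<le> 1 \<Longrightarrow>
      \<exists>T. finite T \<and> K \<subseteq> (\<Union>t\<in>T. cball t e) \<and> real (card T) * e ^ DIM('a) \<le> C * e\<^sup>2"
    using assms unfolding codim_two_def by blast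
  define c where "c = \<bar>C\<bar> * V + 1"
  have c: "c > 0" unfolding c_def using V by (simp add: add_nonneg_pos)
  define e where "e = min 1 (\<epsilon> / c)"
  have e: "0 < e" "e \<le> 1" "c * e \<le> \<epsilon>"
    unfolding e_def using \<open>0 < \<epsilon>\<close> c by (auto simp: min_def field_simps)
  obtain T where T: "finite T" "K \<subseteq> (\<Union>t\<in>T. cball t e)" "real (card T) * e ^ DIM('a) \<le> C * e\<^sup>2"
    using C[OF e(1,2)] by blast
  have "measure lebesgue (\<Union>t\<in>T. cball t e) \<le> (\<Sum>t\<in>T. measure lebesgue (cball t e))"
    using T(1) by (intro measure_UNION_le) auto
  also have "\<dots> = (real (card T) * e ^ DIM('a)) * V"
    using e(1) by (simp add: content_cball V_def)
  also have "\<dots> \<le> (\<bar>C\<bar> * e\<^sup>2) * V"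
    by (intro mult_right_mono order_trans[OF T(3)]) (use V in auto)
  also have "\<dots> \<le> (\<bar>C\<bar> * V) * e"
    using e V by (simp add: power2_eq_square mult_ac mult_left_mono mult_left_le_one_le)
  also have "\<dots> \<le> c * e" unfolding c_def using e by (intro mult_right_mono) auto
  also have "\<dots> \<le> \<epsilon>" by (rule e)
  finally show "\<exists>T. K \<subseteq> T \<and> T \<in> lmeasurable \<and> measure lebesgue T \<le> \<epsilon>"
    using T by (intro exI[of _ "\<Union>t\<in>T. cball t e"]) (auto intro!: fmeasurable.finite_UN)
qed

lemma sigma_codim_two_negligible: "sigma_codim_two S \<Longrightarrow> negligible S"
  unfolding sigma_codim_two_def
  by (metis codim_two_negligible negligible_Union_nat negligible_subset)

text \<open>Serves as a uniqueness principle: an open condition satisfied only on such a set is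
  satisfied nowhere.\<close>

lemma sigma_codim_two_no_open:
  "sigma_codim_two S \<Longrightarrow> open W \<Longrightarrow> W \<subseteq> S \<Longrightarrow> W = {}"
  by (meson sigma_codim_two_negligible negligible_subset open_not_negligible)

text \<open>Local extensions are glued by letting each point use its own ball. They agree on
  overlaps, since the set where two of them differ is open and contained in \<open>E\<close>. Square
  integrability is inherited because \<open>E\<close> is a null set.\<close>

lemma L2a_removable_if_sigma_codim_two:
  fixes D E :: "(complex^'n) set"
  assumes D: "open D" and E: "closedin (top_of_set D) E" "sigma_codim_two E"
  shows "L2a_removable D E"
  unfolding L2a_removable_def
proof (intro conjI ballI)
  show "E \<subseteq> D" using E(1) closedin_subset by force
  show "closedin (top_of_set D) E" by (rule E(1))
  fix f assume "f \<in> bergman (D - E)"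
  then have f: "holo_on f (D - E)" "set_integrable lborel (D - E) (\<lambda>z. (cmod (f z))\<^sup>2)"
    unfolding bergman_def by auto
  have "\<forall>p\<in>D. \<exists>r g. 0 < r \<and> ball p r \<subseteq> D \<and> holo_on g (ball p r) \<and> (\<forall>z\<in>ball p r - E. g z = f z)"
  proof
    fix p assume "p \<in> D"
    then obtain R where R: "0 < R" "ball p R \<subseteq> D" using D open_contains_ball by blast
    have sub: "ball p R - E \<inter> ball p R \<subseteq> D - E" using R(2) by blast
    \<comment> \<open>Passing to a ball provides the boundedness that the reproducing formula asks
      for.\<close>
    interpret punctured_L2 "ball p R" "E \<inter> ball p R" f
    proof
      show "closedin (top_of_set (ball p R)) (E \<inter> ball p R)"
      proof -
        obtain C where "closed C" "E = D \<inter> C" using E(1) by (auto simp: closedin_closed)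
        then have "E \<inter> ball p R = ball p R \<inter> C" using R(2) by blast
        then show ?thesis using \<open>closed C\<close> by (auto simp: closedin_closed)
      qed
      show "sigma_codim_two (E \<inter> ball p R)" by (rule sigma_codim_two_subset[OF E(2)]) auto
      show "holo_on f (ball p R - E \<inter> ball p R)" by (rule holo_on_subset[OF f(1) sub])
      show "set_integrable lborel (ball p R - E \<inter> ball p R) (\<lambda>z. (cmod (f z))\<^sup>2)"
      proof (rule set_integrable_subset[OF f(2) _ sub])
        have "open (D - E)" using D E(1) by (metis closedin_def openin_open_eq topspace_euclidean_subtopology)
        then have "open (ball p R \<inter> (D - E))" by blast
        moreover have "ball p R \<inter> (D - E) = ball p R - E \<inter> ball p R" using R(2) by blast
        ultimately show "ball p R - E \<inter> ball p R \<in> sets lborel" by simp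
      qed
    qed auto
    obtain g where "holo_on g (ball p (R/2))" "\<forall>z\<in>ball p (R/2) - E \<inter> ball p R. g z = f z"
      using local_extension[of "R/2" p] R by auto
    then show "\<exists>r g. 0 < r \<and> ball p r \<subseteq> D \<and> holo_on g (ball p r) \<and> (\<forall>z\<in>ball p r - E. g z = f z)"
      using R by (intro exI[of _ "R/2"] exI[of _ g]) (auto simp: subset_iff)
  qed
  then obtain r g where rg: "\<And>p. p \<in> D \<Longrightarrow> 0 < r p" "\<And>p. p \<in> D \<Longrightarrow> ball p (r p) \<subseteq> D"
      "\<And>p. p \<in> D \<Longrightarrow> holo_on (g p) (ball p (r p))" "\<And>p z. p \<in> D \<Longrightarrow> z \<in> ball p (r p) - E \<Longrightarrow> g p z = f z"
    by metis
  define G where "G = (\<lambda>z. g z z)"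
  have G_eq: "G z = g p z" if p: "p \<in> D" and z: "z \<in> ball p (r p)" for p z
  proof (rule ccontr)
    assume ne: "G z \<noteq> g p z"
    have zD: "z \<in> D" using rg(2) p z by blast
    define B where "B = ball p (r p) \<inter> ball z (r z)"
    define W where "W = B \<inter> (\<lambda>w. g z w - g p w) -` (- {0})"
    have "continuous_on B (\<lambda>w. g z w - g p w)"
      unfolding B_def using rg(3)[OF p] rg(3)[OF zD]
      by (intro continuous_on_diff continuous_on_subset[OF holo_on_imp_continuous_on]) auto
    then have "open W" unfolding W_def by (rule continuous_open_preimage) (auto simp: B_def open_Compl)
    moreover have "W \<subseteq> E" unfolding W_def B_def using rg(4)[OF p] rg(4)[OF zD] by force
    moreover have "z \<in> W" unfolding W_def B_def using z rg(1)[OF zD] ne G_def by simp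
    ultimately show False using sigma_codim_two_no_open[OF E(2)] by blast
  qed
  have G_f: "G z = f z" if "z \<in> D - E" for z
    unfolding G_def using rg(1,4)[of z] that by simp
  have "holo_on G D"
    unfolding holo_on_def
  proof
    fix p assume p: "p \<in> D"
    have "holo_on G (ball p (r p))"
      by (rule holo_on_cong[OF open_ball rg(3)[OF p]]) (rule G_eq[OF p])
    then show "\<exists>L. (G has_derivative L) (at p) \<and> (\<forall>c w. L (c *s w) = c * L w)"
      using rg(1)[OF p] unfolding holo_on_def by simp
  qed
  moreover have "set_integrable lborel D (\<lambda>z. (cmod (G z))\<^sup>2)"
  proof -
    have opDE: "open (D - E)" using D E(1) by (metis closedin_def openin_open_eq topspace_euclidean_subtopology)
    have "E = D - (D - E)" using \<open>E \<subseteq> D\<close> by blast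
    then have E_sets: "E \<in> sets borel" using D opDE by (metis borel_open sets.Diff)
    have "E \<in> null_sets lebesgue"
      using sigma_codim_two_negligible[OF E(2)] negligible_iff_null_sets by blast
    then have "E \<in> null_sets lborel" using E_sets null_sets_completion_iff by (metis sets_lborel)
    then have ae: "AE z in lborel. z \<notin> E" by (rule AE_not_in)
    have m: "(\<lambda>z. indicator D z *\<^sub>R (cmod (G z))\<^sup>2) \<in> borel_measurable lborel"
      using borel_measurable_continuous_on_indicator[of D "\<lambda>z. (cmod (G z))\<^sup>2"] D holo_on_imp_continuous_on[OF \<open>holo_on G D\<close>]
      by (simp add: continuous_on_power continuous_on_norm)
    have m': "(\<lambda>z. indicator (D - E) z *\<^sub>R (cmod (f z))\<^sup>2) \<in> borel_measurable lborel"
      using f(2) unfolding set_integrable_def by simp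
    have "AE z in lborel. indicator D z *\<^sub>R (cmod (G z))\<^sup>2 = indicator (D - E) z *\<^sub>R (cmod (f z))\<^sup>2"
      using ae by eventually_elim (auto simp: indicator_def G_f)
    from integrable_cong_AE[OF m m' this] show ?thesis using f(2) unfolding set_integrable_def by blast
  qed
  ultimately have "G \<in> bergman D" unfolding bergman_def by simp
  then show "\<exists>g\<in>bergman D. \<forall>z\<in>D - E. g z = f z" using G_f by blast
qed

section \<open>Bounded pointwise limits of holomorphic functions\<close>

lemma punctured_L2_bounded:
  fixes f :: "complex^'n \<Rightarrow> complex"
  assumes "open D" "bounded D" "holo_on f D" "\<And>z. z \<in> D \<Longrightarrow> cmod (f z) \<le> M"
  shows "punctured_L2 D {} f"
proof
  show "sigma_codim_two ({}::(complex^'n) set)" by (intro codim_two_imp_sigma codim_two_empty)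
  show "set_integrable lborel (D - {}) (\<lambda>z. (cmod (f z))\<^sup>2)"
    unfolding set_integrable_def
  proof (rule Bochner_Integration.integrable_bound)
    have "emeasure lborel D < \<infinity>" using assms(2) by (rule emeasure_bounded_finite)
    then show "integrable lborel (\<lambda>z. M\<^sup>2 * indicator D z)" using assms(1) by (intro integrable_mult_right) auto
    show "(\<lambda>z. indicat_real (D - {}) z *\<^sub>R (cmod (f z))\<^sup>2) \<in> borel_measurable lborel"
      using borel_measurable_continuous_on_indicator[of D "\<lambda>z. (cmod (f z))\<^sup>2"] assms(1) holo_on_imp_continuous_on[OF assms(3)]
      by (simp add: continuous_on_power continuous_on_norm)
    show "AE z in lborel. norm (indicat_real (D - {}) z *\<^sub>R (cmod (f z))\<^sup>2) \<le> norm (M\<^sup>2 * indicator D z)"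
    proof (rule AE_I2)
      fix z show "norm (indicat_real (D - {}) z *\<^sub>R (cmod (f z))\<^sup>2) \<le> norm (M\<^sup>2 * indicator D z)"
        using power_mono[OF assms(4)[of z] norm_ge_zero, of 2] by (cases "z \<in> D") auto
    qed
  qed
qed (use assms in auto)

text \<open>Dominated convergence carries the reproducing formula over to the limit, which is
  therefore a multiple of a smoothing and differentiable; complex linearity of its derivative is
  inherited from the \<open>h n\<close>.\<close>

lemma holo_on_bounded_limit:
  fixes h :: "nat \<Rightarrow> complex^'n \<Rightarrow> complex"
  assumes r: "0 < r" and h: "\<And>n. holo_on (h n) (ball p (2 * r))"
    and M: "\<And>n z. z \<in> ball p (2 * r) \<Longrightarrow> cmod (h n z) \<le> M"
    and lim: "\<And>z. z \<in> ball p (2 * r) \<Longrightarrow> (\<lambda>n. h n z) \<longlonglongrightarrow> g z"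
  shows "holo_on g (ball p r)"
proof -
  define B where "B = ball p (2 * r)"
  define q where "q = (\<lambda>n w. indicator (B - {}) w *\<^sub>R h n w)"
  define Q where "Q = (\<lambda>w. indicator (B - {}) w *\<^sub>R g w)"
  define a where "a = 1 / r\<^sup>2"
  have ar: "1 \<le> a * r\<^sup>2" and a: "0 < a" unfolding a_def using r by auto
  let ?N = "complex_of_real (kern_mass TYPE('n))"
  have N: "?N \<noteq> 0" using kern_mass_pos[where 'n='n] by simp
  have P: "punctured_L2 B {} (h n)" for n
    by (rule punctured_L2_bounded[of _ _ M]) (use h M in \<open>auto simp: B_def\<close>)
  have f0: "punctured_L2.f0 B {} (h n) = q n" for n
    unfolding q_def punctured_L2.f0_def[OF P, abs_def] ..
  have q_meas [measurable]: "q n \<in> borel_measurable borel" for n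
    using punctured_L2.f0_measurable[OF P] unfolding f0 .
  have q_int: "integrable lborel (q n)" for n
    using punctured_L2.f0_integrable[OF P] unfolding f0 .
  have q_lim: "(\<lambda>n. q n w) \<longlonglongrightarrow> Q w" for w
    unfolding q_def Q_def using lim[of w] by (cases "w \<in> B") (auto simp: B_def)
  have Q_meas [measurable]: "Q \<in> borel_measurable borel"
    by (rule borel_measurable_LIMSEQ_metric[OF _ q_lim]) simp
  have M0: "0 \<le> M" using M[of p 0] r norm_ge_zero by (metis centre_in_ball mult_pos_pos order_trans zero_less_numeral)
  have q_bd: "cmod (q n w) \<le> M * indicator B w" for n w
    unfolding q_def using M[of w n] by (cases "w \<in> B") (auto simp: B_def)
  have Q_bd: "cmod (Q w) \<le> M * indicator B w" for w
    using q_bd by (intro Lim_bounded[OF tendsto_norm[OF q_lim], of 0]) auto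
  have B_int: "integrable lborel (\<lambda>w. M * indicator B w)"
    using emeasure_bounded_finite[OF bounded_ball[of p "2 * r"]] unfolding B_def by (intro integrable_mult_right) auto
  have Q_int: "integrable lborel Q"
    by (rule Bochner_Integration.integrable_bound[OF B_int]) (use Q_bd in \<open>auto intro!: AE_I2 order_trans[OF Q_bd abs_ge_self]\<close>)
  have conv: "(\<lambda>n. \<integral>w. u w *\<^sub>R q n w \<partial>lborel) \<longlonglongrightarrow> (\<integral>w. u w *\<^sub>R Q w \<partial>lborel)"
    if [measurable]: "u \<in> borel_measurable borel" and u: "\<And>w. \<bar>u w\<bar> \<le> c" for u c
  proof (rule integral_dominated_convergence)
    show "integrable lborel (\<lambda>w. c * (M * indicator B w))" using B_int by (rule integrable_mult_right)
    show "AE w in lborel. (\<lambda>n. u w *\<^sub>R q n w) \<longlonglongrightarrow> u w *\<^sub>R Q w"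
      by (intro AE_I2 tendsto_scaleR tendsto_const q_lim)
    show "AE w in lborel. norm (u w *\<^sub>R q n w) \<le> c * (M * indicator B w)" for n
      unfolding norm_scaleR using u q_bd by (intro AE_I2 mult_mono) (auto intro: order_trans[OF abs_ge_zero u])
  qed measurable
  have sub: "cball z r \<subseteq> B" if "z \<in> ball p r" for z
  proof
    fix w assume "w \<in> cball z r"
    then show "w \<in> B" using that dist_triangle[of p w z] by (simp add: B_def)
  qed
  have kern_m: "(\<lambda>w::complex^'n. kern a (w - z)) \<in> borel_measurable borel" for z by (rule kern_measurable) simp
  have kern'_m: "(\<lambda>w::complex^'n. - kern' a (w - z) v) \<in> borel_measurable borel" for z v
    by (intro borel_measurable_uminus kern'_measurable) simp
  have kern_bd: "\<bar>kern a x\<bar> \<le> a ^ CARD('n)" for x :: "complex^'n"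
    using kern_nonneg[OF a, of x] kern_le[OF a, of x] by simp
  have kern'_bd: "\<bar>- kern' a x v\<bar> \<le> 4 * a ^ Suc CARD('n) * (1 + 1 / a) * norm v" for x v :: "complex^'n"
    using kern'_bound[OF a, of x v] by simp
  have eq: "smoothing Q a z = ?N * g z" if z: "z \<in> ball p r" for z
  proof (rule LIMSEQ_unique)
    have zB: "z \<in> B" using z r by (simp add: B_def)
    show "(\<lambda>n. smoothing (q n) a z) \<longlonglongrightarrow> smoothing Q a z"
      unfolding smoothing_def
      by (intro conv[OF kern_m, of _ "a ^ CARD('n)"] kern_bd)
    have "smoothing (q n) a z = ?N * h n z" for n
      using punctured_L2.smoothing_eq[OF P _ r sub[OF z] ar, of n] zB unfolding f0 by simp
    moreover have "(\<lambda>n. ?N * h n z) \<longlonglongrightarrow> ?N * g z"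
      using z r by (intro tendsto_mult tendsto_const lim) auto
    ultimately show "(\<lambda>n. smoothing (q n) a z) \<longlonglongrightarrow> ?N * g z" by simp
  qed
  have "holo_on (smoothing Q a) (ball p r)"
    unfolding holo_on_def
  proof
    fix z assume z: "z \<in> ball p r"
    define L where "L = (\<lambda>q v. \<integral>w. (- kern' a (w - z) v) *\<^sub>R q w \<partial>lborel :: complex)"
    have der: "(smoothing q a has_derivative L q) (at z)" if "integrable lborel q" for q
      unfolding L_def by (rule smoothing_has_derivative[OF that a])
    have Ln: "L (q n) (c *s v) = c * L (q n) v" for n c v
    proof -
      have "z \<in> {z. cball z r \<subseteq> B}" using sub[OF z] by simp
      then obtain K where K: "(smoothing (q n) a has_derivative K) (at z)" "\<And>c w. K (c *s w) = c * K w"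
        using holo_onE[OF punctured_L2.holo_on_smoothing[OF P r ar, of n, unfolded f0]] by blast
      then have "K = L (q n)" using has_derivative_unique der[OF q_int] by blast
      then show ?thesis using K(2) by simp
    qed
    have Llim: "(\<lambda>n. L (q n) v) \<longlonglongrightarrow> L Q v" for v
      unfolding L_def
      by (intro conv[OF kern'_m, of _ _ "4 * a ^ Suc CARD('n) * (1 + 1 / a) * norm v"] kern'_bd)
    have "L Q (c *s v) = c * L Q v" for c v
    proof (rule LIMSEQ_unique[OF Llim])
      show "(\<lambda>n. L (q n) (c *s v)) \<longlonglongrightarrow> c * L Q v"
        unfolding Ln by (intro tendsto_mult tendsto_const Llim)
    qed
    then show "\<exists>L. (smoothing Q a has_derivative L) (at z) \<and> (\<forall>c w. L (c *s w) = c * L w)"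
      using der[OF Q_int] by blast
  qed
  then have "holo_on (\<lambda>z. inverse ?N * smoothing Q a z) (ball p r)" by (rule holo_on_cmult)
  then show ?thesis by (rule holo_on_cong[OF open_ball]) (use eq N in simp)
qed

section \<open>Zero sets\<close>

text \<open>One-variable \<open>deriv\<close> on the complex line through \<open>z\<close> makes the
  iterates for a fixed \<open>v\<close> equal to the iterated derivatives of a slice
  function.\<close>

definition dir_deriv :: "complex^'n \<Rightarrow> (complex^'n \<Rightarrow> complex) \<Rightarrow> complex^'n \<Rightarrow> complex" where
  "dir_deriv v g z = deriv (\<lambda>\<zeta>. g (z + \<zeta> *s v)) 0"

lemma dir_deriv_eq:
  fixes g :: "complex^'n \<Rightarrow> complex"
  assumes "(g has_derivative L) (at z)" "\<And>c w. L (c *s w) = c * L w"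
  shows "dir_deriv v g z = L v"
  unfolding dir_deriv_def using has_field_derivative_line[of g L z 0 v] assms by (simp add: DERIV_imp_deriv)

lemma higher_dir_deriv_line:
  "((dir_deriv v ^^ k) g) (z + \<zeta> *s v) = (deriv ^^ k) (\<lambda>\<zeta>. g (z + \<zeta> *s v)) \<zeta>"
proof (induction k arbitrary: \<zeta>)
  case (Suc k)
  let ?G = "(dir_deriv v ^^ k) g"
  have "((dir_deriv v ^^ Suc k) g) (z + \<zeta> *s v) = deriv (\<lambda>\<xi>. ?G (z + \<zeta> *s v + \<xi> *s v)) 0"
    by (simp add: dir_deriv_def)
  also have "\<dots> = deriv ((\<lambda>x. ?G (z + x *s v)) \<circ> (\<lambda>x. \<zeta> + x)) 0"
    by (simp add: o_def vector_sadd_rdistrib add.assoc)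
  also have "\<dots> = deriv (\<lambda>x. ?G (z + x *s v)) \<zeta>" by (rule deriv_shift_0[symmetric])
  also have "(\<lambda>x. ?G (z + x *s v)) = (deriv ^^ k) (\<lambda>\<zeta>. g (z + \<zeta> *s v))"
    by (rule ext) (rule Suc.IH)
  finally show ?case by simp
qed simp

text \<open>The difference quotients are holomorphic, and the Lipschitz estimate bounds them
  uniformly, so \<open>holo_on_bounded_limit\<close> applies.\<close>

lemma holo_on_dir_deriv:
  fixes g :: "complex^'n \<Rightarrow> complex"
  assumes U: "open U" and g: "holo_on g U"
  shows "holo_on (dir_deriv v g) U"
  unfolding holo_on_def
proof
  fix p assume "p \<in> U"
  then obtain R where R: "0 < R" "cball p R \<subseteq> U" using U open_contains_cball by blast
  define \<rho> where "\<rho> = R / 2"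
  have \<rho>: "0 < \<rho>" "cball p (2 * \<rho>) \<subseteq> U" unfolding \<rho>_def using R by auto
  have "compact (g ` cball p (2 * \<rho>))"
    by (intro compact_continuous_image continuous_on_subset[OF holo_on_imp_continuous_on[OF g] \<rho>(2)]) auto
  then obtain B where B: "\<And>w. w \<in> cball p (2 * \<rho>) \<Longrightarrow> cmod (g w) \<le> B"
    by (metis bounded_iff compact_imp_bounded imageI)
  have lip: "cmod (g x - g y) \<le> B / \<rho> * norm (x - y)" if "x \<in> cball p \<rho>" "y \<in> cball p \<rho>" for x y
    using holo_lipschitz[OF g \<rho>(2,1) B that] by simp
  define \<alpha> where "\<alpha> = (\<lambda>n. inverse (real (Suc n)))"
  have \<alpha>: "0 < \<alpha> n" "real (Suc n) * \<alpha> n = 1" for n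
    unfolding \<alpha>_def by (auto simp: field_simps simp del: of_nat_Suc)
  have "(\<lambda>n. \<alpha> n * norm v) \<longlonglongrightarrow> 0 * norm v"
    unfolding \<alpha>_def by (intro tendsto_mult tendsto_const LIMSEQ_inverse_real_of_nat)
  then have "\<forall>\<^sub>F n in sequentially. \<alpha> n * norm v < \<rho> / 2"
    using \<rho>(1) by (intro order_tendstoD(2)[where y=0]) auto
  then obtain N where N: "\<And>n. n \<ge> N \<Longrightarrow> \<alpha> n * norm v < \<rho> / 2" by (auto simp: eventually_sequentially)
  \<comment> \<open>Discarding the first \<open>N\<close> quotients keeps every translate inside
    \<open>cball p \<rho>\<close>.\<close>
  define h where "h = (\<lambda>n z. of_nat (Suc (n + N)) * (g (z + \<alpha> (n + N) *\<^sub>R v) - g z))"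
  define r where "r = \<rho> / 4"
  have r: "0 < r" "2 * r = \<rho> / 2" unfolding r_def using \<rho> by auto
  have inb: "z + \<alpha> (n + N) *\<^sub>R v \<in> cball p \<rho>" "z \<in> cball p \<rho>" if "z \<in> ball p (2 * r)" for z n
  proof -
    have "dist p (z + \<alpha> (n + N) *\<^sub>R v) \<le> dist p z + norm (\<alpha> (n + N) *\<^sub>R v)"
      using dist_triangle[of p "z + \<alpha> (n + N) *\<^sub>R v" z] by (simp add: dist_norm)
    also have "norm (\<alpha> (n + N) *\<^sub>R v) < \<rho> / 2" using N[of "n + N"] \<alpha>(1)[of "n + N"] by simp
    finally show "z + \<alpha> (n + N) *\<^sub>R v \<in> cball p \<rho>" using that r by simp
    show "z \<in> cball p \<rho>" using that r \<rho> by simp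
  qed
  have sub: "cball p \<rho> \<subseteq> U" by (rule order_trans[OF subset_cball \<rho>(2)]) (use \<rho> in simp)
  have "holo_on (dir_deriv v g) (ball p r)"
  proof (rule holo_on_bounded_limit[OF r(1), of h])
    show "holo_on (h n) (ball p (2 * r))" for n
    proof -
      have "holo_on (\<lambda>z. g (z + \<alpha> (n + N) *\<^sub>R v)) (ball p (2 * r))"
        by (rule holo_on_shift[OF g]) (use inb sub in blast)
      moreover have "holo_on (\<lambda>z. (- 1) * g z) (ball p (2 * r))"
        by (intro holo_on_cmult holo_on_subset[OF g]) (use inb sub in blast)
      ultimately have "holo_on (\<lambda>z. g (z + \<alpha> (n + N) *\<^sub>R v) + (- 1) * g z) (ball p (2 * r))"
        by (rule holo_on_add)
      from holo_on_cmult[OF this, of "of_nat (Suc (n + N))"] show ?thesis unfolding h_def by simp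
    qed
    show "cmod (h n z) \<le> B / \<rho> * norm v" if z: "z \<in> ball p (2 * r)" for n z
    proof -
      have "cmod (h n z) = real (Suc (n + N)) * cmod (g (z + \<alpha> (n + N) *\<^sub>R v) - g z)"
        unfolding h_def norm_mult norm_of_nat ..
      also have "\<dots> \<le> real (Suc (n + N)) * (B / \<rho> * norm ((z + \<alpha> (n + N) *\<^sub>R v) - z))"
        using inb[OF z] by (intro mult_left_mono lip) auto
      also have "\<dots> = (real (Suc (n + N)) * \<alpha> (n + N)) * (B / \<rho> * norm v)"
        using \<alpha>(1)[of "n + N"] by (simp del: of_nat_Suc)
      finally show ?thesis unfolding \<alpha>(2) by simp
    qed
    show "(\<lambda>n. h n z) \<longlonglongrightarrow> dir_deriv v g z" if z: "z \<in> ball p (2 * r)" for z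
    proof -
      obtain L where L: "(g has_derivative L) (at z)" "\<And>c w. L (c *s w) = c * L w"
        using holo_onE[OF g] inb(2)[OF z] sub by blast
      have "(\<lambda>n. of_nat (Suc n) * (g (z + \<alpha> n *\<^sub>R v) - g z)) \<longlonglongrightarrow> L v"
        unfolding \<alpha>_def by (rule has_derivative_difference_quotient[OF L(1)])
      from LIMSEQ_ignore_initial_segment[OF this, of N] show ?thesis
        unfolding h_def dir_deriv_eq[OF L] .
    qed
  qed
  then show "\<exists>L. (dir_deriv v g has_derivative L) (at p) \<and> (\<forall>c w. L (c *s w) = c * L w)"
    using r(1) unfolding holo_on_def by simp
qed

lemma holo_on_higher_dir_deriv:
  assumes "open U" "holo_on g U"
  shows "holo_on ((dir_deriv v ^^ k) g) U"
proof (induction k)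
  case (Suc k)
  then show ?case using holo_on_dir_deriv[OF assms(1)] by simp
qed (simp add: assms(2))

lemma complex_linear_axis_expansion:
  fixes L :: "complex^'n \<Rightarrow> complex"
  assumes "linear L" "\<And>c w. L (c *s w) = c * L w"
  shows "L v = (\<Sum>j\<in>UNIV. v $ j * L (axis j 1))"
proof -
  have "v = (\<Sum>j\<in>UNIV. (v $ j) *s axis j 1)" by (simp add: basis_expansion)
  then have "L v = L (\<Sum>j\<in>UNIV. (v $ j) *s axis j 1)" by simp
  also have "\<dots> = (\<Sum>j\<in>UNIV. v $ j * L (axis j 1))" by (simp add: linear_sum[OF assms(1)] assms(2))
  finally show ?thesis .
qed

section \<open>Strict differentiability and zeros of finite order\<close>

text \<open>The partial derivatives are holomorphic, hence continuous, so the derivative of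
  \<open>g - L\<close> is small near \<open>a\<close> and the mean value inequality applies on a
  ball. This two-point estimate stands in for the implicit and inverse function theorems.\<close>

lemma holo_strict_derivative:
  fixes g :: "complex^'n \<Rightarrow> complex"
  assumes U: "open U" and g: "holo_on g U" and a: "a \<in> U"
    and L: "(g has_derivative L) (at a)" "\<And>c w. L (c *s w) = c * L w" and "0 < \<eta>"
  obtains r where "0 < r" "ball a r \<subseteq> U"
    "\<And>x y. x \<in> ball a r \<Longrightarrow> y \<in> ball a r \<Longrightarrow> cmod (g x - g y - L (x - y)) \<le> \<eta> * norm (x - y)"
proof -
  define S where "S = (\<lambda>x. \<Sum>j\<in>UNIV. cmod (dir_deriv (axis j 1) g x - dir_deriv (axis j 1) g a))"
  have "continuous (at a) S"
    unfolding S_def by (intro continuous_intros holo_on_continuous_at[OF holo_on_dir_deriv[OF U g] a])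
  then obtain r1 where r1: "0 < r1" "\<And>x. dist x a < r1 \<Longrightarrow> dist (S x) (S a) < \<eta>"
    using \<open>0 < \<eta>\<close> unfolding continuous_at_eps_delta by blast
  obtain r2 where r2: "0 < r2" "ball a r2 \<subseteq> U" using U a open_contains_ball by blast
  define r where "r = min r1 r2"
  have r: "0 < r" "ball a r \<subseteq> U" unfolding r_def using r1 r2 by auto
  have linL: "linear L" using L(1) by (rule has_derivative_linear)
  obtain K where K: "\<And>w. w \<in> U \<Longrightarrow> (g has_derivative K w) (at w)"
      "\<And>w c v. w \<in> U \<Longrightarrow> K w (c *s v) = c * K w v"
    using g unfolding holo_on_def by metis
  have bd: "onorm (\<lambda>v. K x v - L v) \<le> \<eta>" if x: "x \<in> ball a r" for x
  proof (rule onorm_le)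
    fix v
    let ?d = "\<lambda>j. dir_deriv (axis j 1) g x - dir_deriv (axis j 1) g a"
    have xU: "x \<in> U" using x r by blast
    have linK: "linear (K x)" using K(1)[OF xU] by (rule has_derivative_linear)
    have "K x v - L v = (\<Sum>j\<in>UNIV. v $ j * (K x (axis j 1) - L (axis j 1)))"
      unfolding complex_linear_axis_expansion[OF linK K(2)[OF xU], of v] complex_linear_axis_expansion[OF linL L(2), of v]
      by (simp add: sum_subtractf[symmetric] right_diff_distrib)
    also have "\<dots> = (\<Sum>j\<in>UNIV. v $ j * ?d j)"
      using dir_deriv_eq[OF K(1)[OF xU] K(2)[OF xU]] dir_deriv_eq[OF L] by simp
    finally have "cmod (K x v - L v) \<le> (\<Sum>j\<in>UNIV. cmod (v $ j) * cmod (?d j))"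
      by (simp add: norm_mult[symmetric] norm_sum)
    also have "\<dots> \<le> (\<Sum>j\<in>UNIV. norm v * cmod (?d j))"
      by (intro sum_mono mult_right_mono Finite_Cartesian_Product.norm_nth_le) auto
    also have "\<dots> = S x * norm v" unfolding S_def by (simp add: sum_distrib_left mult.commute)
    also have "\<dots> \<le> \<eta> * norm v"
    proof (rule mult_right_mono)
      have "S a = 0" unfolding S_def by simp
      then show "S x \<le> \<eta>" using r1(2)[of x] x unfolding r_def by (auto simp: dist_real_def dist_commute)
    qed simp
    finally show "cmod (K x v - L v) \<le> \<eta> * norm v" .
  qed
  show ?thesis
  proof (rule that[OF r])
    fix x y assume xy: "x \<in> ball a r" "y \<in> ball a r"
    have "norm ((g x - L x) - (g y - L y)) \<le> \<eta> * norm (x - y)"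
    proof (rule differentiable_bound[of "ball a r" "\<lambda>x. g x - L x" "\<lambda>x v. K x v - L v"])
      show "((\<lambda>x. g x - L x) has_derivative (\<lambda>v. K w v - L v)) (at w within ball a r)" if "w \<in> ball a r" for w
        by (rule has_derivative_at_withinI, rule has_derivative_diff[OF K(1) linear_imp_has_derivative[OF linL]])
           (use that r(2) in blast)
    qed (use xy bd in auto)
    then show "cmod (g x - g y - L (x - y)) \<le> \<eta> * norm (x - y)"
      by (simp add: linear_diff[OF linL] algebra_simps)
  qed
qed

text \<open>For two zeros near \<open>a\<close> the strict derivative makes \<open>L (z - w)\<close>
  small compared with \<open>z - w\<close>, whereas \<open>L (s *s u)\<close> has modulus
  \<open>b * norm s\<close>. Thus \<open>u\<close> is uniformly transversal to the zero set, as
  \<open>codim_two_transversal\<close> requires.\<close>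

lemma sigma_codim_two_regular_zeros:
  fixes g :: "complex^'n \<Rightarrow> complex"
  assumes U: "open U" and g: "holo_on g U"
  shows "sigma_codim_two {z \<in> U. g z = 0 \<and> dir_deriv v g z \<noteq> 0}" (is "sigma_codim_two ?S")
proof (rule sigma_codim_two_locally)
  fix a assume "a \<in> ?S"
  then have a: "a \<in> U" "g a = 0" "dir_deriv v g a \<noteq> 0" by auto
  obtain L where L: "(g has_derivative L) (at a)" "\<And>c w. L (c *s w) = c * L w"
    using holo_onE[OF g a(1)] by blast
  have lin: "linear L" using L(1) by (rule has_derivative_linear)
  have Lv: "L v \<noteq> 0" using a(3) dir_deriv_eq[OF L] by simp
  then have "v \<noteq> 0" using linear_0[OF lin] by auto
  define u where "u = inverse (of_real (norm v)) *s v"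
  have u: "norm u = 1" unfolding u_def using \<open>v \<noteq> 0\<close> by (simp add: norm_smult norm_inverse)
  have Lu: "L u \<noteq> 0" unfolding u_def L(2) using Lv \<open>v \<noteq> 0\<close> by simp
  define b where "b = cmod (L u)"
  have b: "0 < b" unfolding b_def using Lu by simp
  obtain \<Lambda> where \<Lambda>: "0 \<le> \<Lambda>" "\<And>x. cmod (L x) \<le> \<Lambda> * norm x"
    using bounded_linear.nonneg_bounded[OF has_derivative_bounded_linear[OF L(1)]] by (metis mult.commute)
  obtain r where r: "0 < r" "ball a r \<subseteq> U"
      "\<And>x y. x \<in> ball a r \<Longrightarrow> y \<in> ball a r \<Longrightarrow> cmod (g x - g y - L (x - y)) \<le> b / 2 * norm (x - y)"
    using holo_strict_derivative[OF U g a(1) L, of "b / 2"] b by auto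
  \<comment> \<open>Arises from solving \<open>norm s * b \<le> \<Lambda> * norm ?y + b / 2 * (norm
    ?y + norm s)\<close> for \<open>norm s\<close>; the tolerance \<open>b / 2\<close> above allows
    the last term to be absorbed.\<close>
  define C where "C = (2 * \<Lambda> + b) / b"
  have C: "0 \<le> C" unfolding C_def using \<Lambda>(1) b by simp
  have key: "norm s \<le> C * norm (z - w + s *s u)"
    if z: "z \<in> ball a r" "g z = 0" and w: "w \<in> ball a r" "g w = 0" for z w s
  proof -
    let ?y = "z - w + s *s u"
    have "s * L u = L ?y - L (z - w)" by (simp add: linear_add[OF lin] L(2))
    then have "norm s * b = cmod (L ?y - L (z - w))" unfolding b_def by (metis norm_mult)
    also have "\<dots> \<le> cmod (L ?y) + cmod (L (z - w))" by (rule norm_triangle_ineq4)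
    also have "cmod (L (z - w)) \<le> b / 2 * norm (z - w)" using r(3)[OF z(1) w(1)] z w by simp
    also have "norm (z - w) \<le> norm ?y + norm s"
      using norm_triangle_ineq4[of ?y "s *s u"] u by (simp add: norm_smult)
    also have "cmod (L ?y) \<le> \<Lambda> * norm ?y" by (rule \<Lambda>(2))
    finally have "norm s * b \<le> \<Lambda> * norm ?y + b / 2 * (norm ?y + norm s)" using b by simp
    then have "norm s * b \<le> (2 * \<Lambda> + b) * norm ?y" by (simp add: algebra_simps)
    then show ?thesis unfolding C_def using b by (simp add: field_simps)
  qed
  have "codim_two {z \<in> ball a r. g z = 0}"
  proof (rule codim_two_transversal[where \<iota>="\<lambda>s. s *s u" and c="1 / (1 + C)"])
    show "bounded {z \<in> ball a r. g z = 0}" by (rule bounded_subset[OF bounded_ball]) auto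
    show "linear (\<lambda>s. s *s u)" using bounded_linear_smult_left bounded_linear.linear by blast
    show "0 < 1 / (1 + C)" using C by simp
    show "norm (s *s u) = norm s" for s using u by (simp add: norm_smult)
    fix z w s assume zw: "z \<in> {z \<in> ball a r. g z = 0}" "w \<in> {z \<in> ball a r. g z = 0}"
    let ?y = "z - w + s *s u"
    have k: "norm s \<le> C * norm ?y" using key zw by blast
    also have "\<dots> \<le> (1 + C) * norm ?y" by (intro mult_right_mono) auto
    finally show "1 / (1 + C) * norm s \<le> norm ?y" using C by (simp add: field_simps)
    have "norm (z - w) \<le> norm ?y + norm s"
      using norm_triangle_ineq4[of ?y "s *s u"] u by (simp add: norm_smult)
    also have "\<dots> \<le> (1 + C) * norm ?y" using k by (simp add: algebra_simps)
    finally show "1 / (1 + C) * norm (z - w) \<le> norm ?y" using C by (simp add: field_simps)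
  qed
  then have "sigma_codim_two (?S \<inter> ball a r)"
    by (rule codim_two_imp_sigma[OF codim_two_subset]) auto
  then show "\<exists>W. open W \<and> a \<in> W \<and> sigma_codim_two (?S \<inter> W)"
    using r(1) by (intro exI[of _ "ball a r"]) auto
qed

text \<open>The one-variable identity theorem on the slice through \<open>a\<close> in direction
  \<open>v\<close>: convexity of \<open>U\<close> makes the parameter set \<open>V\<close>
  connected, and it contains 0 and 1.\<close>

lemma holo_eq_0_if_higher_dir_deriv_0:
  fixes g :: "complex^'n \<Rightarrow> complex"
  assumes U: "open U" "convex U" and g: "holo_on g U" and ab: "a \<in> U" "a + v \<in> U"
    and der: "\<And>k. ((dir_deriv v ^^ k) g) a = 0"
  shows "g (a + v) = 0"
proof -
  define V where "V = (\<lambda>\<zeta>. a + \<zeta> *s v) -` U"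
  have cont: "continuous_on UNIV (\<lambda>\<zeta>. a + \<zeta> *s v)"
    by (intro continuous_on_add continuous_on_const linear_continuous_on bounded_linear_smult_left)
  have "open V" unfolding V_def using cont U(1) by (simp add: continuous_on_open_vimage)
  moreover have "convex V"
  proof (rule convexI)
    fix x y s t assume xy: "x \<in> V" "y \<in> V" "0 \<le> s" "0 \<le> t" "s + t = (1::real)"
    have "a = s *\<^sub>R a + t *\<^sub>R a" using xy(5) by (metis scaleR_add_left scaleR_one)
    then have "a + (s *\<^sub>R x + t *\<^sub>R y) *s v = s *\<^sub>R (a + x *s v) + t *\<^sub>R (a + y *s v)"
      by (simp add: vec_eq_iff algebra_simps)
    also have "\<dots> \<in> U" using xy U(2) unfolding V_def by (auto intro!: convexD)
    finally show "s *\<^sub>R x + t *\<^sub>R y \<in> V" unfolding V_def by simp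
  qed
  ultimately have V: "open V" "connected V" using convex_connected by auto
  have "(\<lambda>\<zeta>. g (a + \<zeta> *s v)) holomorphic_on V"
    by (rule holomorphic_on_line[OF g]) (simp add: V_def)
  then have "g (a + 1 *s v) = 0"
  proof (rule holomorphic_fun_eq_0_on_connected[OF _ V, of "\<lambda>\<zeta>. g (a + \<zeta> *s v)" 0 1])
    show "(deriv ^^ k) (\<lambda>\<zeta>. g (a + \<zeta> *s v)) 0 = 0" for k
      using higher_dir_deriv_line[of k v g a 0] der by simp
  qed (use ab in \<open>auto simp: V_def\<close>)
  then show ?thesis by simp
qed

text \<open>A direction that detects one zero may fail at another; but for each zero the good
  directions contain a nonempty open set, so countably many dense directions suffice.\<close>

lemma sigma_codim_two_zeros:
  fixes h :: "complex^'n \<Rightarrow> complex"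
  assumes U: "open U" "convex U" and h: "holo_on h U" and b: "b \<in> U" "h b \<noteq> 0"
  shows "sigma_codim_two {z \<in> U. h z = 0}"
proof -
  obtain Q :: "(complex^'n) set" where Q: "countable Q" "\<And>X. open X \<Longrightarrow> X \<noteq> {} \<Longrightarrow> \<exists>d\<in>Q. d \<in> X"
    by (rule countable_dense_setE) blast
  let ?h = "\<lambda>v k. (dir_deriv v ^^ k) h"
  let ?S = "\<lambda>(v, k). {z \<in> U. ?h v k z = 0 \<and> dir_deriv v (?h v k) z \<noteq> 0}"
  have "{z \<in> U. h z = 0} \<subseteq> (\<Union>i\<in>Q \<times> UNIV. ?S i)"
  proof
    fix z assume "z \<in> {z \<in> U. h z = 0}"
    then have z: "z \<in> U" "h z = 0" by auto
    \<comment> \<open>The directions \<open>v\<close> for which \<open>z + v\<close> lies in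
      \<open>U\<close> and \<open>h\<close> is nonzero there.\<close>
    define X where "X = (+) (- z) ` (U \<inter> h -` (- {0}))"
    have "open (U \<inter> h -` (- {0}))"
      by (rule continuous_open_preimage[OF holo_on_imp_continuous_on[OF h] U(1)]) (simp add: open_Compl)
    then have "open X" unfolding X_def by (rule open_translation)
    moreover have "X \<noteq> {}" unfolding X_def using b by blast
    ultimately obtain v where v: "v \<in> Q" "v \<in> X" using Q(2) by blast
    then have v': "z + v \<in> U" "h (z + v) \<noteq> 0" unfolding X_def by auto
    then obtain k where "?h v k z \<noteq> 0"
      using holo_eq_0_if_higher_dir_deriv_0[OF U h z(1), of v] by blast
    \<comment> \<open>At the least order with a nonzero derivative, the derivative one order lower
      vanishes at \<open>z\<close> but has nonzero directional derivative there. This order is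
      positive since \<open>h z = 0\<close>.\<close>
    then have "\<exists>k. ?h v k z \<noteq> 0 \<and> (\<forall>m<k. ?h v m z = 0)" using exists_least_iff[of "\<lambda>k. ?h v k z \<noteq> 0"] by blast
    then obtain k where k: "?h v k z \<noteq> 0" "\<And>m. m < k \<Longrightarrow> ?h v m z = 0" by blast
    have "k \<noteq> 0" using k(1) z(2) by (metis funpow_0)
    then obtain m where m: "k = Suc m" using not0_implies_Suc by blast
    have "z \<in> ?S (v, m)" using z k m by simp
    then show "z \<in> (\<Union>i\<in>Q \<times> UNIV. ?S i)" using v(1) by blast
  qed
  moreover have "sigma_codim_two (\<Union>i\<in>Q \<times> UNIV. ?S i)"
    using Q(1) by (intro sigma_codim_two_UN)
      (auto split: prod.splits intro!: sigma_codim_two_regular_zeros U holo_on_higher_dir_deriv h)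
  ultimately show ?thesis by (rule sigma_codim_two_subset[rotated])
qed

section \<open>Identity theorem on connected open sets\<close>

text \<open>On a ball where \<open>g\<close> is not identically zero its zeros form a null set. So a
  ball meeting the interior of the zero set consists of zeros; this makes that interior relatively
  closed, and connectedness finishes.\<close>

lemma holo_eq_0_connected:
  fixes g :: "complex^'n \<Rightarrow> complex"
  assumes U: "open U" "connected U" and g: "holo_on g U"
    and W: "open W" "W \<noteq> {}" "W \<subseteq> U" "\<And>z. z \<in> W \<Longrightarrow> g z = 0" and "z \<in> U"
  shows "g z = 0"
proof -
  define A where "A = {x \<in> U. \<exists>r>0. ball x r \<subseteq> U \<and> (\<forall>w\<in>ball x r. g w = 0)}"
  have open_A: "open A"
    unfolding open_contains_ball
  proof
    fix x assume "x \<in> A"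
    then obtain r where r: "r > 0" "ball x r \<subseteq> U" "\<forall>w\<in>ball x r. g w = 0" unfolding A_def by blast
    have "y \<in> A" if y: "y \<in> ball x r" for y
    proof -
      obtain s where "s > 0" "ball y s \<subseteq> ball x r" using openE[OF open_ball y] by blast
      then show ?thesis unfolding A_def using r y by blast
    qed
    then show "\<exists>e>0. ball x e \<subseteq> A" using r(1) by blast
  qed
  have ball_zero: "g w = 0" if H: "ball x R \<subseteq> U" "y \<in> A" "y \<in> ball x R" "w \<in> ball x R" for x R y w
  proof (rule ccontr)
    assume "g w \<noteq> 0"
    then have s: "sigma_codim_two {z \<in> ball x R. g z = 0}"
      using H(4) by (intro sigma_codim_two_zeros[OF open_ball convex_ball holo_on_subset[OF g H(1)]]) auto
    obtain r where r: "r > 0" "\<forall>w\<in>ball y r. g w = 0" using H(2) unfolding A_def by blast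
    have "ball y r \<inter> ball x R = {}"
      by (rule sigma_codim_two_no_open[OF s]) (use r in auto)
    then show False using H(3) r(1) by (metis IntI centre_in_ball empty_iff)
  qed
  have "open (U - A)"
    unfolding open_contains_ball
  proof
    fix x assume x: "x \<in> U - A"
    then obtain R where R: "R > 0" "ball x R \<subseteq> U" using U(1) open_contains_ball by blast
    have "ball x R \<inter> A = {}"
    proof (rule ccontr)
      assume "ball x R \<inter> A \<noteq> {}"
      then obtain y where "y \<in> ball x R" "y \<in> A" by blast
      then have "x \<in> A" using ball_zero[OF R(2)] R x unfolding A_def by blast
      then show False using x by blast
    qed
    then show "\<exists>e>0. ball x e \<subseteq> U - A" using R by blast
  qed
  moreover have "A \<noteq> {}"
  proof -
    obtain x where x: "x \<in> W" using W(2) by blast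
    then obtain r where "r > 0" "ball x r \<subseteq> W" using W(1) open_contains_ball by blast
    then have "x \<in> A" unfolding A_def using W x by blast
    then show ?thesis by blast
  qed
  moreover have "A \<subseteq> U" unfolding A_def by blast
  ultimately have "A = U" using connectedD[OF U(2) open_A, of "U - A"] by blast
  then have "z \<in> A" using \<open>z \<in> U\<close> by blast
  then show ?thesis unfolding A_def by auto
qed

section \<open>Images and preimages under holomorphic maps\<close>

definition jac_matrix :: "(complex^'n \<Rightarrow> complex^'n) \<Rightarrow> complex^'n \<Rightarrow> complex^'n^'n" where
  "jac_matrix F z = (\<chi> i j. dir_deriv (axis j 1) (\<lambda>z. F z $ i) z)"

lemma holo_on_det_jac:
  assumes "open U" "holo_map_on F U"
  shows "holo_on (\<lambda>z. det (jac_matrix F z)) U"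
  unfolding det_def jac_matrix_def using assms unfolding holo_map_on_def
  by (auto intro!: holo_on_sum holo_on_mult holo_on_const holo_on_prod holo_on_dir_deriv)

lemma jac_matrix_component:
  fixes F :: "complex^'n \<Rightarrow> complex^'n"
  assumes L: "((\<lambda>z. F z $ i) has_derivative L) (at a)" "\<And>c w. L (c *s w) = c * L w"
  shows "L h = (jac_matrix F a *v h) $ i"
proof -
  have "L h = (\<Sum>j\<in>UNIV. h $ j * L (axis j 1))"
    by (rule complex_linear_axis_expansion[OF has_derivative_linear[OF L(1)] L(2)])
  also have "\<dots> = (jac_matrix F a *v h) $ i"
    unfolding matrix_vector_mult_def jac_matrix_def using dir_deriv_eq[OF L] by (simp add: mult.commute)
  finally show ?thesis .
qed

lemma holo_map_has_derivative:
  fixes F :: "complex^'n \<Rightarrow> complex^'n"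
  assumes "holo_map_on F U" "a \<in> U"
  shows "(F has_derivative (\<lambda>h. jac_matrix F a *v h)) (at a)"
proof -
  have "((\<lambda>z. F z $ i) has_derivative (\<lambda>h. (jac_matrix F a *v h) $ i)) (at a)" for i
  proof -
    have "holo_on (\<lambda>z. F z $ i) U" using assms(1) unfolding holo_map_on_def by blast
    then obtain L where L: "((\<lambda>z. F z $ i) has_derivative L) (at a)" "\<And>c w. L (c *s w) = c * L w"
      using holo_onE assms(2) by blast
    have "L = (\<lambda>h. (jac_matrix F a *v h) $ i)" using jac_matrix_component[OF L] by blast
    then show ?thesis using L(1) by simp
  qed
  then have "((\<lambda>z. F z $ i \<bullet> u) has_derivative (\<lambda>h. (jac_matrix F a *v h) $ i \<bullet> u)) (at a)" for i u
    by (intro has_derivative_inner_left)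
  then show ?thesis
    by (subst has_derivative_componentwise_within) (auto simp: Basis_vec_def inner_axis)
qed

lemma holo_map_strict_derivative:
  fixes F :: "complex^'n \<Rightarrow> complex^'n"
  assumes U: "open U" and F: "holo_map_on F U" and a: "a \<in> U" and "0 < \<eta>"
  obtains r where "0 < r" "ball a r \<subseteq> U"
    "\<And>x y. x \<in> ball a r \<Longrightarrow> y \<in> ball a r \<Longrightarrow> norm (F x - F y - jac_matrix F a *v (x - y)) \<le> \<eta> * norm (x - y)"
proof -
  \<comment> \<open>The norm is at most the sum of the moduli of the components, hence the division
    by their number.\<close>
  define \<eta>' where "\<eta>' = \<eta> / CARD('n)"
  have \<eta>': "0 < \<eta>'" unfolding \<eta>'_def using \<open>0 < \<eta>\<close> by simp
  have "\<exists>r>0. ball a r \<subseteq> U \<and> (\<forall>x\<in>ball a r. \<forall>y\<in>ball a r.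
      cmod ((F x - F y - jac_matrix F a *v (x - y)) $ i) \<le> \<eta>' * norm (x - y))" for i
  proof -
    have g: "holo_on (\<lambda>z. F z $ i) U" using F unfolding holo_map_on_def by blast
    obtain L where L: "((\<lambda>z. F z $ i) has_derivative L) (at a)" "\<And>c w. L (c *s w) = c * L w"
      using holo_onE[OF g a] by blast
    obtain r where "0 < r" "ball a r \<subseteq> U"
        "\<And>x y. x \<in> ball a r \<Longrightarrow> y \<in> ball a r \<Longrightarrow> cmod (F x $ i - F y $ i - L (x - y)) \<le> \<eta>' * norm (x - y)"
      using holo_strict_derivative[OF U g a L \<eta>'] by blast
    then show ?thesis unfolding jac_matrix_component[OF L] by auto
  qed
  then obtain r where r: "\<And>i. 0 < r i" "\<And>i. ball a (r i) \<subseteq> U" "\<And>i x y. x \<in> ball a (r i) \<Longrightarrow> y \<in> ball a (r i) \<Longrightarrow>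
      cmod ((F x - F y - jac_matrix F a *v (x - y)) $ i) \<le> \<eta>' * norm (x - y)"
    by metis
  define R where "R = Min (range r)"
  have R: "0 < R" "\<And>i. R \<le> r i" unfolding R_def using r(1) by auto
  show ?thesis
  proof (rule that[OF R(1)])
    have "ball a R \<subseteq> ball a (r undefined)" by (rule subset_ball[OF R(2)])
    then show "ball a R \<subseteq> U" using r(2) by blast
    fix x y assume xy: "x \<in> ball a R" "y \<in> ball a R"
    let ?v = "F x - F y - jac_matrix F a *v (x - y)"
    have "norm ?v \<le> (\<Sum>i\<in>UNIV. cmod (?v $ i))" unfolding norm_vec_def by (rule L2_set_le_sum) simp
    also have "\<dots> \<le> (\<Sum>i\<in>(UNIV::'n set). \<eta>' * norm (x - y))"
      using xy R(2) subset_ball by (intro sum_mono r(3)) blast+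
    also have "\<dots> = \<eta> * norm (x - y)" unfolding \<eta>'_def by simp
    finally show "norm ?v \<le> \<eta> * norm (x - y)" .
  qed
qed

lemma holo_map_locally_lipschitz:
  fixes F :: "complex^'n \<Rightarrow> complex^'n"
  assumes U: "open U" and F: "holo_map_on F U" and a: "a \<in> U"
  shows "\<exists>W L. open W \<and> a \<in> W \<and> (\<forall>x\<in>W. \<forall>y\<in>W. dist (F x) (F y) \<le> L * dist x y)"
proof -
  obtain r where r: "0 < r" "ball a r \<subseteq> U"
    "\<And>x y. x \<in> ball a r \<Longrightarrow> y \<in> ball a r \<Longrightarrow> norm (F x - F y - jac_matrix F a *v (x - y)) \<le> 1 * norm (x - y)"
    using holo_map_strict_derivative[OF U F a, of 1] by auto
  obtain K where K: "\<And>h. norm (jac_matrix F a *v h) \<le> norm h * K"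
    using bounded_linear.bounded[OF has_derivative_bounded_linear[OF holo_map_has_derivative[OF F a]]] by blast
  have "dist (F x) (F y) \<le> (1 + K) * dist x y" if "x \<in> ball a r" "y \<in> ball a r" for x y
  proof -
    have "norm (F x - F y) \<le> norm (F x - F y - jac_matrix F a *v (x - y)) + norm (jac_matrix F a *v (x - y))"
      using norm_triangle_ineq[of "F x - F y - jac_matrix F a *v (x - y)" "jac_matrix F a *v (x - y)"] by simp
    also have "\<dots> \<le> 1 * norm (x - y) + norm (x - y) * K" by (intro add_mono r(3) K that)
    finally show ?thesis by (simp add: dist_norm algebra_simps)
  qed
  then show ?thesis using r(1) by (intro exI[of _ "ball a r"] exI[of _ "1 + K"]) auto
qed

text \<open>At an invertible Jacobian matrix, strict differentiability gives
  \<open>c / 2 * norm (x - y) \<le> norm (F x - F y)\<close> nearby. The preimage is therefore the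
  image of a part of \<open>S\<close> under an inverse with Lipschitz constant
  \<open>2 / c\<close>.\<close>

lemma sigma_codim_two_vimage:
  fixes F :: "complex^'n \<Rightarrow> complex^'n"
  assumes U: "open U" and F: "holo_map_on F U" and a: "a \<in> U" "det (jac_matrix F a) \<noteq> 0"
    and S: "sigma_codim_two S"
  shows "\<exists>r>0. sigma_codim_two (ball a r \<inter> F -` S)"
proof -
  let ?A = "jac_matrix F a"
  have lin: "linear (\<lambda>h. ?A *v h)"
    using has_derivative_linear[OF holo_map_has_derivative[OF F a(1)]] .
  have "invertible ?A" using a(2) invertible_det_nz by blast
  then have "\<And>x. ?A *v x = 0 \<Longrightarrow> x = 0"
    unfolding invertible_left_inverse matrix_left_invertible_ker by blast
  then have "inj (\<lambda>h. ?A *v h)" using linear_injective_0[OF lin] by blast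
  then obtain c where c: "c > 0" "\<And>h. c * norm h \<le> norm (?A *v h)"
    using linear_inj_bounded_below_pos[OF lin] by blast
  obtain r where r: "0 < r" "ball a r \<subseteq> U"
    "\<And>x y. x \<in> ball a r \<Longrightarrow> y \<in> ball a r \<Longrightarrow> norm (F x - F y - ?A *v (x - y)) \<le> c / 2 * norm (x - y)"
    using holo_map_strict_derivative[OF U F a(1), of "c / 2"] c(1) by auto
  have exp: "c / 2 * norm (x - y) \<le> norm (F x - F y)" if "x \<in> ball a r" "y \<in> ball a r" for x y
  proof -
    have "c * norm (x - y) \<le> norm (?A *v (x - y))" by (rule c(2))
    also have "\<dots> \<le> norm (F x - F y) + norm (F x - F y - ?A *v (x - y))"
      using norm_triangle_ineq4[of "F x - F y" "F x - F y - ?A *v (x - y)"] by simp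
    finally show ?thesis using r(3)[OF that] by (simp add: field_simps)
  qed
  have "inj_on F (ball a r)"
  proof (rule inj_onI)
    fix x y assume "x \<in> ball a r" "y \<in> ball a r" "F x = F y"
    then have "c / 2 * norm (x - y) \<le> 0" using exp[of x y] by simp
    then show "x = y" using c(1) by (simp add: mult_le_0_iff)
  qed
  then have inv: "inv_into (ball a r) F (F x) = x" if "x \<in> ball a r" for x using that by simp
  have "sigma_codim_two (inv_into (ball a r) F ` (S \<inter> F ` ball a r))"
  proof (rule sigma_codim_two_lipschitz_image[where L="2 / c"])
    show "sigma_codim_two (S \<inter> F ` ball a r)" by (rule sigma_codim_two_subset[OF S]) auto
    fix u v assume "u \<in> S \<inter> F ` ball a r" "v \<in> S \<inter> F ` ball a r"
    then obtain x y where xy: "x \<in> ball a r" "u = F x" "y \<in> ball a r" "v = F y" by blast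
    show "dist (inv_into (ball a r) F u) (inv_into (ball a r) F v) \<le> 2 / c * dist u v"
      unfolding xy(2,4) inv[OF xy(1)] inv[OF xy(3)] dist_norm using exp[OF xy(1,3)] c(1) by (simp add: field_simps)
  qed
  moreover have "ball a r \<inter> F -` S \<subseteq> inv_into (ball a r) F ` (S \<inter> F ` ball a r)"
  proof
    fix x assume "x \<in> ball a r \<inter> F -` S"
    then show "x \<in> inv_into (ball a r) F ` (S \<inter> F ` ball a r)"
      by (intro image_eqI[of _ _ "F x"]) (auto simp: inv)
  qed
  ultimately show ?thesis using r(1) sigma_codim_two_subset by blast
qed

text \<open>The library's Sard lemma needs a well-ordered index type; \<open>'n bit0\<close> is one of the right size.\<close>
lemma negligible_critical_values:
  fixes F :: "complex^'n \<Rightarrow> complex^'n"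
  assumes F: "\<And>z. z \<in> S \<Longrightarrow> (F has_derivative (\<lambda>h. A z *v h)) (at z)"
    and det: "\<And>z. z \<in> S \<Longrightarrow> det (A z) = 0"
  shows "negligible (F ` S)"
proof -
  have dim: "DIM(complex^'n) = DIM(real^('n bit0))" by simp
  obtain T :: "complex^'n \<Rightarrow> real^('n bit0)" and T' where T: "linear T" "linear T'"
      "\<And>x. T' (T x) = x" "\<And>y. T (T' y) = y"
    using isomorphisms_UNIV_UNIV[OF dim] by metis
  have "negligible ((T \<circ> F \<circ> T') ` (T ` S))"
  proof (rule baby_Sard[where f'="\<lambda>y h. T (A (T' y) *v T' h)"])
    fix y assume y: "y \<in> T ` S"
    then have z: "T' y \<in> S" using T(3) by auto
    have d1: "(T' has_derivative T') (at y)" by (rule linear_imp_has_derivative[OF T(2)])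
    have "((\<lambda>y. F (T' y)) has_derivative (\<lambda>h. A (T' y) *v T' h)) (at y)"
      by (rule has_derivative_compose[OF d1 F[OF z]])
    from has_derivative_compose[OF this linear_imp_has_derivative[OF T(1)]]
    have der: "((\<lambda>y. T (F (T' y))) has_derivative (\<lambda>h. T (A (T' y) *v T' h))) (at y)" .
    then show "((T \<circ> F \<circ> T') has_derivative (\<lambda>h. T (A (T' y) *v T' h))) (at y within T ` S)"
      unfolding o_def by (rule has_derivative_at_withinI)
    let ?f' = "\<lambda>h. T (A (T' y) *v T' h)"
    have lin: "linear ?f'" using der by (rule has_derivative_linear)
    \<comment> \<open>A singular complex matrix kills a nonzero vector; transported by
      \<open>T\<close>, that vector shows that the real map is not injective, so its real rank is
      deficient.\<close>
    have "\<not> invertible (A (T' y))" using det[OF z] invertible_det_nz by blast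
    then obtain x where x: "A (T' y) *v x = 0" "x \<noteq> 0"
      unfolding invertible_left_inverse matrix_left_invertible_ker by blast
    have "?f' (T x) = 0" using x(1) T(3) linear_0[OF T(1)] by simp
    moreover have "T x \<noteq> 0" using x(2) T(3)[of x] linear_0[OF T(2)] by metis
    ultimately have "\<not> inj ?f'" using linear_injective_0[OF lin] by blast
    then have "\<not> inj ((*v) (matrix ?f'))" using matrix_vector_mul(2)[OF lin] by simp
    then show "rank (matrix ?f') < CARD('n bit0)"
      using full_rank_injective[of "matrix ?f'"] rank_bound[of "matrix ?f'"] by (simp add: less_le)
  qed simp
  then have "negligible (T' ` ((T \<circ> F \<circ> T') ` (T ` S)))"
    by (rule negligible_differentiable_image_negligible[rotated])
       (auto simp: T(2) linear_imp_differentiable_on)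
  moreover have "T' ` ((T \<circ> F \<circ> T') ` (T ` S)) = F ` S"
    unfolding image_image by (simp add: T)
  ultimately show ?thesis by simp
qed

theorem theorem1p3:
  fixes \<Omega> E :: "(complex^'n) set" and F :: "complex^'n \<Rightarrow> complex^'n"
  assumes "domain \<Omega>" and "bounded \<Omega>"
    and "good_zero_variety \<Omega> E"
    and "holo_on_closure F \<Omega>"
    and "interior (F ` \<Omega>) \<noteq> {}"
  shows "L2a_removable \<Omega> {z\<in>\<Omega>. F z \<in> F ` closure E} \<and>
    (\<forall>D. domain D \<and> F ` \<Omega> \<subseteq> D \<longrightarrow> L2a_removable D (F ` closure E \<inter> D))"
proof -
  have \<Omega>: "open \<Omega>" "connected \<Omega>" using assms(1) unfolding domain_def by auto
  obtain U where U: "open U" "closure \<Omega> \<subseteq> U" "holo_map_on F U"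
    using assms(4) unfolding holo_on_closure_def by blast
  obtain f where f: "holo_on f \<Omega>" "\<not> (\<exists>c. \<forall>z\<in>\<Omega>. f z = c)" "E = {z \<in> \<Omega>. f z = 0}"
    using assms(3) unfolding good_zero_variety_def zero_variety_def by blast
  have \<Omega>U: "\<Omega> \<subseteq> U" using U(2) closure_subset by blast
  have cE: "closure E \<subseteq> closure \<Omega>" unfolding f(3) by (intro closure_mono) auto
  \<comment> \<open>Goodness is used at every point of \<open>closure E\<close>, boundary points of
    \<Omega> included: near each of them the closure lies in the zero set of a local
    \<open>h\<close>.\<close>
  have sE: "sigma_codim_two (closure E)"
  proof (rule sigma_codim_two_locally)
    fix p assume p: "p \<in> closure E"
    then obtain r h where rh: "r > 0" "holo_on h (ball p r)"
        "ball p r \<inter> closure E = {z \<in> ball p r \<inter> closure \<Omega>. h z = 0}"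
      using assms(3) cE unfolding good_zero_variety_def by blast
    \<comment> \<open>If \<open>h\<close> vanished identically, \<open>closure E\<close> would
      contain all of \<open>closure \<Omega>\<close> near \<open>p\<close>; then \<open>f\<close>
      would vanish on a nonempty open part of \<Omega>, hence on \<Omega>, and be constant.\<close>
    have "\<exists>b\<in>ball p r. h b \<noteq> 0"
    proof (rule ccontr)
      assume "\<not> (\<exists>b\<in>ball p r. h b \<noteq> 0)"
      then have sub: "ball p r \<inter> closure \<Omega> \<subseteq> closure E" using rh(3) by blast
      have "f z = 0" if z: "z \<in> ball p r \<inter> \<Omega>" for z
      proof -
        \<comment> \<open>\<open>E\<close> is relatively closed in \<Omega>, so passing to the
          closure adds no points of \<Omega>.\<close>
        have "closedin (top_of_set \<Omega>) (\<Omega> \<inter> f -` {0})"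
          by (rule continuous_closedin_preimage[OF holo_on_imp_continuous_on[OF f(1)]]) simp
        then obtain C where C: "closed C" "\<Omega> \<inter> f -` {0} = \<Omega> \<inter> C" by (auto simp: closedin_closed)
        have "E \<subseteq> C" using C(2) f(3) by auto
        then have "closure E \<subseteq> C" using C(1) by (rule closure_minimal)
        then have "z \<in> \<Omega> \<inter> C" using z sub closure_subset by blast
        then show ?thesis using C(2) by blast
      qed
      moreover have "ball p r \<inter> \<Omega> \<noteq> {}"
        using p cE rh(1) by (metis centre_in_ball disjoint_iff in_mono open_Int_closure_eq_empty open_ball)
      ultimately have "\<forall>z\<in>\<Omega>. f z = 0"
        using holo_eq_0_connected[OF \<Omega> f(1), of "ball p r \<inter> \<Omega>"] \<Omega>(1) by blast
      then show False using f(2) by blast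
    qed
    then have "sigma_codim_two {z \<in> ball p r. h z = 0}"
      using sigma_codim_two_zeros[OF open_ball convex_ball rh(2)] by blast
    then have "sigma_codim_two (closure E \<inter> ball p r)"
      by (rule sigma_codim_two_subset) (use rh(3) in blast)
    then show "\<exists>W. open W \<and> p \<in> W \<and> sigma_codim_two (closure E \<inter> W)"
      using rh(1) by (intro exI[of _ "ball p r"]) auto
  qed
  have sFE: "sigma_codim_two (F ` closure E)"
    by (rule sigma_codim_two_locally_lipschitz_image[OF sE])
       (use holo_map_locally_lipschitz[OF U(1,3)] cE U(2) in blast)
  have contF: "continuous_on U F"
    using holo_map_has_derivative[OF U(3)] has_derivative_continuous continuous_at_imp_continuous_on by blast
  have "bounded E" using assms(2) unfolding f(3) by (rule bounded_subset) auto
  \<comment> \<open>Compactness makes the image under \<open>F\<close> closed, hence relatively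
    closed in every domain.\<close>
  then have "compact (closure E)" by (simp add: compact_closure)
  then have "compact (F ` closure E)"
    by (intro compact_continuous_image continuous_on_subset[OF contF]) (use cE U(2) in blast)
  then have closed: "closed (F ` closure E)" by (rule compact_imp_closed)
  have J: "holo_on (\<lambda>z. det (jac_matrix F z)) \<Omega>"
    by (rule holo_on_subset[OF holo_on_det_jac[OF U(1,3)] \<Omega>U])
  \<comment> \<open>A Jacobian determinant vanishing on one ball vanishes on \<Omega> by
    connectedness. All values of \<open>F\<close> on \<Omega> would then be critical and form a
    negligible set, against the interior point.\<close>
  have J0: "\<exists>b\<in>ball p r. det (jac_matrix F b) \<noteq> 0" if p: "r > 0" "ball p r \<subseteq> \<Omega>" for p r
  proof (rule ccontr)
    assume "\<not> (\<exists>b\<in>ball p r. det (jac_matrix F b) \<noteq> 0)"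
    then have "det (jac_matrix F z) = 0" if "z \<in> \<Omega>" for z
      using holo_eq_0_connected[OF \<Omega> J open_ball _ p(2) _ that] p(1) by auto
    then have "negligible (F ` \<Omega>)"
      using holo_map_has_derivative[OF U(3)] \<Omega>U by (intro negligible_critical_values[where A="jac_matrix F"]) auto
    then have "negligible (interior (F ` \<Omega>))" using negligible_subset interior_subset by blast
    then show False using assms(5) open_not_negligible by blast
  qed
  let ?A = "{z \<in> \<Omega>. F z \<in> F ` closure E}"
  have sA: "sigma_codim_two ?A"
  proof (rule sigma_codim_two_locally)
    fix p assume "p \<in> ?A"
    then have p: "p \<in> \<Omega>" by simp
    obtain r where r: "r > 0" "ball p r \<subseteq> \<Omega>" using \<Omega>(1) p open_contains_ball by blast
    obtain b where "b \<in> ball p r" "det (jac_matrix F b) \<noteq> 0" using J0[OF r] by blast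
    then have crit: "sigma_codim_two {z \<in> ball p r. det (jac_matrix F z) = 0}"
      by (intro sigma_codim_two_zeros[OF open_ball convex_ball holo_on_subset[OF J r(2)]])
    have "sigma_codim_two {z \<in> ?A \<inter> ball p r. det (jac_matrix F z) \<noteq> 0}" (is "sigma_codim_two ?B")
    \<comment> \<open>Regular points may accumulate at the critical set, so the radius on which
      \<open>F\<close> is bi-Lipschitz depends on \<open>a\<close>; hence the second
      localisation.\<close>
    proof (rule sigma_codim_two_locally)
      fix a assume a: "a \<in> ?B"
      then have "a \<in> U" "det (jac_matrix F a) \<noteq> 0" using \<Omega>U by auto
      then obtain s where s: "s > 0" "sigma_codim_two (ball a s \<inter> F -` (F ` closure E))"
        using sigma_codim_two_vimage[OF U(1,3) _ _ sFE] by blast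
      have "sigma_codim_two (?B \<inter> ball a s)" by (rule sigma_codim_two_subset[OF s(2)]) auto
      then show "\<exists>W. open W \<and> a \<in> W \<and> sigma_codim_two (?B \<inter> W)"
        using s(1) by (intro exI[of _ "ball a s"]) auto
    qed
    from sigma_codim_two_Un[OF crit this] have "sigma_codim_two (?A \<inter> ball p r)"
      by (rule sigma_codim_two_subset) auto
    then show "\<exists>W. open W \<and> p \<in> W \<and> sigma_codim_two (?A \<inter> W)"
      using r(1) by (intro exI[of _ "ball p r"]) auto
  qed
  have "closedin (top_of_set \<Omega>) (\<Omega> \<inter> F -` (F ` closure E))"
    by (rule continuous_closedin_preimage[OF continuous_on_subset[OF contF \<Omega>U] closed])
  moreover have "\<Omega> \<inter> F -` (F ` closure E) = ?A" by blast
  ultimately have "L2a_removable \<Omega> ?A"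
    using L2a_removable_if_sigma_codim_two[OF \<Omega>(1) _ sA] by simp
  moreover have "L2a_removable D (F ` closure E \<inter> D)" if "domain D" for D
  proof (rule L2a_removable_if_sigma_codim_two)
    show "open D" using that unfolding domain_def by simp
    show "closedin (top_of_set D) (F ` closure E \<inter> D)"
      using closed by (auto simp: closedin_closed)
    show "sigma_codim_two (F ` closure E \<inter> D)" by (rule sigma_codim_two_subset[OF sFE]) auto
  qed
  ultimately show ?thesis by blast
qed

end
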